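(* Let $\varphi:\mathfrak{n}\to\mathbb{C}$ be a good character, let $I$ be an ideal of $A=S(Z)=\mathbb{C}[x_{(1,0)}]$, and let $V=M_\varphi/IM_\varphi$, with $w'\in V$ the image of the cyclic Whittaker vector $w=1\otimes 1$ of $M_\varphi$. Then every Whittaker vector of $V$ (of type $\varphi$) is of the form $pw'$ with $p\in A$.
   Context: Let $\mathcal{B}$ be the complex Lie algebra with basis $\{x_{(a,i)} : a\in\mathbb{Z},\ i\in\mathbb{N}\}$, $\mathbb{N}=\{0,1,2,\dots\}$, and bracket $[x_{(a,i)},x_{(b,j)}]=\big((b-1)i-(a-1)j\big)x_{(a+b,\,i+j-1)}$ (the coefficient is $0$ when $i=j=0$). Let $\mathfrak{n}=\mathrm{Span}_{\mathbb{C}}\{x_{(a,i)} : a+i>1\}$, a Lie subalgebra. Let $Z=\mathbb{C}x_{(1,0)}$ be the center of $\mathcal{B}$ and $A=S(Z)=\mathbb{C}[x_{(1,0)}]\subset\mathcal{U}(\mathcal{B})$, where $\mathcal{U}(\cdot)$ denotes the universal enveloping algebra. Let $\varphi:\mathfrak{n}\to\mathbb{C}$ be a Lie algebra homomorphism ($\mathbb{C}$ abelian). It is nonsingular if $\varphi(x_{(a,i)})\neq 0$ for all $(a,i)$ with $i\ge 0$ and $a+i=2$. For integers $n\ge1$, $s\ge 1$, let $H^{(n,s)}$ be the $\infty\times(n+1)$ matrix with rows indexed by $m\ge1$ and columns by $0\le j\le n$, whose $(m,j)$ entry is $\varphi(x_{(2-a,a)})$ with $a=m+j+s-1$. The homomorphism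 $\varphi$ is a good character if it is nonsingular and $\mathrm{rank}(H^{(n,s)})=n+1$ for all $n\ge1$, $s\ge1$. For a $\mathcal{B}$-module $V$, a vector $v\in V$ is a Whittaker vector of type $\varphi$ if $xv=\varphi(x)v$ for all $x\in\mathfrak{n}$. Let $\mathbb{C}_\varphi$ be the one-dimensional $\mathfrak{n}$-module on which $x\in\mathfrak{n}$ acts by $\varphi(x)$, let $M_\varphi=\mathcal{U}(\mathcal{B})\otimes_{\mathcal{U}(\mathfrak{n})}\mathbb{C}_\varphi$, and $w=1\otimes1\in M_\varphi$. *)

theory Defs
  imports
    Complex_Main
    "HOL-Library.Poly_Mapping"
    "HOL-Library.Function_Algebras"
    "HOL-Algebra.Generated_Groups"
    "HOL-Algebra.Generated_Rings"
    "HOL-Algebra.QuotRing"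
    "HOL-Algebra.Module"
begin

section \<open>The Lie algebra \<open>\<B>\<close> and the subalgebra \<open>\<nn>\<close>\<close>

text \<open>\<open>\<B>\<close> is the complex vector space of finitely supported functions on the index set of its
  basis, so the \<open>xB a i\<close> below are a basis by construction.\<close>

type_synonym lieB = "(int \<times> nat) \<Rightarrow>\<^sub>0 complex"

definition xB :: "int \<Rightarrow> nat \<Rightarrow> lieB"
  where "xB a i = Poly_Mapping.single (a, i) 1"

definition scaleB :: "complex \<Rightarrow> lieB \<Rightarrow> lieB"  (infixr \<open>*\<^sub>B\<close> 75)
  where "c *\<^sub>B f = Poly_Mapping.map ((*) c) f"

text \<open>Bilinear extension of the bracket on the basis.  The truncated subtraction \<open>i + j - 1\<close> is
  harmless, since the coefficient vanishes if \<open>i = j = 0\<close>.\<close>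

definition bracket :: "lieB \<Rightarrow> lieB \<Rightarrow> lieB"
  where "bracket f g =
    (\<Sum>(a, i)\<in>Poly_Mapping.keys f. \<Sum>(b, j)\<in>Poly_Mapping.keys g.
       Poly_Mapping.single (a + b, i + j - 1)
         (Poly_Mapping.lookup f (a, i) * Poly_Mapping.lookup g (b, j)
            * of_int ((b - 1) * int i - (a - 1) * int j)))"

definition \<nn> :: "lieB set"
  where "\<nn> = {f. \<forall>(a, i)\<in>Poly_Mapping.keys f. a + int i > 1}"


section \<open>Universal enveloping algebras\<close>

text \<open>The free monoid on \<open>'a\<close>, written additively so that \<open>'a free_monoid \<Rightarrow>\<^sub>0 complex\<close>, with the
  convolution product of the library, is the free associative complex algebra on the set \<open>'a\<close>.\<close>

datatype 'a free_monoid = Free_Monoid (letters: "'a list")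

instantiation free_monoid :: (type) monoid_add
begin
definition "0 = Free_Monoid []"
definition "u + v = Free_Monoid (letters u @ letters v)"
instance
  by standard (simp_all add: zero_free_monoid_def plus_free_monoid_def)
end

type_synonym 'a free_alg = "'a free_monoid \<Rightarrow>\<^sub>0 complex"

definition free_algebra :: "'a set \<Rightarrow> 'a free_alg ring"
  where "free_algebra S =
    \<lparr>carrier = {f. \<forall>u\<in>Poly_Mapping.keys f. set (letters u) \<subseteq> S},
     mult = (*), one = 1, zero = 0, add = (+)\<rparr>"

definition gen :: "'a \<Rightarrow> 'a free_alg"
  where "gen y = Poly_Mapping.single (Free_Monoid [y]) 1"

definition const :: "complex \<Rightarrow> 'a free_alg"
  where "const c = Poly_Mapping.single 0 c"

text \<open>For a Lie subalgebra \<open>L\<close> of \<open>\<B>\<close>: the free algebra on the underlying set of \<open>L\<close> modulo the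
  first two families of relations is the tensor algebra of the vector space \<open>L\<close>, and the third
  family cuts out the enveloping algebra.\<close>

definition uea_relations :: "lieB set \<Rightarrow> lieB free_alg set"
  where "uea_relations L =
    {gen (y + z) - (gen y + gen z) | y z. y \<in> L \<and> z \<in> L} \<union>
    {gen (c *\<^sub>B y) - const c * gen y | c y. y \<in> L} \<union>
    {gen y * gen z - gen z * gen y - gen (bracket y z) | y z. y \<in> L \<and> z \<in> L}"

definition uea_ideal :: "lieB set \<Rightarrow> lieB free_alg set"
  where "uea_ideal L = Idl\<^bsub>free_algebra L\<^esub> (uea_relations L)"

definition uea :: "lieB set \<Rightarrow> lieB free_alg set ring"  (\<open>\<U>\<close>)
  where "\<U> L = free_algebra L Quot uea_ideal L"

definition uea_class :: "lieB set \<Rightarrow> lieB free_alg \<Rightarrow> lieB free_alg set"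
  where "uea_class L f = uea_ideal L +>\<^bsub>free_algebra L\<^esub> f"

text \<open>The homomorphism \<open>\<U> L \<rightarrow> \<U> \<B>\<close> induced by the inclusion \<open>L \<subseteq> \<B>\<close>; its value is the common
  class in \<open>\<U> \<B>\<close> of all representatives.\<close>

definition uea_inclusion :: "lieB free_alg set \<Rightarrow> lieB free_alg set"
  where "uea_inclusion u = (\<Union>f\<in>u. uea_class UNIV f)"

abbreviation UB :: "lieB free_alg set ring"
  where "UB \<equiv> \<U> UNIV"

definition lie_elt :: "lieB \<Rightarrow> lieB free_alg set"
  where "lie_elt y = uea_class UNIV (gen y)"

definition scalar :: "complex \<Rightarrow> lieB free_alg set"
  where "scalar c = uea_class UNIV (const c)"

text \<open>\<open>A = S(Z) = \<complex>[x\<^sub>(\<^sub>1\<^sub>,\<^sub>0\<^sub>)]\<close>, the unital complex subalgebra of \<open>\<U> \<B>\<close> generated by the central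
  element \<open>xB 1 0\<close>.\<close>

definition AZ :: "lieB free_alg set set"
  where "AZ = generate_ring UB (range scalar \<union> {lie_elt (xB 1 0)})"


section \<open>Modules over a noncommutative ring\<close>

text \<open>Left modules use the record of HOL-Algebra, of which only the fields \<open>carrier\<close>, \<open>zero\<close>, \<open>add\<close>
  and \<open>smult\<close> are relevant (the library locale \<open>module\<close> requires a commutative ring).\<close>

definition quotient_module :: "('r, 'm) module \<Rightarrow> 'm set \<Rightarrow> ('r, 'm set) module"
  where "quotient_module M N =
    \<lparr>carrier = a_rcosets\<^bsub>M\<^esub> N, mult = undefined, one = undefined, zero = N, add = set_add M,
     smult = (\<lambda>r C. \<Union>m\<in>C. N +>\<^bsub>M\<^esub> (r \<odot>\<^bsub>M\<^esub> m))\<rparr>"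

definition ideal_smult :: "'r set \<Rightarrow> ('r, 'm) module \<Rightarrow> 'm set"
  where "ideal_smult I M = generate (add_monoid M) {r \<odot>\<^bsub>M\<^esub> m | r m. r \<in> I \<and> m \<in> carrier M}"

text \<open>\<open>S \<otimes>\<^sub>R N\<close> for a ring homomorphism \<open>h: R \<rightarrow> S\<close> and a left \<open>R\<close>-module \<open>N\<close>, where \<open>R\<close> acts on \<open>S\<close> from
  the right through \<open>h\<close>: the free abelian group on \<open>S \<times> N\<close> modulo the relations of a balanced
  biadditive map, with \<open>S\<close> acting by left multiplication on the first factor.\<close>

definition tensor_free :: "'s ring \<Rightarrow> ('r, 'n) module \<Rightarrow> ('s, 's \<times> 'n \<Rightarrow>\<^sub>0 int) module"
  where "tensor_free S N =
    \<lparr>carrier = {f. Poly_Mapping.keys f \<subseteq> carrier S \<times> carrier N},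
     mult = undefined, one = undefined, zero = 0, add = (+),
     smult = (\<lambda>s. frag_extend (\<lambda>(t, n). frag_of (s \<otimes>\<^bsub>S\<^esub> t, n)))\<rparr>"

definition tensor_relations ::
    "'r ring \<Rightarrow> 's ring \<Rightarrow> ('r \<Rightarrow> 's) \<Rightarrow> ('r, 'n) module \<Rightarrow> ('s \<times> 'n \<Rightarrow>\<^sub>0 int) set"
  where "tensor_relations R S h N =
    {frag_of (s \<oplus>\<^bsub>S\<^esub> t, n) - (frag_of (s, n) + frag_of (t, n)) | s t n.
       s \<in> carrier S \<and> t \<in> carrier S \<and> n \<in> carrier N} \<union>
    {frag_of (s, m \<oplus>\<^bsub>N\<^esub> n) - (frag_of (s, m) + frag_of (s, n)) | s m n.
       s \<in> carrier S \<and> m \<in> carrier N \<and> n \<in> carrier N} \<union>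
    {frag_of (s \<otimes>\<^bsub>S\<^esub> h r, n) - frag_of (s, r \<odot>\<^bsub>N\<^esub> n) | s r n.
       s \<in> carrier S \<and> r \<in> carrier R \<and> n \<in> carrier N}"

definition tensor_kernel ::
    "'r ring \<Rightarrow> 's ring \<Rightarrow> ('r \<Rightarrow> 's) \<Rightarrow> ('r, 'n) module \<Rightarrow> ('s \<times> 'n \<Rightarrow>\<^sub>0 int) set"
  where "tensor_kernel R S h N =
    generate (add_monoid (tensor_free S N)) (tensor_relations R S h N)"

definition tensor_module ::
    "'r ring \<Rightarrow> 's ring \<Rightarrow> ('r \<Rightarrow> 's) \<Rightarrow> ('r, 'n) module \<Rightarrow> ('s, ('s \<times> 'n \<Rightarrow>\<^sub>0 int) set) module"
  where "tensor_module R S h N = quotient_module (tensor_free S N) (tensor_kernel R S h N)"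

definition pure_tensor ::
    "'r ring \<Rightarrow> 's ring \<Rightarrow> ('r \<Rightarrow> 's) \<Rightarrow> ('r, 'n) module \<Rightarrow> 's \<Rightarrow> 'n \<Rightarrow> ('s \<times> 'n \<Rightarrow>\<^sub>0 int) set"
  where "pure_tensor R S h N s n =
    tensor_kernel R S h N +>\<^bsub>tensor_free S N\<^esub> frag_of (s, n)"


section \<open>Good characters\<close>

text \<open>Only the restriction of \<open>\<phi>\<close> to \<open>\<nn>\<close> matters.  The last clause is compatibility with brackets, the
  bracket of \<open>\<complex>\<close> being zero.\<close>

definition lie_character :: "(lieB \<Rightarrow> complex) \<Rightarrow> bool"
  where "lie_character \<phi> \<longleftrightarrow>
    (\<forall>y\<in>\<nn>. \<forall>z\<in>\<nn>. \<phi> (y + z) = \<phi> y + \<phi> z) \<and>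
    (\<forall>c. \<forall>y\<in>\<nn>. \<phi> (c *\<^sub>B y) = c * \<phi> y) \<and>
    (\<forall>y\<in>\<nn>. \<forall>z\<in>\<nn>. \<phi> (bracket y z) = 0)"

definition nonsingular :: "(lieB \<Rightarrow> complex) \<Rightarrow> bool"
  where "nonsingular \<phi> \<longleftrightarrow> (\<forall>a i. a + int i = 2 \<longrightarrow> \<phi> (xB a i) \<noteq> 0)"

definition hankel :: "(lieB \<Rightarrow> complex) \<Rightarrow> nat \<Rightarrow> nat \<Rightarrow> nat \<Rightarrow> complex"
  where "hankel \<phi> s m j = (let a = m + j + s - 1 in \<phi> (xB (2 - int a) a))"

text \<open>Rank of a matrix with arbitrary sets of row and column indices, as the dimension of the column
  space inside the space of functions of the row index (extended by \<open>0\<close> off the row set).\<close>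

definition matrix_rank :: "nat set \<Rightarrow> nat set \<Rightarrow> (nat \<Rightarrow> nat \<Rightarrow> complex) \<Rightarrow> nat"
  where "matrix_rank rows cols H =
    vector_space.dim (\<lambda>c (f :: nat \<Rightarrow> complex) m. c * f m)
      ((\<lambda>j m. if m \<in> rows then H m j else 0) ` cols)"

definition good_character :: "(lieB \<Rightarrow> complex) \<Rightarrow> bool"
  where "good_character \<phi> \<longleftrightarrow> lie_character \<phi> \<and> nonsingular \<phi> \<and>
    (\<forall>n\<ge>1. \<forall>s\<ge>1. matrix_rank {1..} {0..n} (hankel \<phi> s) = n + 1)"


section \<open>Whittaker modules\<close>

text \<open>The algebra homomorphism \<open>\<U> \<nn> \<rightarrow> \<complex>\<close> extending \<open>\<phi>\<close>; all representatives of a class have the same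
  value.\<close>

definition uea_character :: "(lieB \<Rightarrow> complex) \<Rightarrow> lieB free_alg set \<Rightarrow> complex"
  where "uea_character \<phi> u = the_elem ((\<lambda>f. \<Sum>v\<in>Poly_Mapping.keys f.
    Poly_Mapping.lookup f v * prod_list (map \<phi> (letters v))) ` u)"

definition C_mod :: "(lieB \<Rightarrow> complex) \<Rightarrow> (lieB free_alg set, complex) module"
  where "C_mod \<phi> = \<lparr>carrier = UNIV, mult = (*), one = 1, zero = 0, add = (+),
    smult = (\<lambda>u c. uea_character \<phi> u * c)\<rparr>"

type_synonym whit = "(lieB free_alg set \<times> complex \<Rightarrow>\<^sub>0 int) set"

definition M_whit :: "(lieB \<Rightarrow> complex) \<Rightarrow> (lieB free_alg set, whit) module"
  where "M_whit \<phi> = tensor_module (\<U> \<nn>) UB uea_inclusion (C_mod \<phi>)"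

definition w_whit :: "(lieB \<Rightarrow> complex) \<Rightarrow> whit"
  where "w_whit \<phi> = pure_tensor (\<U> \<nn>) UB uea_inclusion (C_mod \<phi>) \<one>\<^bsub>UB\<^esub> 1"

definition V_whit :: "(lieB \<Rightarrow> complex) \<Rightarrow> lieB free_alg set set \<Rightarrow> (lieB free_alg set, whit set) module"
  where "V_whit \<phi> I = quotient_module (M_whit \<phi>) (ideal_smult I (M_whit \<phi>))"

definition w_quot :: "(lieB \<Rightarrow> complex) \<Rightarrow> lieB free_alg set set \<Rightarrow> whit set"
  where "w_quot \<phi> I = ideal_smult I (M_whit \<phi>) +>\<^bsub>M_whit \<phi>\<^esub> w_whit \<phi>"

text \<open>A \<open>\<B>\<close>-module is given as a left module over \<open>\<U> \<B>\<close>.\<close>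

definition whittaker_vector ::
    "(lieB \<Rightarrow> complex) \<Rightarrow> (lieB free_alg set, 'v) module \<Rightarrow> 'v \<Rightarrow> bool"
  where "whittaker_vector \<phi> V v \<longleftrightarrow> v \<in> carrier V \<and>
    (\<forall>y\<in>\<nn>. lie_elt y \<odot>\<^bsub>V\<^esub> v = scalar (\<phi> y) \<odot>\<^bsub>V\<^esub> v)"

end

theory Submission
  imports Defs "HOL-Library.Product_Lexorder" "HOL-Library.Multiset" "HOL-Computational_Algebra.Polynomial"
begin

text \<open>
  Straightening words identifies \<open>M\<^sub>\<phi>\<close> with the polynomials over \<open>A = \<complex>[t]\<close>, \<open>t = x\<^sub>(\<^sub>1\<^sub>,\<^sub>0\<^sub>)\<close>, in the
  remaining \<open>x\<^sub>(\<^sub>a\<^sub>,\<^sub>i\<^sub>)\<close> with \<open>a + i \<le> 1\<close>, and \<open>I M\<^sub>\<phi>\<close> with the polynomials whose coefficients lie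
  in \<open>I\<close>.  Let \<open>v\<close> be a Whittaker vector, reduced modulo \<open>I\<close>, and suppose that its top part \<open>P\<close> has
  size \<open>r \<ge> 1\<close>.  Apply \<open>E\<^sub>i - \<phi>(E\<^sub>i)\<close> with \<open>E\<^sub>i = x\<^sub>(\<^sub>2\<^sub>-\<^sub>i\<^sub>,\<^sub>i\<^sub>)\<close> and \<open>i\<close> large.  A variable \<open>y\<close> with
  \<open>a + i < 1\<close> becomes a variable \<open>[E\<^sub>i, y]\<close> that does not occur in \<open>v\<close>, with coefficient a nonzero
  multiple of \<open>\<partial>P/\<partial>y\<close>; so \<open>P\<close> involves only the \<open>z\<^sub>j = x\<^sub>(\<^sub>1\<^sub>-\<^sub>j\<^sub>,\<^sub>j\<^sub>)\<close>.  The terms of size \<open>r - 1\<close>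
  without new variables are then \<open>\<Sum>\<^sub>j -j \<phi>(x\<^sub>(\<^sub>3\<^sub>-\<^sub>i\<^sub>-\<^sub>j\<^sub>,\<^sub>i\<^sub>+\<^sub>j\<^sub>-\<^sub>1\<^sub>)) \<partial>P/\<partial>z\<^sub>j\<close>, and since they vanish for all
  large \<open>i\<close>, the rank condition forces \<open>\<partial>P/\<partial>z\<^sub>j = 0\<close> for all \<open>j\<close>, a contradiction.
\<close>

section \<open>Straightening words\<close>

text \<open>That sorted words span is the easy half; the obstacle is their independence over
  \<open>A\<close>, also modulo \<open>I\<close>, as the tensor product is given by generators and
  relations. So a module is built on the polynomials: a letter acts by being put in front of a
  sorted word, which is then straightened. This is a module only if the result does not depend on
  the order of the steps, as in the diamond lemma: overlapping descents are resolved by the Jacobi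
  identity, and letters of \<nn> at the end by the vanishing of \<phi> on brackets. The tensor
  product maps to this module (\<open>Psi\<close>), and straightening recovers a tensor from its
  image.

  The final relations have coefficients in \<complex>[t], while the rank condition is over
  \<complex>. Since \<complex>[t] is a principal ideal domain, taking remainders modulo a generator
  and comparing coefficients of powers of \<open>t\<close> gives relations over \<complex>. Large
  \<open>i\<close> serves twice: it makes the variables \<open>[E_i, y]\<close> new, and it turns
  the relations into those of a Hankel matrix whose shift \<open>s\<close> lies beyond all indices
  in \<open>v\<close>.\<close>

fun inversions :: "'a::linorder list \<Rightarrow> nat"
  where
    "inversions [] = 0"
  | "inversions (x # w) = length (filter (\<lambda>y. y < x) w) + inversions w"

lemma inversions_swap:
  assumes "y < x"
  shows "inversions (u @ y # x # v) < inversions (u @ x # y # v)"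
  using assms by (induction u) auto

lemma not_sorted_descent:
  assumes "\<not> sorted w"
  shows "\<exists>u x y v. w = u @ x # y # v \<and> y < (x::'a::linorder)"
proof -
  obtain i where i: "Suc i < length w" "\<not> w ! i \<le> w ! Suc i"
    using assms by (auto simp: sorted_iff_nth_Suc)
  have "w = take i w @ w ! i # w ! Suc i # drop (Suc (Suc i)) w"
    using i by (metis Cons_nth_drop_Suc Suc_lessD append_take_drop_id)
  then show ?thesis using i by (metis not_le)
qed

text \<open>The critical pairs of the rewriting: two descents of one word coincide, share a letter
  on either side, or are disjoint on either side.\<close>

lemma append_two_eq_append_two:
  assumes "u @ x # y # v = u' @ x' # y' # v'"
  obtains (same) "u' = u" "x' = x" "y' = y" "v' = v"
    | (left_overlap) "u' = u @ [x]" "x' = y" "v = y' # v'"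
    | (left) w where "u' = u @ x # y # w" "v = w @ x' # y' # v'"
    | (right_overlap) "u = u' @ [x']" "x = y'" "v' = y # v"
    | (right) w where "u = u' @ x' # y' # w" "v' = w @ x # y # v"
proof -
  from assms obtain us where
    "u = u' @ us \<and> us @ x # y # v = x' # y' # v' \<or> u @ us = u' \<and> x # y # v = us @ x' # y' # v'"
    by (auto simp: append_eq_append_conv2)
  then show thesis
  proof
    assume a: "u = u' @ us \<and> us @ x # y # v = x' # y' # v'"
    show thesis
    proof (cases us)
      case Nil then show ?thesis using a same by auto
    next
      case (Cons c us')
      show ?thesis
      proof (cases us')
        case Nil then show ?thesis using a Cons right_overlap by auto
      next
        case (Cons d us'')
        then show ?thesis using a \<open>us = c # us'\<close> right by auto
      qed
    qed
  next
    assume a: "u @ us = u' \<and> x # y # v = us @ x' # y' # v'"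
    show thesis
    proof (cases us)
      case Nil then show ?thesis using a same by auto
    next
      case (Cons c us')
      show ?thesis
      proof (cases us')
        case Nil then show ?thesis using a Cons left_overlap by auto
      next
        case (Cons d us'')
        then show ?thesis using a \<open>us = c # us'\<close> left by auto
      qed
    qed
  qed
qed

text \<open>Brackets of letters are multiples \<open>coef x y\<close> of single letters
  \<open>br x y\<close>. A positive letter at the end of a word is to be replaced by its value under
  \<open>chi\<close>, and \<open>pos_upward\<close> brings the positive letters of a sorted word to
  its end. In \<open>jacobi\<close> the map \<open>g\<close> is arbitrary because iterated brackets
  with coefficient 0 may be unrelated letters.\<close>

locale straightening =
  fixes coef :: "'a::linorder \<Rightarrow> 'a \<Rightarrow> complex"
    and br :: "'a \<Rightarrow> 'a \<Rightarrow> 'a"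
    and pos :: "'a \<Rightarrow> bool"
    and chi :: "'a \<Rightarrow> complex"
    and scale :: "complex \<Rightarrow> 'm::ab_group_add \<Rightarrow> 'm"
    and nv :: "'a list \<Rightarrow> 'm"
  assumes scale_add: "scale c (p + q) = scale c p + scale c q"
    and scale_add_left: "scale (c + d) p = scale c p + scale d p"
    and scale_scale: "scale c (scale d p) = scale (c * d) p"
    and coef_skew: "coef y x = - coef x y"
    and br_commute: "br y x = br x y"
    and jacobi: "scale (coef x y * coef (br x y) z) (g (br (br x y) z))
        + scale (coef y z * coef (br y z) x) (g (br (br y z) x))
        + scale (coef z x * coef (br z x) y) (g (br (br z x) y)) = 0"
    and pos_upward: "pos x \<Longrightarrow> x \<le> y \<Longrightarrow> pos y"
    and chi_br: "pos x \<Longrightarrow> pos y \<Longrightarrow> coef x y \<noteq> 0 \<Longrightarrow> pos (br x y) \<and> chi (br x y) = 0"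
begin

lemma scale_zero: "scale c 0 = 0" using scale_add[of c 0 0] by simp
lemma scale_zero_left: "scale 0 p = 0" using scale_add_left[of 0 0 p] by simp
lemma scale_minus_left: "scale (- c) p = - scale c p"
  using scale_add_left[of c "- c" p] by (simp add: scale_zero_left eq_neg_iff_add_eq_0 add.commute)

definition descent :: "'a list \<Rightarrow> 'a list \<times> 'a \<times> 'a \<times> 'a list"
  where "descent w = (SOME (u, x, y, v). w = u @ x # y # v \<and> y < x)"

lemma descent:
  assumes "\<not> sorted w" "descent w = (u, x, y, v)"
  shows "w = u @ x # y # v" "y < x"
proof -
  have "\<exists>p. case p of (u, x, y, v) \<Rightarrow> w = u @ x # y # v \<and> y < x"
    using not_sorted_descent[OF assms(1)] by auto
  from someI_ex[OF this] show "w = u @ x # y # v" "y < x"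
    using assms(2) by (auto simp: descent_def)
qed

lemma descent':
  assumes "(u, x, y, v) = descent w" "\<not> sorted w"
  shows "w = u @ x # y # v \<and> y < x"
  using descent[OF assms(2) assms(1)[symmetric]] by blast

text \<open>A deterministic strategy: evaluating a positive last letter takes precedence, then one
  chosen descent is swapped. Independence of the choice is the content of
  \<open>swap_rule\<close>.\<close>

function straighten :: "'a list \<Rightarrow> 'm"
  where "straighten w =
    (if w \<noteq> [] \<and> pos (last w) then scale (chi (last w)) (straighten (butlast w))
     else if sorted w then nv w
     else let (u, x, y, v) = descent w in
       straighten (u @ y # x # v) + scale (coef x y) (straighten (u @ br x y # v)))"
  by auto
termination
  \<comment> \<open>Evaluating a letter and taking a bracket shorten the word; a swap keeps the
    length and lowers the number of inversions.\<close>
  by (relation "measures [length, inversions]") (auto dest: descent' simp: inversions_swap)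

declare straighten.simps[simp del]

lemma straighten_snoc_pos: "pos x \<Longrightarrow> straighten (u @ [x]) = scale (chi x) (straighten u)"
  by (subst straighten.simps) simp

lemma straighten_sorted: "sorted w \<Longrightarrow> \<forall>x\<in>set w. \<not> pos x \<Longrightarrow> straighten w = nv w"
  by (subst straighten.simps) auto

text \<open>Hides the chosen descent: the swap case treats an arbitrary one. Combined with
  \<open>straighten_swap\<close>, this is how most later properties of \<open>straighten\<close> are
  proved.\<close>

lemma straighten_induct [case_names snoc_pos swap sorted]:
  assumes "\<And>u x. pos x \<Longrightarrow> P u \<Longrightarrow> P (u @ [x])"
    and "\<And>u x y v. y < x \<Longrightarrow> P (u @ y # x # v) \<Longrightarrow> P (u @ br x y # v) \<Longrightarrow> P (u @ x # y # v)"
    and "\<And>w. sorted w \<Longrightarrow> \<forall>x\<in>set w. \<not> pos x \<Longrightarrow> P w"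
  shows "P w"
proof (induction w rule: straighten.induct)
  case (1 w)
  show ?case
  proof (cases "w \<noteq> [] \<and> pos (last w)")
    case True
    then show ?thesis using 1(1) assms(1)[of "last w" "butlast w"] by simp
  next
    case np: False
    show ?thesis
    proof (cases "sorted w")
      case True
      \<comment> \<open>The last letter of a sorted word is its largest, so it is positive as soon
        as some letter is.\<close>
      have "\<not> pos x" if "x \<in> set w" for x
      proof
        assume "pos x"
        moreover have "x \<le> last w"
          using True that by (cases w rule: rev_cases) (auto simp: sorted_append)
        ultimately show False using pos_upward np that by (metis empty_iff empty_set)
      qed
      then show ?thesis using assms(3) True by blast
    next
      case False
      obtain u x y v where d: "descent w = (u, x, y, v)" by (cases "descent w") auto
      note dd = descent[OF False d]
      have "P (u @ y # x # v)" using 1(2)[OF np False d[symmetric]] by simp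
      moreover have "P (u @ br x y # v)" using 1(3)[OF np False d[symmetric]] by simp
      ultimately show ?thesis using assms(2) dd by metis
    qed
  qed
qed

section \<open>Confluence of the straightening\<close>

definition swap_rule :: "'a list \<Rightarrow> 'a \<Rightarrow> 'a \<Rightarrow> 'a list \<Rightarrow> bool"
  where "swap_rule u x y v \<longleftrightarrow>
    straighten (u @ x # y # v) = straighten (u @ y # x # v) + scale (coef x y) (straighten (u @ br x y # v))"

lemma swap_rule_commute: "swap_rule u x y v \<Longrightarrow> swap_rule u y x v"
  by (simp add: swap_rule_def coef_skew[of y x] br_commute[of y x] scale_minus_left)

lemma swap_rule_refl: "swap_rule u x x v"
proof -
  have "coef x x = 0" using coef_skew[of x x] by simp
  then show ?thesis by (simp add: swap_rule_def scale_zero_left)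
qed

text \<open>The overlap ambiguity. Both sides are carried on to the word with \<open>z\<close>,
  \<open>y\<close>, \<open>x\<close> in this order, the left one by the first two rules of
  \<open>low\<close> and the right one by the last two. Words containing a bracket are one letter
  shorter, so \<open>short\<close> reorders them; what is left over is the sum of the three iterated
  brackets, which is zero by \<open>jacobi\<close>.\<close>

lemma overlap_consistent:
  assumes short: "\<And>u' a b v'. length (u' @ a # b # v') = length (u @ x # y # v) \<Longrightarrow> swap_rule u' a b v'"
    and low: "swap_rule (u @ [y]) x z v" "swap_rule u y z (x # v)"
      "swap_rule u x z (y # v)" "swap_rule (u @ [z]) x y v"
  shows "straighten (u @ y # x # z # v) + scale (coef x y) (straighten (u @ br x y # z # v))
    = straighten (u @ x # z # y # v) + scale (coef y z) (straighten (u @ x # br y z # v))"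
proof -
  let ?S = straighten
  have s: "?S (u @ a # b # v) = ?S (u @ b # a # v) + scale (coef a b) (?S (u @ br a b # v))" for a b
    using short[of u a b v] by (simp add: swap_rule_def)
  define g where "g a = ?S (u @ a # v)" for a
  have J: "scale (coef x y * coef (br x y) z) (g (br (br x y) z))
        + scale (coef y z * coef (br y z) x) (g (br (br y z) x))
        + scale (coef z x * coef (br z x) y) (g (br (br z x) y)) = 0"
    by (rule jacobi)
  have 1: "?S (u @ y # x # z # v) = ?S (u @ y # z # x # v) + scale (coef x z) (?S (u @ y # br x z # v))"
    using low(1) by (simp add: swap_rule_def)
  have 2: "?S (u @ y # z # x # v) = ?S (u @ z # y # x # v) + scale (coef y z) (?S (u @ br y z # x # v))"
    using low(2) by (simp add: swap_rule_def)
  have 3: "?S (u @ x # z # y # v) = ?S (u @ z # x # y # v) + scale (coef x z) (?S (u @ br x z # y # v))"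
    using low(3) by (simp add: swap_rule_def)
  have 4: "?S (u @ z # x # y # v) = ?S (u @ z # y # x # v) + scale (coef x y) (?S (u @ z # br x y # v))"
    using low(4) by (simp add: swap_rule_def)
  have c1: "scale (coef x y) (?S (u @ br x y # z # v)) =
      scale (coef x y) (?S (u @ z # br x y # v)) + scale (coef x y * coef (br x y) z) (g (br (br x y) z))"
    by (subst s) (simp add: scale_add scale_scale g_def)
  have c2: "scale (coef y z) (?S (u @ br y z # x # v)) =
      scale (coef y z) (?S (u @ x # br y z # v)) + scale (coef y z * coef (br y z) x) (g (br (br y z) x))"
    by (subst s) (simp add: scale_add scale_scale g_def)
  have c3: "scale (coef x z) (?S (u @ br x z # y # v)) =
      scale (coef x z) (?S (u @ y # br x z # v)) - scale (coef z x * coef (br z x) y) (g (br (br z x) y))"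
    by (subst s) (simp add: scale_add scale_scale g_def coef_skew[of z x] br_commute[of z x] scale_minus_left)
  show ?thesis unfolding 1 2 3 4 c1 c2 c3 using J by (simp add: algebra_simps)
qed

text \<open>Induction on the length and, for descents in words of equal length, on the number of
  inversions. The given descent is compared with the one that \<open>straighten\<close> picks; as
  both are descents, either swap leads to a word with fewer inversions, where the induction
  hypothesis applies.\<close>

lemma swap_rule: "swap_rule u x y v"
proof -
  have "\<forall>u x y v. length (u @ x # y # v) = n \<longrightarrow> swap_rule u x y v" for n
  proof (induction n rule: less_induct)
    case (less n)
    have short: "swap_rule u x y v" if "length (u @ x # y # v) < n" for u x y v
      using less that by blast
    have desc: "swap_rule u x y v"
      if "y < x" "length (u @ x # y # v) = n" "inversions (u @ x # y # v) = k" for u x y v k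
      using that
    proof (induction k arbitrary: u x y v rule: less_induct)
      case (less k)
      have IH: "swap_rule u' x' y' v'"
        if "y' < x'" "length (u' @ x' # y' # v') = n"
          "inversions (u' @ x' # y' # v') < inversions (u @ x # y # v)" for u' x' y' v'
        using less.IH[of "inversions (u' @ x' # y' # v')" y' x' u' v'] that less.prems by simp
      let ?w = "u @ x # y # v"
      let ?S = straighten
      show ?case
      proof (cases "pos (last ?w)")
        case True
        show ?thesis
        proof (cases v rule: rev_cases)
          case (snoc v' z)
          have "swap_rule u x y v'" using short[of u x y v'] less.prems snoc by simp
          moreover have "pos z" using True snoc by simp
          then have "?S (w @ [z]) = scale (chi z) (?S w)" for w by (rule straighten_snoc_pos)
          from this[of "u @ x # y # v'"] this[of "u @ y # x # v'"] this[of "u @ br x y # v'"]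
          have "?S ?w = scale (chi z) (?S (u @ x # y # v'))"
            "?S (u @ y # x # v) = scale (chi z) (?S (u @ y # x # v'))"
            "?S (u @ br x y # v) = scale (chi z) (?S (u @ br x y # v'))"
            using snoc by simp_all
          ultimately show ?thesis
            by (simp add: swap_rule_def scale_add scale_scale mult.commute)
        next
          \<comment> \<open>The descent stands at the end and both of its letters are positive:
            either order evaluates to the same product of scalars, and the bracket term vanishes by
            \<open>chi_br\<close>.\<close>
          case Nil
          then have py: "pos y" using True by simp
          then have px: "pos x" using less.prems(1) pos_upward by (meson less_imp_le)
          have "?S (u @ [x, y]) = scale (chi y) (scale (chi x) (?S u))"
            using straighten_snoc_pos[OF py, of "u @ [x]"] straighten_snoc_pos[OF px, of u] by simp
          moreover have "?S (u @ [y, x]) = scale (chi x) (scale (chi y) (?S u))"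
            using straighten_snoc_pos[OF px, of "u @ [y]"] straighten_snoc_pos[OF py, of u] by simp
          moreover have "scale (coef x y) (?S (u @ [br x y])) = 0"
          proof (cases "coef x y = 0")
            case False
            then show ?thesis using chi_br[OF px py] straighten_snoc_pos[of "br x y" u]
              by (simp add: scale_zero scale_zero_left)
          qed (simp add: scale_zero_left)
          ultimately show ?thesis using Nil by (simp add: swap_rule_def scale_scale mult.commute)
        qed
      next
        case np: False
        have ns: "\<not> sorted ?w" using less.prems(1) by (auto simp: sorted_append)
        obtain u' x' y' v' where d: "descent ?w = (u', x', y', v')" by (cases "descent ?w") auto
        note dd = descent[OF ns d]
        have S: "?S ?w = ?S (u' @ y' # x' # v') + scale (coef x' y') (?S (u' @ br x' y' # v'))"
          using np ns d by (subst straighten.simps) simp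
        have inv: "inversions (u' @ y' # x' # v') < inversions ?w"
          using dd inversions_swap by metis
        from dd(1) show ?thesis
        proof (cases rule: append_two_eq_append_two)
          case same
          then show ?thesis using S by (simp add: swap_rule_def)
        next
          \<comment> \<open>The chosen descent consists of \<open>y\<close> and \<open>y'\<close>,
            so \<open>x\<close>, \<open>y\<close>, \<open>y'\<close> form a decreasing triple; each
            swap that \<open>overlap_consistent\<close> asks for takes place in a word with fewer
            inversions or of smaller length.\<close>
          case left_overlap
          let ?z = y' let ?v = v'
          have o: "?z < y" "y < x" using dd(2) left_overlap less.prems by auto
          have i1: "inversions (u @ y # x # ?z # ?v) < inversions ?w"
            using inversions_swap[of y x u "?z # ?v"] o left_overlap by simp
          have i2: "inversions (u @ x # ?z # y # ?v) < inversions ?w"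
            using inversions_swap[of ?z y "u @ [x]" "?v"] o left_overlap by simp
          have i3: "inversions (u @ y # ?z # x # ?v) < inversions (u @ y # x # ?z # ?v)"
            using inversions_swap[of ?z x "u @ [y]" "?v"] o by simp
          have i4: "inversions (u @ ?z # x # y # ?v) < inversions (u @ x # ?z # y # ?v)"
            using inversions_swap[of ?z x "u" "y # ?v"] o by simp
          have "?S (u @ y # x # ?z # ?v) + scale (coef x y) (?S (u @ br x y # ?z # ?v))
              = ?S (u @ x # ?z # y # ?v) + scale (coef y ?z) (?S (u @ x # br y ?z # ?v))"
          proof (rule overlap_consistent)
            show "swap_rule u' a b v''" if "length (u' @ a # b # v'') = length (u @ x # y # v')"
              for u' a b v'' by (rule short) (use that less.prems left_overlap in simp)
            show "swap_rule (u @ [y]) x ?z ?v" by (rule IH) (use o i1 less.prems left_overlap in auto)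
            show "swap_rule u y ?z (x # ?v)" by (rule IH) (use o i1 i3 less.prems left_overlap in auto)
            show "swap_rule u x ?z (y # ?v)" by (rule IH) (use o i2 less.prems left_overlap in auto)
            show "swap_rule (u @ [?z]) x y ?v" by (rule IH) (use o i2 i4 less.prems left_overlap in auto)
          qed
          then show ?thesis using S left_overlap by (simp add: swap_rule_def)
        next
          case right_overlap
          have o: "y < x" "x < x'" using dd(2) right_overlap less.prems by auto
          have e: "?w = u' @ x' # x # y # v" using right_overlap by simp
          have i1: "inversions (u' @ x # x' # y # v) < inversions ?w"
            using inversions_swap[of x x' u' "y # v"] o e by simp
          have i2: "inversions (u' @ x' # y # x # v) < inversions ?w"
            using inversions_swap[of y x "u' @ [x']" "v"] o e by simp
          have i3: "inversions (u' @ x # y # x' # v) < inversions (u' @ x # x' # y # v)"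
            using inversions_swap[of y x' "u' @ [x]" "v"] o by simp
          have i4: "inversions (u' @ y # x' # x # v) < inversions (u' @ x' # y # x # v)"
            using inversions_swap[of y x' "u'" "x # v"] o by simp
          have "?S (u' @ x # x' # y # v) + scale (coef x' x) (?S (u' @ br x' x # y # v))
              = ?S (u' @ x' # y # x # v) + scale (coef x y) (?S (u' @ x' # br x y # v))"
          proof (rule overlap_consistent)
            show "swap_rule u'' a b v''" if "length (u'' @ a # b # v'') = length (u' @ x' # x # v)"
              for u'' a b v'' by (rule short) (use that less.prems e in simp)
            show "swap_rule (u' @ [x]) x' y v" by (rule IH) (use o i1 less.prems e in auto)
            show "swap_rule u' x y (x' # v)" by (rule IH) (use o i1 i3 less.prems e in auto)
            show "swap_rule u' x' y (x # v)" by (rule IH) (use o i2 less.prems e in auto)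
            show "swap_rule (u' @ [y]) x' x v" by (rule IH) (use o i2 i4 less.prems e in auto)
          qed
          then show ?thesis using S right_overlap by (simp add: swap_rule_def)
        next
          \<comment> \<open>Disjoint descents: performing the other swap after either one leads to
            the same four terms.\<close>
          case (left m)
          have "swap_rule u x y (m @ y' # x' # v')"
            by (rule IH) (use less.prems inv left in auto)
          moreover have "swap_rule u x y (m @ br x' y' # v')"
            by (rule short) (use less.prems left in auto)
          moreover have "swap_rule (u @ y # x # m) x' y' v'"
          proof (rule IH)
            show "inversions ((u @ y # x # m) @ x' # y' # v') < inversions (u @ x # y # v)"
              using left inversions_swap[OF less.prems(1), of u v] by simp
          qed (use less.prems dd left in auto)
          moreover have "swap_rule (u @ br x y # m) x' y' v'"
            by (rule short) (use less.prems left in auto)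
          ultimately show ?thesis using S left
            by (simp add: swap_rule_def scale_add scale_scale algebra_simps)
        next
          case (right m)
          have "swap_rule (u' @ y' # x' # m) x y v"
            by (rule IH) (use less.prems inv right in auto)
          moreover have "swap_rule (u' @ br x' y' # m) x y v"
            by (rule short) (use less.prems right in auto)
          moreover have "swap_rule u' x' y' (m @ y # x # v)"
          proof (rule IH)
            show "inversions (u' @ x' # y' # (m @ y # x # v)) < inversions (u @ x # y # v)"
              using right inversions_swap[OF less.prems(1), of u v] by simp
          qed (use less.prems dd right in auto)
          moreover have "swap_rule u' x' y' (m @ br x y # v)"
            by (rule short) (use less.prems right in auto)
          ultimately show ?thesis using S right
            by (simp add: swap_rule_def scale_add scale_scale algebra_simps)
        qed
      qed
    qed
    show ?case
    proof (intro allI impI)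
      fix u v and x y :: 'a
      assume l: "length (u @ x # y # v) = n"
      consider "x = y" | "y < x" | "x < y" by force
      then show "swap_rule u x y v"
      proof cases
        case 3
        then have "swap_rule u y x v" using desc l by simp
        then show ?thesis by (rule swap_rule_commute)
      qed (use desc l swap_rule_refl in auto)
    qed
  qed
  then show ?thesis by blast
qed

lemma straighten_swap:
  "straighten (u @ x # y # v)
    = straighten (u @ y # x # v) + scale (coef x y) (straighten (u @ br x y # v))"
  using swap_rule[of u x y v] by (simp add: swap_rule_def)

text \<open>The Leibniz rule: carrying \<open>x\<close> past \<open>v\<close> leaves one bracket for
  each letter of \<open>v\<close>. If \<open>x\<close> is positive, it becomes a scalar on reaching
  the end.\<close>

lemma straighten_move_right:
  "straighten (u @ x # v) = straighten (u @ v @ [x])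
    + (\<Sum>k<length v. scale (coef x (v ! k)) (straighten (u @ v[k := br x (v ! k)])))"
proof (induction v arbitrary: u)
  case (Cons y v)
  have "straighten (u @ x # y # v) = straighten ((u @ [y]) @ x # v)
      + scale (coef x y) (straighten (u @ br x y # v))"
    using straighten_swap[of u x y v] by simp
  also have "straighten ((u @ [y]) @ x # v) = straighten (u @ y # v @ [x])
      + (\<Sum>k<length v. scale (coef x (v ! k)) (straighten (u @ y # v[k := br x (v ! k)])))"
    using Cons[of "u @ [y]"] by simp
  finally show ?case
    by (simp add: sum.lessThan_Suc_shift del: sum.lessThan_Suc)
qed simp

end

section \<open>Polynomials as values of words\<close>

text \<open>The coefficient is an argument of \<open>t\<close>, so that additivity in it is all that
  \<open>ext_add\<close> asks for; complex, polynomial and integer coefficients are thereby covered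
  alike.\<close>

definition ext :: "('k \<Rightarrow> 'c::zero \<Rightarrow> 'm::comm_monoid_add) \<Rightarrow> ('k \<Rightarrow>\<^sub>0 'c) \<Rightarrow> 'm"
  where "ext t f = (\<Sum>k\<in>Poly_Mapping.keys f. t k (Poly_Mapping.lookup f k))"

lemma ext_zero [simp]: "ext t 0 = 0"
  by (simp add: ext_def)

lemma ext_single:
  assumes "t k 0 = 0"
  shows "ext t (Poly_Mapping.single k c) = t k c"
  using assms by (simp add: ext_def)

lemma ext_add:
  fixes t :: "'k \<Rightarrow> 'c::ab_group_add \<Rightarrow> 'm::ab_group_add"
  assumes "\<And>k a b. t k (a + b) = t k a + t k b"
  shows "ext t (f + g) = ext t f + ext t g"
proof -
  have t0: "t k 0 = 0" for k using assms[of k 0 0] by simp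
  have e: "ext t h = (\<Sum>k\<in>A. t k (Poly_Mapping.lookup h k))"
    if "finite A" "Poly_Mapping.keys h \<subseteq> A" for h A
    unfolding ext_def
    by (rule sum.mono_neutral_left) (use that t0 in \<open>auto simp: not_in_keys_iff_lookup_eq_zero\<close>)
  let ?A = "Poly_Mapping.keys f \<union> Poly_Mapping.keys g"
  have "Poly_Mapping.keys (f + g) \<subseteq> ?A" by (rule keys_add)
  then show ?thesis
    by (simp add: e[of ?A] assms lookup_add sum.distrib)
qed

lemma poly_mapping_sum_keys:
  "(\<Sum>k\<in>Poly_Mapping.keys f. Poly_Mapping.single k (Poly_Mapping.lookup f k)) = f"
  by (rule poly_mapping_eqI)
    (auto simp: lookup_sum lookup_single when_def sum.delta not_in_keys_iff_lookup_eq_zero)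

lemma poly_mapping_induct_add [case_names zero single add]:
  fixes f :: "'k \<Rightarrow>\<^sub>0 'c::comm_monoid_add"
  assumes "P 0" "\<And>k c. P (Poly_Mapping.single k c)" "\<And>f g. P f \<Longrightarrow> P g \<Longrightarrow> P (f + g)"
  shows "P f"
proof -
  have "P (\<Sum>k\<in>A. Poly_Mapping.single k (Poly_Mapping.lookup f k))" if "finite A" for A
    using that by (induction A) (auto intro: assms)
  then show ?thesis by (metis finite_keys poly_mapping_sum_keys)
qed

text \<open>The letter \<open>(d, i)\<close> stands for \<open>x\<^sub>(\<^sub>a\<^sub>,\<^sub>i\<^sub>)\<close> with \<open>d = a + i - 1\<close>; in these coordinates the bracket
  is graded by \<open>d\<close>, and \<open>\<nn>\<close> is spanned by the letters with \<open>d \<ge> 1\<close>, which come last in the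
  lexicographic order.\<close>

type_synonym letter = "int \<times> nat"
type_synonym sym = "letter multiset \<Rightarrow>\<^sub>0 complex poly"

text \<open>Substitute \<open>a - 1 = d - i\<close> and \<open>b - 1 = e - j\<close> in the
  coefficient of the bracket: the products \<open>i * j\<close> cancel.\<close>

fun letter_coef :: "letter \<Rightarrow> letter \<Rightarrow> complex"
  where "letter_coef (d, i) (e, j) = of_int (e * int i - d * int j)"

fun letter_br :: "letter \<Rightarrow> letter \<Rightarrow> letter"
  where "letter_br (d, i) (e, j) = (d + e, i + j - 1)"

definition letter_pos :: "letter \<Rightarrow> bool"
  where "letter_pos x \<longleftrightarrow> 1 \<le> fst x"

fun letter_vec :: "letter \<Rightarrow> lieB"
  where "letter_vec (d, i) = xB (d + 1 - int i) i"

fun letter_of :: "int \<times> nat \<Rightarrow> letter"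
  where "letter_of (a, i) = (a + int i - 1, i)"

lemma letter_of_inverse: "letter_vec (letter_of k) = Poly_Mapping.single k 1"
  by (cases k) (simp add: xB_def)

definition pscale :: "complex poly \<Rightarrow> sym \<Rightarrow> sym"
  where "pscale p n = Poly_Mapping.single 0 p * n"

lemma lookup_pscale [simp]: "Poly_Mapping.lookup (pscale p n) m = p * Poly_Mapping.lookup n m"
  by (simp add: pscale_def flip: mult_map_scale_conv_mult) (simp add: map.rep_eq when_def)

lemma pscale_add: "pscale p (m + n) = pscale p m + pscale p n"
  and pscale_add_left: "pscale (p + q) n = pscale p n + pscale q n"
  and pscale_pscale [simp]: "pscale p (pscale q n) = pscale (p * q) n"
  and pscale_1 [simp]: "pscale 1 n = n"
  and pscale_0 [simp]: "pscale 0 n = 0"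
  and pscale_0_right [simp]: "pscale p 0 = 0"
  and pscale_single [simp]: "pscale p (Poly_Mapping.single u q) = Poly_Mapping.single u (p * q)"
  by (auto intro!: poly_mapping_eqI simp: lookup_add algebra_simps lookup_single when_def)

lemma pscale_sum: "pscale p (sum f A) = (\<Sum>a\<in>A. pscale p (f a))"
  by (auto intro!: poly_mapping_eqI simp: lookup_sum sum_distrib_left)

text \<open>The letter \<open>(0, 0)\<close>, which is the central element \<open>t\<close>, does
  not become a variable: its occurrences are counted by the power of the indeterminate in the
  coefficient.\<close>

definition normal_value :: "letter list \<Rightarrow> sym"
  where "normal_value w =
    Poly_Mapping.single (mset (filter (\<lambda>x. x \<noteq> (0, 0)) w)) (monom 1 (count_list w (0, 0)))"

lemma bracket_letter:
  "bracket (letter_vec x) (letter_vec y) = letter_coef x y *\<^sub>B letter_vec (letter_br x y)"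
proof -
  obtain d i e j where xy: "x = (d, i)" "y = (e, j)" by (metis surj_pair)
  have "d + e + 1 - int (i + j - 1) = d + 1 - int i + (e + 1 - int j)" if "i + j > 0"
    using that by linarith
  then show ?thesis unfolding xy
    by (cases "i + j > 0") (auto simp: bracket_def scaleB_def xB_def algebra_simps)
qed

text \<open>If the inner index sum is 0, the inner coefficient vanishes; otherwise the inner
  subtraction is exact. So all three iterated brackets may be taken as the letter with index
  \<open>i + j + k - 2\<close>, truncated in the same way, and a polynomial identity between the
  coefficients remains.\<close>

lemma letter_jacobi:
  "letter_coef x y * letter_coef (letter_br x y) z * g (letter_br (letter_br x y) z)
    + letter_coef y z * letter_coef (letter_br y z) x * g (letter_br (letter_br y z) x)
    + letter_coef z x * letter_coef (letter_br z x) y * g (letter_br (letter_br z x) y) = 0"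
proof -
  obtain d i e j f k where xyz: "x = (d, i)" "y = (e, j)" "z = (f, k)" by (metis surj_pair)
  have *: "letter_coef (d, i) (e, j) * letter_coef (letter_br (d, i) (e, j)) (f, k)
        * g (letter_br (letter_br (d, i) (e, j)) (f, k))
      = of_int ((e * int i - d * int j) * (f * (int i + int j - 1) - (d + e) * int k))
        * g (d + e + f, i + j + k - 2)" for d e f i j k
  proof (cases "i + j = 0")
    case False
    then have 1: "int (i + j - 1) = int i + int j - 1" by linarith
    have 3: "of_nat (i + j - 1) = (of_nat i + of_nat j - 1 :: complex)"
      using False by (subst of_nat_diff) auto
    have 2: "letter_br (letter_br (d, i) (e, j)) (f, k) = (d + e + f, i + j + k - 2)"
      using False by auto
    show ?thesis unfolding 2 using 3 by (simp add: 1)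
  qed auto
  have s: "e + f + d = d + e + f" "f + d + e = d + e + f"
    "j + k + i - 2 = i + j + k - 2" "k + i + j - 2 = i + j + k - 2" by auto
  show ?thesis unfolding xyz * s by (simp add: algebra_simps)
qed

section \<open>The Lie algebra acting on polynomials\<close>

locale lie_char =
  fixes \<phi> :: "lieB \<Rightarrow> complex"
  assumes lie_character: "lie_character \<phi>"
begin

lemma phi_add: "y \<in> \<nn> \<Longrightarrow> z \<in> \<nn> \<Longrightarrow> \<phi> (y + z) = \<phi> y + \<phi> z"
  and phi_scaleB: "y \<in> \<nn> \<Longrightarrow> \<phi> (c *\<^sub>B y) = c * \<phi> y"
  and phi_bracket: "y \<in> \<nn> \<Longrightarrow> z \<in> \<nn> \<Longrightarrow> \<phi> (bracket y z) = 0"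
  using lie_character by (auto simp: lie_character_def)

definition chi :: "letter \<Rightarrow> complex"
  where "chi x = \<phi> (letter_vec x)"

lemma letter_vec_in_n: "letter_pos x \<Longrightarrow> letter_vec x \<in> \<nn>"
  by (cases x) (auto simp: letter_pos_def \<nn>_def xB_def)

lemma chi_br:
  assumes "letter_pos x" "letter_pos y" "letter_coef x y \<noteq> 0"
  shows "letter_pos (letter_br x y) \<and> chi (letter_br x y) = 0"
proof -
  have p: "letter_pos (letter_br x y)"
    using assms by (cases x; cases y) (auto simp: letter_pos_def)
  have "letter_coef x y * chi (letter_br x y) = \<phi> (bracket (letter_vec x) (letter_vec y))"
    using letter_vec_in_n[OF p] by (simp add: bracket_letter phi_scaleB chi_def)
  also have "\<dots> = 0" using assms letter_vec_in_n phi_bracket by blast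
  finally show ?thesis using p assms by simp
qed

sublocale straightening letter_coef letter_br letter_pos chi "\<lambda>c. pscale [:c:]" normal_value
proof
  fix x y z :: letter and g :: "letter \<Rightarrow> sym"
  show "pscale [:letter_coef x y * letter_coef (letter_br x y) z:] (g (letter_br (letter_br x y) z))
    + pscale [:letter_coef y z * letter_coef (letter_br y z) x:] (g (letter_br (letter_br y z) x))
    + pscale [:letter_coef z x * letter_coef (letter_br z x) y:] (g (letter_br (letter_br z x) y)) = 0"
    (is "?s = 0")
  proof (intro poly_mapping_eqI poly_eqI)
    fix m k
    show "coeff (Poly_Mapping.lookup ?s m) k = coeff (Poly_Mapping.lookup 0 m) k"
      using letter_jacobi[of x y z "\<lambda>a. coeff (Poly_Mapping.lookup (g a) m) k"]
      by (simp add: lookup_add)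
  qed
next
  fix x y :: letter
  show "letter_coef y x = - letter_coef x y" by (cases x; cases y) (simp add: algebra_simps)
  show "letter_br y x = letter_br x y" by (cases x; cases y) (simp add: algebra_simps)
  show "letter_pos x \<Longrightarrow> x \<le> y \<Longrightarrow> letter_pos y" by (auto simp: letter_pos_def less_eq_prod_def)
qed (auto simp: pscale_add chi_br mult.commute simp flip: pscale_add_left)

abbreviation central :: letter
  where "central \<equiv> (0, 0)"

lemma straighten_central_move: "straighten (u @ central # v @ z) = straighten (u @ v @ central # z)"
proof (induction v arbitrary: u)
  case (Cons y v)
  have "letter_coef central y = 0" by (cases y) simp
  then have "straighten (u @ central # y # v @ z) = straighten ((u @ [y]) @ central # v @ z)"
    using straighten_swap[of u central y "v @ z"] by simp
  also have "\<dots> = straighten (u @ y # v @ central # z)" using Cons[of "u @ [y]"] by simp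
  finally show ?case by simp
qed simp

text \<open>A prefix does not disturb the straightening steps, so only sorted words matter. There
  \<open>central\<close>, having zero brackets, moves to its place in the order and raises the
  exponent of \<open>t\<close> by one.\<close>

lemma straighten_Cons_central: "straighten (central # w) = pscale [:0, 1:] (straighten w)"
proof (induction w rule: straighten_induct)
  case (snoc_pos u x)
  then show ?case
    using straighten_snoc_pos[of x u] straighten_snoc_pos[of x "central # u"]
    by (simp add: mult.commute)
next
  case (swap u x y v)
  then show ?case
    using straighten_swap[of u x y v] straighten_swap[of "central # u" x y v]
    by (simp add: pscale_add mult.commute)
next
  case (sorted w)
  have "straighten (central # w) = straighten (insort central w)"
  proof -
    have "insort central w = takeWhile (\<lambda>x. x < central) w @ central # dropWhile (\<lambda>x. x < central) w"
      by (induction w) (auto simp: not_le not_less simp del: less_prod_simp less_eq_prod_simp)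
    then show ?thesis
      using straighten_central_move[of "[]" "takeWhile (\<lambda>x. x < central) w" "dropWhile (\<lambda>x. x < central) w"]
      by (simp del: less_prod_simp less_eq_prod_simp)
  qed
  also have "\<dots> = normal_value (insort central w)"
    by (rule straighten_sorted) (use sorted in \<open>auto simp: set_insort_key sorted_insort letter_pos_def\<close>)
  also have "\<dots> = pscale [:0, 1:] (normal_value w)"
  proof -
    have "count_list (insort central w) central = Suc (count_list w central)"
      by (simp flip: count_mset)
    moreover have "mset (filter (\<lambda>x. x \<noteq> central) (insort central w)) = mset (filter (\<lambda>x. x \<noteq> central) w)"
      by (simp add: mset_filter)
    ultimately show ?thesis by (simp add: normal_value_def monom_Suc)
  qed
  finally show ?case using sorted straighten_sorted by simp
qed

lemma straighten_central: "straighten (u @ central # v) = pscale [:0, 1:] (straighten (u @ v))"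
  using straighten_central_move[of "[]" u v] straighten_Cons_central[of "u @ v"] by simp

lemma straighten_filter_central:
  "straighten (u @ w) = pscale (monom 1 (count_list w central))
    (straighten (u @ filter (\<lambda>x. x \<noteq> central) w))"
proof (induction w arbitrary: u)
  case Nil
  then show ?case by (simp add: monom_0 flip: one_pCons)
next
  case (Cons a w)
  show ?case
  proof (cases "a = central")
    case True
    then show ?thesis using Cons[of u] straighten_central[of u w] by (simp add: monom_Suc)
  next
    case False
    then show ?thesis using Cons[of "u @ [a]"] by simp
  qed
qed

abbreviation word_of :: "letter multiset \<Rightarrow> letter list"
  where "word_of \<equiv> sorted_list_of_multiset"

definition rho :: "letter \<Rightarrow> sym \<Rightarrow> sym"
  where "rho x n = ext (\<lambda>m p. pscale p (straighten (x # word_of m))) n"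

lemma rho_add: "rho x (m + n) = rho x m + rho x n"
  by (simp add: rho_def ext_add pscale_add_left)

lemma rho_single: "rho x (Poly_Mapping.single m p) = pscale p (straighten (x # word_of m))"
  by (simp add: rho_def ext_single)

lemma rho_zero [simp]: "rho x 0 = 0"
  by (simp add: rho_def)

lemma rho_pscale: "rho x (pscale p n) = pscale p (rho x n)"
  by (induction n rule: poly_mapping_induct_add) (auto simp: rho_single rho_add pscale_add)

lemma rho_sum: "rho x (sum f A) = (\<Sum>a\<in>A. rho x (f a))"
  by (induction A rule: infinite_finite_induct) (auto simp: rho_add)

text \<open>The reason why \<open>rho\<close> is a representation: straightening the tail of a word
  first does not change its value, because every step on the tail is also a step on the whole word.
  The commutation rule is then a single swap at the front.\<close>

lemma rho_straighten: "rho x (straighten w) = straighten (x # w)"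
proof (induction w rule: straighten_induct)
  case (snoc_pos u y)
  then show ?case
    using straighten_snoc_pos[of y u] straighten_snoc_pos[of y "x # u"] by (simp add: rho_pscale)
next
  case (swap u a b v)
  then show ?case
    using straighten_swap[of u a b v] straighten_swap[of "x # u" a b v] by (simp add: rho_add rho_pscale)
next
  case (sorted w)
  have "word_of (mset (filter (\<lambda>y. y \<noteq> central) w)) = filter (\<lambda>y. y \<noteq> central) w"
    using sorted(1) by (simp add: sorted_list_of_multiset_mset sorted_wrt_filter sorted_sort_id
        flip: mset_filter)
  then show ?case
    using sorted straighten_filter_central[of "[x]" w]
    by (simp add: straighten_sorted[of w] normal_value_def[of w] rho_single)
qed

lemma rho_commutator:
  "rho x (rho y n) = rho y (rho x n) + pscale [:letter_coef x y:] (rho (letter_br x y) n)"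
proof (induction n rule: poly_mapping_induct_add)
  case (single m p)
  show ?case
    using straighten_swap[of "[]" x y "word_of m"]
    by (simp add: rho_single rho_pscale rho_straighten pscale_add mult.commute)
qed (simp_all add: rho_add pscale_add)

definition rho_vec :: "lieB \<Rightarrow> sym \<Rightarrow> sym"
  where "rho_vec y n = ext (\<lambda>k c. pscale [:c:] (rho (letter_of k) n)) y"

lemma rho_vec_add_left: "rho_vec (y + z) n = rho_vec y n + rho_vec z n"
  unfolding rho_vec_def by (rule ext_add) (simp flip: pscale_add_left)

lemma rho_vec_zero_left [simp]: "rho_vec 0 n = 0"
  by (simp add: rho_vec_def)

lemma rho_vec_sum_left: "rho_vec (sum f A) n = (\<Sum>a\<in>A. rho_vec (f a) n)"
  by (induction A rule: infinite_finite_induct) (auto simp: rho_vec_add_left)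

lemma rho_vec_single: "rho_vec (Poly_Mapping.single k c) n = pscale [:c:] (rho (letter_of k) n)"
  by (simp add: rho_vec_def ext_single)

lemma scaleB_add: "c *\<^sub>B (y + z) = c *\<^sub>B y + c *\<^sub>B z"
  by (rule poly_mapping_eqI) (simp add: scaleB_def map.rep_eq lookup_add when_def flip: distrib_left)

lemma scaleB_zero [simp]: "c *\<^sub>B 0 = 0"
  by (rule poly_mapping_eqI) (simp add: scaleB_def map.rep_eq)

lemma scaleB_single: "c *\<^sub>B Poly_Mapping.single k d = Poly_Mapping.single k (c * d)"
  by (rule poly_mapping_eqI) (simp add: scaleB_def map.rep_eq lookup_single when_def)

lemma rho_vec_scaleB: "rho_vec (c *\<^sub>B y) n = pscale [:c:] (rho_vec y n)"
  by (induction y rule: poly_mapping_induct_add)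
    (simp_all add: scaleB_add scaleB_single rho_vec_add_left rho_vec_single pscale_add mult.commute)

lemma rho_vec_letter: "rho_vec (letter_vec x) n = rho x n"
  by (cases x) (simp add: xB_def rho_vec_single flip: one_pCons)

lemma rho_vec_add: "rho_vec y (m + n) = rho_vec y m + rho_vec y n"
  by (induction y rule: poly_mapping_induct_add)
    (simp_all add: rho_vec_add_left rho_vec_single rho_add pscale_add)

lemma rho_vec_pscale: "rho_vec y (pscale p n) = pscale p (rho_vec y n)"
  by (induction y rule: poly_mapping_induct_add)
    (simp_all add: rho_vec_add_left rho_vec_single rho_pscale pscale_add mult.commute)

lemma rho_vec_zero [simp]: "rho_vec y 0 = 0"
  using rho_vec_pscale[of y 0 0] by simp

text \<open>By bilinearity this is \<open>rho_commutator\<close> on pairs of basis vectors. The case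
  \<open>i + j = 0\<close> is treated apart: there the truncated indices of \<open>bracket\<close>
  and \<open>letter_br\<close> give different letters, but the coefficient is 0.\<close>

lemma rho_vec_bracket: "rho_vec (bracket y z) n = rho_vec y (rho_vec z n) - rho_vec z (rho_vec y n)"
proof -
  let ?l = Poly_Mapping.lookup and ?K = Poly_Mapping.keys
  let ?R = "\<lambda>k. rho (letter_of k)"
  have tm: "rho_vec (case k of (a, i) \<Rightarrow> case l of (b, j) \<Rightarrow>
      Poly_Mapping.single (a + b, i + j - 1)
         (?l y (a, i) * ?l z (b, j) * of_int ((b - 1) * int i - (a - 1) * int j))) n
     = pscale [:?l y k * ?l z l:] (?R k (?R l n)) - pscale [:?l y k * ?l z l:] (?R l (?R k n))" for k l
  proof -
    obtain a i b j where kl: "k = (a, i)" "l = (b, j)" by (metis surj_pair)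
    have c: "letter_coef (letter_of k) (letter_of l) = of_int ((b - 1) * int i - (a - 1) * int j)"
      by (simp add: kl algebra_simps)
    let ?k = "letter_of k" and ?m = "letter_of l" and ?q = "[:?l y k * ?l z l:]"
    have 1: "rho_vec (Poly_Mapping.single (a + b, i + j - 1)
          (?l y (a, i) * ?l z (b, j) * of_int ((b - 1) * int i - (a - 1) * int j))) n
        = pscale ?q (pscale [:letter_coef ?k ?m:] (rho (letter_br ?k ?m) n))"
    proof (cases "i + j = 0")
      case True
      then have "letter_coef ?k ?m = 0" by (simp add: kl)
      then show ?thesis using True by (simp add: kl)
    next
      case False
      then have "letter_of (a + b, i + j - 1) = letter_br ?k ?m"
        by (simp add: kl) linarith
      then show ?thesis
        unfolding rho_vec_single c by (simp add: kl ac_simps)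
    qed
    show ?thesis
      unfolding rho_commutator[of ?k ?m n] pscale_add
      by (simp only: kl prod.case 1[unfolded kl] add_diff_cancel_left')
  qed
  have "rho_vec y (rho_vec z n) = (\<Sum>k\<in>?K y. \<Sum>l\<in>?K z. pscale [:?l y k * ?l z l:] (?R k (?R l n)))"
    by (simp add: rho_vec_def ext_def rho_sum pscale_sum rho_pscale mult.commute)
  moreover have "rho_vec z (rho_vec y n)
      = (\<Sum>k\<in>?K y. \<Sum>l\<in>?K z. pscale [:?l y k * ?l z l:] (?R l (?R k n)))"
    unfolding rho_vec_def ext_def rho_sum pscale_sum rho_pscale
    by (subst sum.swap) (simp add: mult.commute)
  moreover have "rho_vec (bracket y z) n = (\<Sum>k\<in>?K y. \<Sum>l\<in>?K z. rho_vec (case k of (a, i) \<Rightarrow> case l of (b, j) \<Rightarrow>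
      Poly_Mapping.single (a + b, i + j - 1)
         (?l y (a, i) * ?l z (b, j) * of_int ((b - 1) * int i - (a - 1) * int j))) n)"
    by (simp add: bracket_def rho_vec_sum_left case_prod_unfold)
  ultimately show ?thesis by (simp only: tm sum_subtractf)
qed

end

section \<open>Enveloping algebras\<close>

lemma keys_free_mult:
  fixes f g :: "'a free_alg"
  assumes "w \<in> Poly_Mapping.keys (f * g)"
  obtains u v where "u \<in> Poly_Mapping.keys f" "v \<in> Poly_Mapping.keys g" "w = u + v"
  using assms keys_mult[of f g] by blast

lemma letters_plus: "letters (u + v) = letters u @ letters v"
  by (simp add: plus_free_monoid_def)

lemma letters_zero: "letters 0 = []"
  by (simp add: zero_free_monoid_def)

lemma free_algebra_simps [simp]:
  "f \<otimes>\<^bsub>free_algebra S\<^esub> g = f * g" "\<one>\<^bsub>free_algebra S\<^esub> = 1"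
  "\<zero>\<^bsub>free_algebra S\<^esub> = 0" "f \<oplus>\<^bsub>free_algebra S\<^esub> g = f + g"
  by (simp_all add: free_algebra_def)

lemma in_free_algebra:
  "f \<in> carrier (free_algebra S) \<longleftrightarrow> (\<forall>u\<in>Poly_Mapping.keys f. set (letters u) \<subseteq> S)"
  by (simp add: free_algebra_def)

lemma in_free_algebra_UNIV [simp]: "f \<in> carrier (free_algebra UNIV)"
  by (simp add: in_free_algebra)

lemma free_algebra_closed:
  shows "f \<in> carrier (free_algebra S) \<Longrightarrow> g \<in> carrier (free_algebra S) \<Longrightarrow> f + g \<in> carrier (free_algebra S)"
    and "f \<in> carrier (free_algebra S) \<Longrightarrow> g \<in> carrier (free_algebra S) \<Longrightarrow> f - g \<in> carrier (free_algebra S)"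
    and "f \<in> carrier (free_algebra S) \<Longrightarrow> - f \<in> carrier (free_algebra S)"
    and "f \<in> carrier (free_algebra S) \<Longrightarrow> g \<in> carrier (free_algebra S) \<Longrightarrow> f * g \<in> carrier (free_algebra S)"
    and "const c \<in> carrier (free_algebra S)"
    and "y \<in> S \<Longrightarrow> gen y \<in> carrier (free_algebra S)"
    and "1 \<in> carrier (free_algebra S)" and "0 \<in> carrier (free_algebra S)"
proof -
  show "f \<in> carrier (free_algebra S) \<Longrightarrow> g \<in> carrier (free_algebra S) \<Longrightarrow> f + g \<in> carrier (free_algebra S)"
    using keys_add[of f g] by (auto simp: in_free_algebra)
  show "f \<in> carrier (free_algebra S) \<Longrightarrow> g \<in> carrier (free_algebra S) \<Longrightarrow> f - g \<in> carrier (free_algebra S)"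
    using keys_diff[of f g] by (auto simp: in_free_algebra)
  show "f \<in> carrier (free_algebra S) \<Longrightarrow> - f \<in> carrier (free_algebra S)"
    by (auto simp: in_free_algebra)
  show "f \<in> carrier (free_algebra S) \<Longrightarrow> g \<in> carrier (free_algebra S) \<Longrightarrow> f * g \<in> carrier (free_algebra S)"
    by (fastforce simp: in_free_algebra letters_plus elim: keys_free_mult)
  show "const c \<in> carrier (free_algebra S)"
    by (auto simp: in_free_algebra const_def letters_zero split: if_splits)
  show "y \<in> S \<Longrightarrow> gen y \<in> carrier (free_algebra S)"
    by (auto simp: in_free_algebra gen_def)
  show "1 \<in> carrier (free_algebra S)" "0 \<in> carrier (free_algebra S)"
    by (auto simp: in_free_algebra letters_zero)
qed

lemma ring_free_algebra: "ring (free_algebra S)"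
proof (rule ringI)
  show "abelian_group (free_algebra S)"
  proof (rule abelian_groupI)
    fix x assume "x \<in> carrier (free_algebra S)"
    then show "\<exists>y\<in>carrier (free_algebra S). y \<oplus>\<^bsub>free_algebra S\<^esub> x = \<zero>\<^bsub>free_algebra S\<^esub>"
      by (intro bexI[of _ "- x"]) (auto simp: free_algebra_closed)
  qed (auto simp: free_algebra_closed algebra_simps)
  show "Group.monoid (free_algebra S)"
    by (rule Group.monoidI) (auto simp: free_algebra_closed algebra_simps)
qed (auto simp: algebra_simps)

lemma a_inv_free_algebra:
  assumes "f \<in> carrier (free_algebra S)"
  shows "\<ominus>\<^bsub>free_algebra S\<^esub> f = - f"
proof -
  interpret ring "free_algebra S" by (rule ring_free_algebra)
  show ?thesis using minus_equality[of "- f" f] assms by (simp add: free_algebra_closed)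
qed

lemma in_n_iff: "f \<in> \<nn> \<longleftrightarrow> (\<forall>a i. Poly_Mapping.lookup f (a, i) \<noteq> 0 \<longrightarrow> a + int i > 1)"
  by (auto simp: \<nn>_def in_keys_iff split: prod.splits)

definition lie_subspace :: "lieB set \<Rightarrow> bool"
  where "lie_subspace L \<longleftrightarrow> 0 \<in> L \<and> (\<forall>y\<in>L. \<forall>z\<in>L. y + z \<in> L \<and> bracket y z \<in> L) \<and> (\<forall>c. \<forall>y\<in>L. c *\<^sub>B y \<in> L)"

lemma lie_subspace_UNIV: "lie_subspace UNIV"
  by (simp add: lie_subspace_def)

lemma n_zero: "0 \<in> \<nn>"
  by (simp add: in_n_iff)

lemma n_add: "y \<in> \<nn> \<Longrightarrow> z \<in> \<nn> \<Longrightarrow> y + z \<in> \<nn>"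
  unfolding in_n_iff lookup_add by (metis add.right_neutral)

lemma n_scaleB: "y \<in> \<nn> \<Longrightarrow> c *\<^sub>B y \<in> \<nn>"
  unfolding in_n_iff scaleB_def by (metis map.rep_eq mult_zero_right when_def)

lemma n_sum: "(\<And>a. a \<in> A \<Longrightarrow> f a \<in> \<nn>) \<Longrightarrow> sum f A \<in> \<nn>"
  by (induction A rule: infinite_finite_induct) (auto simp: n_add n_zero)

lemma n_bracket:
  assumes "y \<in> \<nn>" "z \<in> \<nn>"
  shows "bracket y z \<in> \<nn>"
  unfolding bracket_def case_prod_unfold
proof (intro n_sum)
  fix k l assume kl: "k \<in> Poly_Mapping.keys y" "l \<in> Poly_Mapping.keys z"
  have "fst k + int (snd k) > 1" "fst l + int (snd l) > 1"
    using assms kl unfolding \<nn>_def by (auto simp: case_prod_unfold)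
  then show "Poly_Mapping.single (fst k + fst l, snd k + snd l - 1)
      (Poly_Mapping.lookup y (fst k, snd k) * Poly_Mapping.lookup z (fst l, snd l)
        * of_int ((fst l - 1) * int (snd k) - (fst k - 1) * int (snd l))) \<in> \<nn>"
    by (auto simp: \<nn>_def)
qed

lemma lie_subspace_n: "lie_subspace \<nn>"
  by (simp add: lie_subspace_def n_add n_scaleB n_zero n_bracket)

lemma uea_relations_subset:
  assumes "lie_subspace L"
  shows "uea_relations L \<subseteq> carrier (free_algebra L)"
  using assms by (auto simp: uea_relations_def lie_subspace_def intro!: free_algebra_closed)

lemma ideal_uea_ideal:
  assumes "lie_subspace L"
  shows "ideal (uea_ideal L) (free_algebra L)"
  unfolding uea_ideal_def
  by (rule ring.genideal_ideal[OF ring_free_algebra uea_relations_subset[OF assms]])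

lemma uea_relations_in_ideal:
  assumes "lie_subspace L" "r \<in> uea_relations L"
  shows "r \<in> uea_ideal L"
  using ring.genideal_self[OF ring_free_algebra uea_relations_subset[OF assms(1)]] assms(2)
  by (auto simp: uea_ideal_def)

lemma zero_in_uea_ideal:
  assumes "lie_subspace L"
  shows "0 \<in> uea_ideal L"
proof -
  interpret ideal "uea_ideal L" "free_algebra L" by (rule ideal_uea_ideal[OF assms])
  show ?thesis using additive_subgroup.zero_closed[OF is_additive_subgroup] by simp
qed

lemma uea_ideal_closed:
  assumes "lie_subspace L" "f \<in> uea_ideal L"
  shows "g \<in> uea_ideal L \<Longrightarrow> f + g \<in> uea_ideal L" "- f \<in> uea_ideal L"
    and "g \<in> uea_ideal L \<Longrightarrow> f - g \<in> uea_ideal L"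
    and "h \<in> carrier (free_algebra L) \<Longrightarrow> h * f \<in> uea_ideal L"
    and "h \<in> carrier (free_algebra L) \<Longrightarrow> f * h \<in> uea_ideal L"
    and "f \<in> carrier (free_algebra L)"
proof -
  interpret ideal "uea_ideal L" "free_algebra L" by (rule ideal_uea_ideal[OF assms(1)])
  show c: "f \<in> carrier (free_algebra L)" using assms(2) a_Hcarr by blast
  show m: "- f \<in> uea_ideal L" using additive_subgroup.a_inv_closed[OF is_additive_subgroup assms(2)] a_inv_free_algebra[OF c] by simp
  show "g \<in> uea_ideal L \<Longrightarrow> f + g \<in> uea_ideal L" using additive_subgroup.a_closed[OF is_additive_subgroup assms(2)] by simp
  show "h \<in> carrier (free_algebra L) \<Longrightarrow> h * f \<in> uea_ideal L" using I_l_closed[OF assms(2)] by simp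
  show "h \<in> carrier (free_algebra L) \<Longrightarrow> f * h \<in> uea_ideal L" using I_r_closed[OF assms(2)] by simp
  assume g: "g \<in> uea_ideal L"
  then have "g \<in> carrier (free_algebra L)" using a_Hcarr by blast
  then have "- g \<in> uea_ideal L" using additive_subgroup.a_inv_closed[OF is_additive_subgroup g] a_inv_free_algebra by fastforce
  from additive_subgroup.a_closed[OF is_additive_subgroup assms(2) this] show "f - g \<in> uea_ideal L" by simp
qed

lemma uea_ideal_minimal:
  assumes "lie_subspace L" "uea_relations L \<subseteq> I" "I \<subseteq> carrier (free_algebra L)" "0 \<in> I"
    and "\<And>f g. f \<in> I \<Longrightarrow> g \<in> I \<Longrightarrow> f + g \<in> I" "\<And>f. f \<in> I \<Longrightarrow> - f \<in> I"
    and "\<And>f h. f \<in> I \<Longrightarrow> h \<in> carrier (free_algebra L) \<Longrightarrow> h * f \<in> I"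
    and "\<And>f h. f \<in> I \<Longrightarrow> h \<in> carrier (free_algebra L) \<Longrightarrow> f * h \<in> I"
  shows "uea_ideal L \<subseteq> I"
proof -
  interpret ring "free_algebra L" by (rule ring_free_algebra)
  have "ideal I (free_algebra L)"
  proof (rule idealI)
    show "subgroup I (add_monoid (free_algebra L))"
    proof (rule add.subgroupI)
      fix f assume f: "f \<in> I"
      then have "f \<in> carrier (free_algebra L)" using assms(3) by blast
      then show "\<ominus>\<^bsub>free_algebra L\<^esub> f \<in> I" using assms(6) f by (simp add: a_inv_free_algebra)
    qed (use assms in auto)
  qed (use assms ring_free_algebra in auto)
  from genideal_minimal[OF this assms(2)] show ?thesis by (simp add: uea_ideal_def)
qed

text \<open>Makes \<open>uea_inclusion\<close> and, by way of the action on polynomials,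
  \<open>uea_character\<close> independent of the representative.\<close>

lemma uea_ideal_n_subset: "uea_ideal \<nn> \<subseteq> uea_ideal UNIV"
proof -
  have "uea_relations \<nn> \<subseteq> uea_relations UNIV"
    unfolding uea_relations_def by blast
  then have "uea_ideal \<nn> \<subseteq> uea_ideal UNIV \<inter> carrier (free_algebra \<nn>)"
    using uea_relations_subset[OF lie_subspace_n] uea_relations_in_ideal[OF lie_subspace_UNIV]
    by (intro uea_ideal_minimal) (auto simp: lie_subspace_n free_algebra_closed zero_in_uea_ideal lie_subspace_UNIV
        intro: zero_in_uea_ideal uea_ideal_closed[OF lie_subspace_UNIV])
  then show ?thesis by blast
qed

lemma uea_class_eq_iff:
  assumes "lie_subspace L" "f \<in> carrier (free_algebra L)" "g \<in> carrier (free_algebra L)"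
  shows "uea_class L f = uea_class L g \<longleftrightarrow> f - g \<in> uea_ideal L"
proof -
  have eq: "uea_class L h = {k + h | k. k \<in> uea_ideal L}" for h
    by (auto simp: uea_class_def a_r_coset_def' )
  show ?thesis
  proof
    assume "uea_class L f = uea_class L g"
    moreover have "f \<in> uea_class L f"
      using zero_in_uea_ideal[OF assms(1)] by (auto simp: eq)
    ultimately obtain k where "k \<in> uea_ideal L" "f = k + g" by (auto simp: eq)
    then show "f - g \<in> uea_ideal L" by simp
  next
    assume d: "f - g \<in> uea_ideal L"
    show "uea_class L f = uea_class L g"
    proof (intro equalityI subsetI)
      fix x assume "x \<in> uea_class L f"
      then obtain k where k: "k \<in> uea_ideal L" "x = k + f" by (auto simp: eq)
      then have "x = (k + (f - g)) + g" by simp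
      then show "x \<in> uea_class L g" using uea_ideal_closed(1)[OF assms(1) k(1) d] unfolding eq by blast
    next
      fix x assume "x \<in> uea_class L g"
      then obtain k where k: "k \<in> uea_ideal L" "x = k + g" by (auto simp: eq)
      then have "x = (k - (f - g)) + f" by simp
      then show "x \<in> uea_class L f" using uea_ideal_closed(3)[OF assms(1) k(1) d] unfolding eq by blast
    qed
  qed
qed

lemma in_uea_class:
  assumes "lie_subspace L"
  shows "g \<in> uea_class L f \<longleftrightarrow> g - f \<in> uea_ideal L"
proof
  assume "g - f \<in> uea_ideal L"
  then have "(g - f) + f \<in> uea_class L f"
    by (simp only: uea_class_def a_r_coset_def' free_algebra_simps) blast
  then show "g \<in> uea_class L f" by simp
qed (auto simp: uea_class_def a_r_coset_def')

lemma uea_class_self: "lie_subspace L \<Longrightarrow> f \<in> uea_class L f"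
  by (simp add: in_uea_class zero_in_uea_ideal)

lemma ring_uea: "lie_subspace L \<Longrightarrow> ring (\<U> L)"
  unfolding uea_def by (rule ideal.quotient_is_ring[OF ideal_uea_ideal])

lemma carrier_uea: "carrier (\<U> L) = uea_class L ` carrier (free_algebra L)"
  by (auto simp: uea_def FactRing_def A_RCOSETS_def' uea_class_def)

lemma uea_mult:
  assumes "lie_subspace L" "f \<in> carrier (free_algebra L)" "g \<in> carrier (free_algebra L)"
  shows "uea_class L f \<otimes>\<^bsub>\<U> L\<^esub> uea_class L g = uea_class L (f * g)"
  using ideal.rcoset_mult_add[OF ideal_uea_ideal[OF assms(1)] assms(2,3)]
  by (simp add: uea_def FactRing_def uea_class_def)

lemma uea_add:
  assumes "lie_subspace L" "f \<in> carrier (free_algebra L)" "g \<in> carrier (free_algebra L)"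
  shows "uea_class L f \<oplus>\<^bsub>\<U> L\<^esub> uea_class L g = uea_class L (f + g)"
proof -
  interpret ideal "uea_ideal L" "free_algebra L" by (rule ideal_uea_ideal[OF assms(1)])
  show ?thesis using a_rcos_sum[OF assms(2,3)] by (simp add: uea_def FactRing_def uea_class_def)
qed

lemma uea_one: "\<one>\<^bsub>\<U> L\<^esub> = uea_class L 1"
  by (simp add: uea_def FactRing_def uea_class_def)

lemma uea_inclusion_class:
  assumes "f \<in> carrier (free_algebra \<nn>)"
  shows "uea_inclusion (uea_class \<nn> f) = uea_class UNIV f"
proof -
  have "uea_class UNIV g = uea_class UNIV f" if "g \<in> uea_class \<nn> f" for g
    using that uea_ideal_n_subset
    by (auto simp: in_uea_class[OF lie_subspace_n] uea_class_eq_iff[OF lie_subspace_UNIV])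
  moreover have "f \<in> uea_class \<nn> f"
    by (rule uea_class_self[OF lie_subspace_n])
  ultimately show ?thesis unfolding uea_inclusion_def
    by (intro equalityI subsetI UN_I[of f]) blast+
qed

section \<open>The enveloping algebra acting on polynomials\<close>

context lie_char
begin

definition act :: "lieB free_alg \<Rightarrow> sym \<Rightarrow> sym"
  where "act f n = ext (\<lambda>u c. pscale [:c:] (foldr rho_vec (letters u) n)) f"

lemma act_add_left: "act (f + g) n = act f n + act g n"
  unfolding act_def by (rule ext_add) (simp flip: pscale_add_left)

lemma act_zero_left [simp]: "act 0 n = 0"
  by (simp add: act_def)

lemma act_single: "act (Poly_Mapping.single u c) n = pscale [:c:] (foldr rho_vec (letters u) n)"
  by (simp add: act_def ext_single)

lemma act_minus_left: "act (- f) n = - act f n"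
  using act_add_left[of f "- f" n] by (simp add: eq_neg_iff_add_eq_0 add.commute)

lemma act_diff_left: "act (f - g) n = act f n - act g n"
  using act_add_left[of f "- g" n] act_minus_left by simp

lemma act_add: "act f (m + n) = act f m + act f n"
proof (induction f rule: poly_mapping_induct_add)
  case (single u c)
  have "foldr rho_vec ys (m + n) = foldr rho_vec ys m + foldr rho_vec ys n" for ys
    by (induction ys) (auto simp: rho_vec_add)
  then show ?case by (simp add: act_single pscale_add)
qed (simp_all add: act_add_left)

lemma act_pscale: "act f (pscale p n) = pscale p (act f n)"
proof (induction f rule: poly_mapping_induct_add)
  case (single u c)
  have "foldr rho_vec ys (pscale p n) = pscale p (foldr rho_vec ys n)" for ys
    by (induction ys) (auto simp: rho_vec_pscale)
  then show ?case by (simp add: act_single mult.commute)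
qed (simp_all add: act_add_left pscale_add)

lemma act_zero [simp]: "act f 0 = 0"
  using act_pscale[of f 0 0] by simp

lemma act_mult: "act (f * g) n = act f (act g n)"
proof (induction f rule: poly_mapping_induct_add)
  case (single u c)
  show ?case
  proof (induction g rule: poly_mapping_induct_add)
    case (single v d)
    have "foldr rho_vec ys (pscale p n) = pscale p (foldr rho_vec ys n)" for ys p n
      by (induction ys) (auto simp: rho_vec_pscale)
    then show ?case by (simp add: mult_single act_single letters_plus mult.commute)
  next
    case (add f g)
    then show ?case by (simp add: distrib_left act_add_left act_add)
  qed simp
qed (simp_all add: distrib_right act_add_left)

lemma act_gen [simp]: "act (gen y) n = rho_vec y n"
  by (simp add: gen_def act_single flip: one_pCons)

lemma act_const [simp]: "act (const c) n = pscale [:c:] n"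
  by (simp add: const_def act_single letters_zero)

lemma act_one [simp]: "act 1 n = n"
  using act_const[of 1] by (simp add: const_def flip: one_pCons)

lemma act_uea_ideal:
  assumes "f \<in> uea_ideal UNIV"
  shows "act f n = 0"
proof -
  have "uea_ideal UNIV \<subseteq> {f. \<forall>n. act f n = 0}"
    by (rule uea_ideal_minimal)
      (auto simp: lie_subspace_UNIV uea_relations_def act_add_left act_diff_left act_mult act_minus_left
        rho_vec_add_left rho_vec_scaleB rho_vec_bracket)
  then show ?thesis using assms by blast
qed

text \<open>The polynomial \<open>1\<close> is the value of the empty word; a letter of \<nn> put in
  front of it is also the last letter and is replaced by its value. The sum over the support is
  built up inside \<nn> because \<phi> is known to be linear only there.\<close>

lemma rho_vec_one:
  assumes "y \<in> \<nn>"
  shows "rho_vec y 1 = pscale [:\<phi> y:] 1"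
proof -
  have one: "(1 :: sym) = straighten []"
    by (simp add: straighten_sorted normal_value_def monom_0 flip: one_pCons single_one)
  let ?s = "\<lambda>k. Poly_Mapping.single k (Poly_Mapping.lookup y k)"
  have "rho_vec (sum ?s A) 1 = pscale [:\<phi> (sum ?s A):] 1" if "finite A" "A \<subseteq> Poly_Mapping.keys y" for A
    using that
  proof (induction A)
    case empty
    have "\<phi> 0 = 0" using phi_add[OF n_zero n_zero] by simp
    then show ?case by simp
  next
    case (insert k A)
    have pos: "letter_pos (letter_of k)"
      using insert.prems assms by (cases k) (auto simp: letter_pos_def \<nn>_def)
    have kn: "Poly_Mapping.single k 1 \<in> \<nn>"
      using letter_vec_in_n[OF pos] by (simp add: letter_of_inverse)
    have sn: "?s k = Poly_Mapping.lookup y k *\<^sub>B Poly_Mapping.single k 1" for k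
      by (simp add: scaleB_single)
    have all: "?s j \<in> \<nn>" if "j \<in> Poly_Mapping.keys y" for j
      using that assms by (auto simp: \<nn>_def)
    have "rho (letter_of k) 1 = pscale [:\<phi> (Poly_Mapping.single k 1):] 1"
      using straighten_snoc_pos[OF pos, of "[]"] by (simp add: one rho_straighten chi_def letter_of_inverse)
    then have "rho_vec (?s k) 1 = pscale [:\<phi> (?s k):] 1"
      unfolding sn phi_scaleB[OF kn] by (simp add: rho_vec_scaleB rho_vec_single mult.commute flip: one_pCons)
    moreover have "\<phi> (?s k + sum ?s A) = \<phi> (?s k) + \<phi> (sum ?s A)"
      using insert.prems by (intro phi_add n_sum all) auto
    ultimately show ?case using insert by (simp add: rho_vec_add_left flip: pscale_add_left)
  qed
  from this[of "Poly_Mapping.keys y"] show ?thesis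
    by (simp add: poly_mapping_sum_keys)
qed

definition char_value :: "lieB free_alg \<Rightarrow> complex"
  where "char_value f = (\<Sum>v\<in>Poly_Mapping.keys f. Poly_Mapping.lookup f v * prod_list (map \<phi> (letters v)))"

lemma sum_pscale_const: "(\<Sum>a\<in>A. pscale [:h a:] n) = pscale [:\<Sum>a\<in>A. h a:] n"
  by (induction A rule: infinite_finite_induct) (auto simp flip: pscale_add_left)

lemma act_char:
  assumes "f \<in> carrier (free_algebra \<nn>)"
  shows "act f 1 = pscale [:char_value f:] 1"
proof -
  have *: "foldr rho_vec ys 1 = pscale [:prod_list (map \<phi> ys):] 1" if "set ys \<subseteq> \<nn>" for ys
    using that by (induction ys) (auto simp: rho_vec_one rho_vec_pscale mult.commute simp flip: one_pCons)
  have "act f 1 = (\<Sum>v\<in>Poly_Mapping.keys f. pscale [:Poly_Mapping.lookup f v * prod_list (map \<phi> (letters v)):] 1)"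
    unfolding act_def ext_def
    by (intro sum.cong refl) (use assms * in \<open>auto simp: in_free_algebra mult.commute\<close>)
  also have "\<dots> = pscale [:char_value f:] 1"
    unfolding char_value_def by (rule sum_pscale_const)
  finally show ?thesis .
qed

lemma pscale_const_one_inject: "pscale [:c:] 1 = pscale [:d:] 1 \<longleftrightarrow> c = d"
  by (metis lookup_one_zero lookup_pscale mult.right_neutral pCons_eq_iff)

text \<open>Independence of the representative is read off from the action:
  \<open>char_value f\<close> is the eigenvalue of \<open>f\<close> on \<open>1\<close>, and
  \<open>uea_ideal \<nn>\<close> acts as zero.\<close>

lemma uea_character_class:
  assumes "f \<in> carrier (free_algebra \<nn>)"
  shows "uea_character \<phi> (uea_class \<nn> f) = char_value f"
proof -
  have "char_value g = char_value f" if "g \<in> uea_class \<nn> f" for g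
  proof -
    have d: "g - f \<in> uea_ideal \<nn>" using that by (simp add: in_uea_class[OF lie_subspace_n])
    then have "(g - f) + f \<in> carrier (free_algebra \<nn>)"
      using assms uea_ideal_closed(6)[OF lie_subspace_n] free_algebra_closed(1) by blast
    then have "act g 1 = pscale [:char_value g:] 1" by (simp add: act_char)
    moreover have "act (g - f) 1 = 0" using d uea_ideal_n_subset act_uea_ideal by blast
    ultimately show ?thesis
      using act_char[OF assms] by (simp add: act_diff_left pscale_const_one_inject)
  qed
  moreover have "f \<in> uea_class \<nn> f"
    by (rule uea_class_self[OF lie_subspace_n])
  ultimately have "char_value ` uea_class \<nn> f = {char_value f}" by blast
  moreover have "uea_character \<phi> (uea_class \<nn> f) = the_elem (char_value ` uea_class \<nn> f)"
    unfolding uea_character_def char_value_def by (rule refl)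
  ultimately show ?thesis by (simp only: the_elem_eq)
qed

text \<open>The variables are the letters with \<open>a + i \<le> 1\<close> other than
  \<open>t\<close>. Only such polynomials arise as values of \<open>straighten\<close>, and on them
  \<open>t\<close> acts as multiplication by the indeterminate (\<open>rho_central\<close>).\<close>

definition valid :: "sym \<Rightarrow> bool"
  where "valid n \<longleftrightarrow> (\<forall>m\<in>Poly_Mapping.keys n. \<forall>x\<in>#m. \<not> letter_pos x \<and> x \<noteq> central)"

lemma valid_zero [simp]: "valid 0"
  by (simp add: valid_def)

lemma valid_add: "valid m \<Longrightarrow> valid n \<Longrightarrow> valid (m + n)"
  using keys_add[of m n] by (auto simp: valid_def)

lemma valid_pscale: "valid n \<Longrightarrow> valid (pscale p n)"
  by (auto simp: valid_def in_keys_iff)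

lemma valid_sum: "(\<And>a. a \<in> A \<Longrightarrow> valid (f a)) \<Longrightarrow> valid (sum f A)"
  by (induction A rule: infinite_finite_induct) (auto simp: valid_add)

lemma valid_straighten: "valid (straighten w)"
proof (induction w rule: straighten_induct)
  case (snoc_pos u x)
  then show ?case by (simp add: straighten_snoc_pos valid_pscale)
next
  case (swap u x y v)
  then show ?case using straighten_swap[of u x y v] by (simp add: valid_pscale valid_add)
next
  case (sorted w)
  then show ?case
    by (auto simp: straighten_sorted[of w] valid_def normal_value_def[of w] split: if_splits)
qed

lemma valid_rho: "valid (rho x n)"
  unfolding rho_def ext_def by (intro valid_sum valid_pscale valid_straighten)

lemma valid_rho_vec: "valid (rho_vec y n)"
  unfolding rho_vec_def ext_def by (intro valid_sum valid_pscale valid_rho)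

lemma valid_one: "valid 1"
  by (simp add: valid_def)

lemma valid_act:
  assumes "valid n"
  shows "valid (act f n)"
proof -
  have "valid (foldr rho_vec ys n)" for ys
    using assms by (induction ys) (auto simp: valid_rho_vec)
  then show ?thesis unfolding act_def ext_def by (intro valid_sum valid_pscale)
qed

lemma straighten_word_of:
  assumes "\<forall>x\<in>#m. \<not> letter_pos x \<and> x \<noteq> central"
  shows "straighten (word_of m) = Poly_Mapping.single m 1"
proof -
  have "{#x \<in># m. x \<noteq> central#} = m"
    using assms by (intro filter_mset_eq_conv[THEN iffD2]) auto
  moreover have "count_list (word_of m) central = 0"
    using assms by (auto simp: count_list_0_iff)
  ultimately show ?thesis using assms
    by (simp add: straighten_sorted normal_value_def mset_filter monom_0 flip: one_pCons)
qed

lemma rho_central: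
  assumes "valid n"
  shows "rho central n = pscale [:0, 1:] n"
proof -
  have "rho central n = (\<Sum>m\<in>Poly_Mapping.keys n.
      pscale [:0, 1:] (Poly_Mapping.single m (Poly_Mapping.lookup n m)))"
    unfolding rho_def ext_def
    by (intro sum.cong refl)
      (use assms in \<open>auto simp: valid_def straighten_Cons_central straighten_word_of mult.commute\<close>)
  then show ?thesis by (simp only: poly_mapping_sum_keys flip: pscale_sum)
qed

end

section \<open>The Hankel condition\<close>

definition poly_ideal :: "complex poly set \<Rightarrow> bool"
  where "poly_ideal J \<longleftrightarrow> 0 \<in> J \<and> (\<forall>p\<in>J. \<forall>q\<in>J. p + q \<in> J) \<and> (\<forall>p\<in>J. \<forall>q. q * p \<in> J)"

text \<open>Division by a nonzero element of least degree. The generator is needed for its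
  remainders, whose coefficients are complex coordinates of polynomials modulo \<open>J\<close>,
  accessible to the rank condition.\<close>

lemma poly_ideal_principal:
  assumes "poly_ideal J"
  obtains g where "J = {p. g dvd p}"
proof (cases "J = {0}")
  case True
  then show ?thesis using that[of 0] by auto
next
  case False
  then obtain h where h: "h \<in> J \<and> h \<noteq> 0" using assms by (auto simp: poly_ideal_def)
  define g where "g = arg_min degree (\<lambda>p. p \<in> J \<and> p \<noteq> 0)"
  have g: "g \<in> J" "g \<noteq> 0" and min: "\<And>p. p \<in> J \<and> p \<noteq> 0 \<Longrightarrow> degree g \<le> degree p"
    using arg_min_nat_lemma[of "\<lambda>p. p \<in> J \<and> p \<noteq> 0" h degree] h by (auto simp: g_def)
  have "g dvd p" if "p \<in> J" for p
  proof -
    have "p + (- (p div g)) * g \<in> J" using assms that g(1) unfolding poly_ideal_def by blast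
    then have "p mod g \<in> J" by (simp add: minus_div_mult_eq_mod)
    then have "p mod g = 0" using min[of "p mod g"] degree_mod_less[OF g(2), of p] by force
    then show ?thesis by (simp add: mod_eq_0_iff_dvd)
  qed
  moreover have "p \<in> J" if "g dvd p" for p
    using that assms g(1) by (auto simp: poly_ideal_def dvd_def mult.commute)
  ultimately show ?thesis using that[of g] by blast
qed

lemma poly_ideal_sum: "poly_ideal J \<Longrightarrow> (\<And>a. a \<in> A \<Longrightarrow> f a \<in> J) \<Longrightarrow> sum f A \<in> J"
  by (induction A rule: infinite_finite_induct) (auto simp: poly_ideal_def)

lemma poly_ideal_const_mult:
  assumes "poly_ideal J" "[:c:] * p \<in> J" "c \<noteq> 0"
  shows "p \<in> J"
proof -
  have "[:inverse c:] * ([:c:] * p) \<in> J" using assms unfolding poly_ideal_def by blast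
  then show ?thesis using assms(3) by simp
qed

lemma sum_fun_apply: "sum F A x = (\<Sum>a\<in>A. F a x)"
  by (induction A rule: infinite_finite_induct) (auto simp: zero_fun_def plus_fun_def)

text \<open>Rank \<open>n + 1\<close> means that the \<open>n + 1\<close> columns are independent: a
  relation with \<open>a j0\<close> nonzero would express column \<open>j0\<close> by the other
  \<open>n\<close> columns and bound the rank by \<open>n\<close>.\<close>

lemma good_character_relation:
  assumes "good_character \<phi>" "1 \<le> n" "1 \<le> s"
    and "\<And>m. 1 \<le> m \<Longrightarrow> (\<Sum>j\<le>n. a j * hankel \<phi> s m j) = 0"
    and "j0 \<le> n"
  shows "a j0 = 0"
proof (rule ccontr)
  assume nz: "a j0 \<noteq> 0"
  let ?sc = "\<lambda>c (f :: nat \<Rightarrow> complex) m. c * f m"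
  interpret vs: vector_space ?sc
    by unfold_locales (auto simp: fun_eq_iff algebra_simps)
  let ?V = "\<lambda>j m. if m \<in> {1..} then hankel \<phi> s m j else (0 :: complex)"
  let ?T = "{0..n} - {j0}"
  have "?V j0 = (\<Sum>j\<in>?T. ?sc (- (a j / a j0)) (?V j))"
  proof
    fix m
    show "?V j0 m = (\<Sum>j\<in>?T. ?sc (- (a j / a j0)) (?V j)) m"
    proof (cases "m \<ge> 1")
      case True
      have "0 = (\<Sum>j\<in>{0..n}. a j * hankel \<phi> s m j)"
        using assms(4)[OF True] by (simp add: atLeast0AtMost)
      also have "\<dots> = a j0 * hankel \<phi> s m j0 + (\<Sum>j\<in>?T. a j * hankel \<phi> s m j)"
        by (rule sum.remove) (use assms(5) in auto)
      finally have "hankel \<phi> s m j0 = - (\<Sum>j\<in>?T. a j * hankel \<phi> s m j) / a j0"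
        using nz by (simp add: field_simps eq_neg_iff_add_eq_0)
      also have "\<dots> = (\<Sum>j\<in>?T. - (a j / a j0) * hankel \<phi> s m j)"
        by (simp add: sum_negf sum_divide_distrib)
      finally show ?thesis using True by (simp add: sum_fun_apply)
    qed (simp add: sum_fun_apply)
  qed
  moreover have "(\<Sum>j\<in>?T. ?sc (- (a j / a j0)) (?V j)) \<in> vs.span (?V ` ?T)"
    by (intro vs.span_sum vs.span_scale vs.span_base imageI)
  ultimately have j0: "?V j0 \<in> vs.span (?V ` ?T)" by (simp only:)
  have "?V ` {0..n} \<subseteq> vs.span (?V ` ?T)"
  proof (rule image_subsetI)
    fix j assume "j \<in> {0..n}"
    then show "?V j \<in> vs.span (?V ` ?T)"
      using j0 by (cases "j = j0") (simp_all only:, intro vs.span_base imageI, blast)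
  qed
  then have "vs.dim (?V ` {0..n}) \<le> card (?V ` ?T)"
    by (rule vs.dim_le_card) simp
  also have "\<dots> \<le> card ?T" by (rule card_image_le) simp
  also have "\<dots> = n" using assms(5) by simp
  finally have "matrix_rank {1..} {0..n} (hankel \<phi> s) \<le> n"
    by (simp add: matrix_rank_def)
  moreover have "matrix_rank {1..} {0..n} (hankel \<phi> s) = n + 1"
    using assms(1-3) by (auto simp: good_character_def)
  ultimately show False by simp
qed

text \<open>The filtration by the number of variables; powers of \<open>t\<close> sit in the
  coefficients and do not count.\<close>

definition size_less :: "nat \<Rightarrow> sym \<Rightarrow> bool"
  where "size_less k n \<longleftrightarrow> (\<forall>m. k \<le> size m \<longrightarrow> Poly_Mapping.lookup n m = 0)"

lemma size_less_mono: "size_less k n \<Longrightarrow> k \<le> l \<Longrightarrow> size_less l n"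
  by (simp add: size_less_def)

lemma size_less_add: "size_less k m \<Longrightarrow> size_less k n \<Longrightarrow> size_less k (m + n)"
  and size_less_pscale: "size_less k n \<Longrightarrow> size_less k (pscale p n)"
  by (simp_all add: size_less_def lookup_add)

lemma size_less_sum: "(\<And>a. a \<in> A \<Longrightarrow> size_less k (f a)) \<Longrightarrow> size_less k (sum f A)"
  by (simp add: size_less_def lookup_sum)

text \<open>Taking commutators with the letters of a word yields a sum over positions; collecting
  equal letters produces the exponents that occur in partial derivatives.\<close>

lemma sum_nth_count:
  "(\<Sum>k<length w. if w ! k = y then c else 0) = of_nat (count_list w y) * (c :: 'b::semiring_1)"
  by (induction w) (auto simp: sum.lessThan_Suc_shift algebra_simps simp del: sum.lessThan_Suc)

section \<open>Leading terms of straightened words\<close>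

context lie_char
begin

lemma size_less_straighten: "size_less (Suc (length w)) (straighten w)"
proof (induction w rule: straighten_induct)
  case (snoc_pos u x)
  then show ?case
    by (auto simp: straighten_snoc_pos intro!: size_less_pscale intro: size_less_mono)
next
  case (swap u x y v)
  then show ?case
    using straighten_swap[of u x y v]
    by (auto intro!: size_less_pscale size_less_add intro: size_less_mono)
next
  case (sorted w)
  have "size (mset (filter (\<lambda>x. x \<noteq> central) w)) \<le> length w"
    by (simp del: mset_filter)
  then show ?case using sorted
    by (auto simp: straighten_sorted[of w] normal_value_def[of w] size_less_def lookup_single when_def
        simp del: size_mset)
qed

text \<open>A positive letter costs one unit of size: carried to the end it becomes a scalar, and
  each commutator met on the way merges two letters into one.\<close>

lemma size_less_straighten_pos:
  assumes "letter_pos x"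
  shows "size_less (length (u @ x # v)) (straighten (u @ x # v))"
  unfolding straighten_move_right[of u x v]
proof (intro size_less_add size_less_sum size_less_pscale)
  have "straighten ((u @ v) @ [x]) = pscale [:chi x:] (straighten (u @ v))"
    by (rule straighten_snoc_pos[OF assms])
  then show "size_less (length (u @ x # v)) (straighten (u @ v @ [x]))"
    using size_less_pscale[OF size_less_straighten[of "u @ v"]] by simp
  show "size_less (length (u @ x # v)) (straighten (u @ v[k := y]))" for k y
    using size_less_straighten[of "u @ v[k := y]"] by simp
qed

text \<open>Modulo smaller size the letters commute, because bracket terms are shorter; so a word
  has its commutative monomial as leading term.\<close>

lemma straighten_top:
  assumes "\<forall>x\<in>set w. \<not> letter_pos x \<and> x \<noteq> central" "length w \<le> size M"
  shows "Poly_Mapping.lookup (straighten w) M = (1 when M = mset w)"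
  using assms
proof (induction w rule: straighten_induct)
  case (swap u x y v)
  have "Poly_Mapping.lookup (straighten (u @ letter_br x y # v)) M = 0"
    using size_less_straighten[of "u @ letter_br x y # v"] swap.prems by (simp add: size_less_def)
  then show ?case
    using swap.IH(1) swap.prems straighten_swap[of u x y v]
    by (simp add: lookup_add add_mset_commute)
next
  case (sorted w)
  have "filter (\<lambda>x. x \<noteq> central) w = w" "count_list w central = 0"
    using sorted.prems by (auto simp: count_list_0_iff filter_id_conv)
  then show ?case using sorted
    by (cases "M = mset w")
      (auto simp: straighten_sorted[of w] normal_value_def[of w] lookup_single monom_0 simp flip: one_pCons)
qed auto

text \<open>The letter \<open>(1, i)\<close> is the vector \<open>E_i\<close> of the overview, so
  this is the operator \<open>E_i - \<phi>(E_i)\<close>.\<close>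

definition shifted :: "nat \<Rightarrow> sym \<Rightarrow> sym"
  where "shifted i n = rho (1, i) n - pscale [:chi (1, i):] n"

lemma shifted_add: "shifted i (m + n) = shifted i m + shifted i n"
  by (simp add: shifted_def rho_add pscale_add)

lemma shifted_zero [simp]: "shifted i 0 = 0"
  by (simp add: shifted_def)

lemma shifted_sum: "shifted i (sum f A) = (\<Sum>a\<in>A. shifted i (f a))"
  by (induction A rule: infinite_finite_induct) (auto simp: shifted_add)

text \<open>By the Leibniz rule \<open>E_i\<close> moves to the end of the word, where it becomes
  the scalar that is subtracted; only the commutators are left.\<close>

lemma lookup_shifted_single:
  assumes "\<forall>x\<in>#m. \<not> letter_pos x \<and> x \<noteq> central"
  shows "Poly_Mapping.lookup (shifted i (Poly_Mapping.single m p)) M =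
    p * (\<Sum>k<size m. [:letter_coef (1, i) (word_of m ! k):] * Poly_Mapping.lookup
      (straighten ((word_of m)[k := letter_br (1, i) (word_of m ! k)])) M)"
proof -
  let ?w = "word_of m" and ?E = "(1, i) :: letter"
  have "straighten (?w @ [?E]) = pscale [:chi ?E:] (straighten ?w)"
    by (rule straighten_snoc_pos) (simp add: letter_pos_def)
  then have "straighten (?E # ?w) = pscale [:chi ?E:] (Poly_Mapping.single m 1)
      + (\<Sum>k<length ?w. pscale [:letter_coef ?E (?w ! k):] (straighten (?w[k := letter_br ?E (?w ! k)])))"
    using straighten_move_right[of "[]" ?E ?w] straighten_word_of[OF assms] by simp
  moreover have "length ?w = size m" by (metis mset_sorted_list_of_multiset size_mset)
  ultimately show ?thesis
    by (simp add: shifted_def rho_single lookup_minus lookup_add lookup_sum lookup_single when_def algebra_simps)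
qed

lemma word_of_nth:
  assumes "k < size m"
  shows "word_of m ! k \<in># m"
  using assms nth_mem[of k "word_of m"] size_mset[of "word_of m"] by simp

text \<open>A commutator keeps the size only if its letter is not positive, that is, if the replaced
  letter has negative degree; a letter of degree 0 becomes positive and size is lost. The bound
  \<open>2 \<le> i\<close> keeps the new letter from being central.\<close>

lemma lookup_shifted_top:
  assumes m: "\<forall>x\<in>#m. \<not> letter_pos x \<and> x \<noteq> central" and i: "2 \<le> i" and M: "size m \<le> size M"
  shows "Poly_Mapping.lookup (shifted i (Poly_Mapping.single m p)) M =
    p * (\<Sum>k<size m. if fst (word_of m ! k) < 0 \<and>
        M = add_mset (letter_br (1, i) (word_of m ! k)) (m - {#word_of m ! k#})
      then [:letter_coef (1, i) (word_of m ! k):] else 0)"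
  unfolding lookup_shifted_single[OF m]
proof (intro arg_cong[of _ _ "(*) p"] sum.cong refl)
  fix k assume k: "k \<in> {..<size m}"
  let ?w = "word_of m"
  have lw: "length ?w = size m" by (metis mset_sorted_list_of_multiset size_mset)
  let ?x = "?w ! k" and ?v = "?w[k := letter_br (1, i) (?w ! k)]"
  have x: "?x \<in># m" "\<not> letter_pos ?x" using word_of_nth k m by auto
  obtain d j where dj: "?x = (d, j)" by (cases ?x)
  have ms: "mset ?v = add_mset (letter_br (1, i) ?x) (m - {#?x#})"
    using k lw by (simp add: mset_update)
  show "[:letter_coef (1, i) ?x:] * Poly_Mapping.lookup (straighten ?v) M =
    (if fst ?x < 0 \<and> M = add_mset (letter_br (1, i) ?x) (m - {#?x#}) then [:letter_coef (1, i) ?x:] else 0)"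
  proof (cases "fst ?x < 0")
    case True
    have "\<forall>y\<in>set ?v. \<not> letter_pos y \<and> y \<noteq> central"
    proof
      fix y assume "y \<in> set ?v"
      then consider "y \<in># m" | "y = letter_br (1, i) ?x"
        using set_update_subset_insert[of ?w k] by fastforce
      then show "\<not> letter_pos y \<and> y \<noteq> central"
        using m True i by cases (auto simp: dj letter_pos_def)
    qed
    then show ?thesis using True ms lw M straighten_top[of ?v M] by (simp add: when_def)
  next
    case False
    then have "letter_pos (letter_br (1, i) ?x)" by (simp add: dj letter_pos_def)
    then have "size_less (length ?v) (straighten ?v)"
      using size_less_straighten_pos[of "letter_br (1, i) ?x" "take k ?w" "drop (Suc k) ?w"] k lw
      by (simp add: upd_conv_take_nth_drop)
    then show ?thesis using False lw M by (simp add: size_less_def)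
  qed
qed

lemma letter_pos_br: "letter_pos x \<Longrightarrow> fst y = 0 \<Longrightarrow> letter_pos (letter_br x y)"
  by (cases x; cases y) (simp add: letter_pos_def)

text \<open>If all variables have degree 0, every commutator is a positive letter of degree 1. It is
  carried to the end once more, and one size below the monomial only its value under
  \<open>chi\<close> is visible: this gives the derivatives weighted by values of \<phi>.\<close>

lemma lookup_shifted_degree_zero:
  assumes m: "\<forall>x\<in>#m. fst x = 0 \<and> x \<noteq> central" and M: "size m \<le> Suc (size M)"
  shows "Poly_Mapping.lookup (shifted i (Poly_Mapping.single m p)) M =
    p * (\<Sum>k<size m. if M = m - {#word_of m ! k#}
      then [:letter_coef (1, i) (word_of m ! k) * chi (letter_br (1, i) (word_of m ! k)):] else 0)"
proof -
  have m': "\<forall>x\<in>#m. \<not> letter_pos x \<and> x \<noteq> central" using m by (auto simp: letter_pos_def)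
  let ?w = "word_of m"
  have lw: "length ?w = size m" by (metis mset_sorted_list_of_multiset size_mset)
  show ?thesis
    unfolding lookup_shifted_single[OF m']
  proof (intro arg_cong[of _ _ "(*) p"] sum.cong refl)
    fix k assume k: "k \<in> {..<size m}"
    let ?x = "?w ! k" let ?e = "letter_br (1, i) ?x"
    let ?u = "take k ?w" and ?v = "drop (Suc k) ?w"
    have zero: "fst y = 0" if "y \<in> set ?w" for y using that m by simp
    have fx: "fst ?x = 0" using zero[OF nth_mem] k lw by simp
    then have pos: "letter_pos ?e" by (cases ?x) (simp add: letter_pos_def)
    \<comment> \<open>The second commutators have one letter less and still contain a positive
      letter, so their size is at most \<open>size m - 2\<close>.\<close>
    have "Poly_Mapping.lookup (straighten (?u @ ?v[l := letter_br ?e (?v ! l)])) M = 0"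
      if l: "l < length ?v" for l
    proof -
      have "?v ! l \<in> set ?w" using l by (meson in_set_dropD nth_mem)
      then have "letter_pos (letter_br ?e (?v ! l))"
        by (intro letter_pos_br[OF pos] zero)
      then have "size_less (length (?u @ take l ?v @ letter_br ?e (?v ! l) # drop (Suc l) ?v))
          (straighten (?u @ ?v[l := letter_br ?e (?v ! l)]))"
        using size_less_straighten_pos[of "letter_br ?e (?v ! l)" "?u @ take l ?v" "drop (Suc l) ?v"] l
        by (simp add: upd_conv_take_nth_drop)
      then show ?thesis using l k lw M by (simp add: size_less_def)
    qed
    moreover have "straighten (?u @ ?v @ [?e]) = pscale [:chi ?e:] (straighten (?u @ ?v))"
      using straighten_snoc_pos[OF pos, of "?u @ ?v"] by simp
    ultimately have "Poly_Mapping.lookup (straighten (?u @ ?e # ?v)) M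
        = [:chi ?e:] * Poly_Mapping.lookup (straighten (?u @ ?v)) M"
      unfolding straighten_move_right[of ?u ?e ?v] by (simp add: lookup_add lookup_sum)
    moreover have "Poly_Mapping.lookup (straighten (?u @ ?v)) M = (1 when M = mset (?u @ ?v))"
      by (rule straighten_top) (use m' lw k M in \<open>auto dest!: in_set_takeD in_set_dropD\<close>)
    moreover have "mset (?u @ ?v) = m - {#?x#}"
    proof -
      have "?w = ?u @ ?x # ?v" using k lw by (simp add: id_take_nth_drop)
      then have "m = add_mset ?x (mset (?u @ ?v))"
        by (metis mset_append mset.simps(2) mset_sorted_list_of_multiset union_mset_add_mset_right)
      then show ?thesis by (metis add_mset_remove_trivial)
    qed
    ultimately show "[:letter_coef (1, i) ?x:] * Poly_Mapping.lookup (straighten (?w[k := ?e])) M =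
      (if M = m - {#?x#} then [:letter_coef (1, i) ?x * chi ?e:] else 0)"
      using k lw by (simp add: upd_conv_take_nth_drop when_def)
  qed
qed

section \<open>Whittaker vectors modulo an ideal of coefficients\<close>

lemma lookup_in_ideal:
  assumes "poly_ideal J" "\<And>m. Poly_Mapping.lookup n m \<in> J"
  shows "Poly_Mapping.lookup (rho x n) M \<in> J" "Poly_Mapping.lookup (pscale p n) M \<in> J"
proof -
  have mult: "a * b \<in> J" if "a \<in> J" for a b
    using that assms(1) by (metis poly_ideal_def mult.commute)
  show "Poly_Mapping.lookup (pscale p n) M \<in> J"
    using mult[OF assms(2)] by (simp add: mult.commute)
  show "Poly_Mapping.lookup (rho x n) M \<in> J"
    unfolding rho_def ext_def lookup_sum
    by (intro poly_ideal_sum[OF assms(1)]) (simp add: mult assms(2))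
qed

text \<open>The argument of the overview, with membership in \<open>J\<close> in place of vanishing.
  \<open>K\<close> collects the monomials with coefficient outside \<open>J\<close>; the remainder
  \<open>n2\<close> contributes only elements of \<open>J\<close>, and \<open>F i m M\<close> is
  what the monomial \<open>m\<close> contributes to the coefficient at \<open>M\<close>.\<close>

lemma shifted_ideal_imp_ideal:
  assumes good: "good_character \<phi>" and J: "poly_ideal J" and val: "valid n"
    and shifted: "\<And>i M. Poly_Mapping.lookup (shifted i n) M \<in> J"
    and "m \<noteq> {#}"
  shows "Poly_Mapping.lookup n m \<in> J"
proof (rule ccontr)
  assume bad: "Poly_Mapping.lookup n m \<notin> J"
  let ?l = Poly_Mapping.lookup
  define K where "K = {m \<in> Poly_Mapping.keys n. ?l n m \<notin> J}"
  have finK: "finite K" by (simp add: K_def)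
  define n2 where "n2 = n - (\<Sum>m\<in>K. Poly_Mapping.single m (?l n m))"
  have J0: "0 \<in> J" and J_add: "p \<in> J \<Longrightarrow> q \<in> J \<Longrightarrow> p + q \<in> J" and J_mult: "p \<in> J \<Longrightarrow> q * p \<in> J" for p q
    using J by (auto simp: poly_ideal_def)
  have J_diff: "p - q \<in> J" if "p \<in> J" "q \<in> J" for p q
    using J_add[OF that(1) J_mult[OF that(2), of "- 1"]] by simp
  have n2J: "?l n2 M \<in> J" for M
  proof -
    have "?l (\<Sum>m\<in>K. Poly_Mapping.single m (?l n m)) M = (if M \<in> K then ?l n M else 0)"
      using finK by (simp add: lookup_sum lookup_single when_def sum.delta)
    then show ?thesis using J0 by (auto simp: n2_def lookup_minus K_def not_in_keys_iff_lookup_eq_zero)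
  qed
  define F where "F i m M = ?l (shifted i (Poly_Mapping.single m (?l n m))) M" for i m M
  have FJ: "(\<Sum>m\<in>K. F i m M) \<in> J" for i M
  proof -
    have "n = (\<Sum>m\<in>K. Poly_Mapping.single m (?l n m)) + n2" by (simp add: n2_def)
    then have "shifted i n = (\<Sum>m\<in>K. shifted i (Poly_Mapping.single m (?l n m))) + shifted i n2"
      by (metis shifted_add shifted_sum)
    then have "?l (shifted i n) M = (\<Sum>m\<in>K. F i m M) + ?l (shifted i n2) M"
      by (simp add: lookup_add lookup_sum F_def)
    moreover have "?l (shifted i n2) M \<in> J"
      unfolding shifted_def lookup_minus using n2J by (intro J_diff lookup_in_ideal[OF J])
    ultimately show ?thesis using J_diff[OF shifted[of i M]] by (metis add_diff_cancel_right')
  qed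
  have mK: "m \<in> K" using bad J0 by (auto simp: K_def in_keys_iff)
  have Kval: "\<not> letter_pos x \<and> x \<noteq> central" if "m \<in> K" "x \<in># m" for m x
    using val that unfolding valid_def K_def by blast
  define r where "r = Max (size ` K)"
  have size_le: "size m \<le> r" if "m \<in> K" for m
    using that finK by (simp add: r_def)
  have "r \<in> size ` K" unfolding r_def using finK mK by (intro Max_in) auto
  then obtain m1 where m1: "m1 \<in> K" "size m1 = r" by auto
  have "r \<noteq> 0" using size_le[OF mK] assms(5) by (metis le_zero_eq size_eq_0_iff_empty)
  have "finite (\<Union>m\<in>K. snd ` set_mset m)" using finK by auto
  then obtain B where "\<forall>j\<in>(\<Union>m\<in>K. snd ` set_mset m). j \<le> B"
    using finite_nat_set_iff_bounded_le by blast
  then have B: "snd x \<le> B" if "m \<in> K" "x \<in># m" for m x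
    using that by blast
  \<comment> \<open>The bracket with \<open>(1, i)\<close> has index \<open>i + j - 1\<close>, which
    is at least \<open>B + 1\<close>; so it is a variable that no monomial of \<open>K\<close>
    contains.\<close>
  have new: "B < snd (letter_br (1, i) x)" if "B + 2 \<le> i" for i x
    using that by (cases x) auto

  have deg0: "fst y = 0" if m0: "m0 \<in> K" "size m0 = r" and y: "y \<in># m0" for m0 y
  proof (rule ccontr)
    assume "fst y \<noteq> 0"
    then have neg: "fst y < 0" using Kval[OF m0(1) y] by (auto simp: letter_pos_def)
    let ?i = "B + 2"
    let ?z = "letter_br (1, ?i) y"
    \<comment> \<open>\<open>M\<close> is \<open>m0\<close> with one \<open>y\<close> turned into
      the new variable \<open>?z\<close>. In a term producing \<open>M\<close>, the letter
      \<open>?z\<close> must come from the commutator, and bracketing with \<open>(1, ?i)\<close> is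
      injective on letters, so the term arises from \<open>y\<close> in \<open>m0\<close>.\<close>
    define M where "M = add_mset ?z (m0 - {#y#})"
    have szM: "size M = r" 
      unfolding M_def by (metis insert_DiffM m0(2) size_add_mset y)
    have only_y: "m = m0 \<and> x = y"
      if "m \<in> K" "x \<in># m" "M = add_mset (letter_br (1, ?i) x) (m - {#x#})" for m x
    proof -
      have "?z \<in># add_mset (letter_br (1, ?i) x) (m - {#x#})"
        using that(3) by (metis M_def union_single_eq_member)
      moreover have "?z \<notin># m" using B[OF that(1)] new[of ?i y] by fastforce
      ultimately have "?z = letter_br (1, ?i) x" by (auto dest: in_diffD)
      then have xy: "x = y" by (cases x; cases y) auto
      then have "m - {#y#} = m0 - {#y#}" using that(3) by (simp add: M_def)
      then show ?thesis using xy y that(2) by (metis insert_DiffM)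
    qed
    have F_eq: "F ?i m M = ?l n m * (\<Sum>k<size m. if fst (word_of m ! k) < 0 \<and>
        M = add_mset (letter_br (1, ?i) (word_of m ! k)) (m - {#word_of m ! k#})
      then [:letter_coef (1, ?i) (word_of m ! k):] else 0)" if "m \<in> K" for m
      unfolding F_def by (rule lookup_shifted_top) (use Kval that size_le szM in auto)
    have "F ?i m M = 0" if "m \<in> K - {m0}" for m
      unfolding F_eq[OF DiffD1[OF that]]
      by (intro mult_eq_0_iff[THEN iffD2] disjI2 sum.neutral)
        (use that only_y[OF DiffD1[OF that] word_of_nth] in \<open>auto simp del: letter_br.simps letter_coef.simps\<close>)
    then have "(\<Sum>m\<in>K. F ?i m M) = F ?i m0 M"
      using finK m0(1) by (simp add: sum.remove)
    also have "\<dots> = ?l n m0 * (\<Sum>k<length (word_of m0). if word_of m0 ! k = y then [:letter_coef (1, ?i) y:] else 0)"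
    proof -
      have "length (word_of m0) = size m0" by (metis mset_sorted_list_of_multiset size_mset)
      then show ?thesis unfolding F_eq[OF m0(1)]
        using only_y[OF m0(1) word_of_nth] neg
        by (intro arg_cong[of _ _ "(*) (?l n m0)"] sum.cong) (auto simp: M_def simp del: letter_br.simps letter_coef.simps)
    qed
    also have "\<dots> = [:of_nat (count m0 y) * letter_coef (1, ?i) y:] * ?l n m0"
      unfolding sum_nth_count by (simp add: of_nat_poly mult.commute flip: count_mset)
    finally have "[:of_nat (count m0 y) * letter_coef (1, ?i) y:] * ?l n m0 \<in> J" using FJ by metis
    moreover have "letter_coef (1, ?i) y \<noteq> 0"
    \<comment> \<open>For \<open>y = (d, j)\<close> the coefficient is \<open>d * ?i - j\<close>,
      negative since \<open>d < 0\<close>.\<close>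
    proof -
      obtain d j where dj: "y = (d, j)" by (cases y)
      have "d * int ?i < 0" using neg dj by (intro mult_neg_pos) auto
      then have "d * int ?i - 1 * int j < 0" by simp
      then show ?thesis unfolding dj letter_coef.simps by (metis less_irrefl of_int_eq_0_iff)
    qed
    ultimately have "?l n m0 \<in> J" using poly_ideal_const_mult[OF J] y by (simp del: letter_coef.simps)
    then show False using m0(1) by (simp add: K_def)
  qed

  obtain y1 where y1: "y1 \<in># m1" using m1 \<open>r \<noteq> 0\<close> by (metis size_eq_0_iff_empty multiset_nonemptyE)
  obtain j1 where j1: "y1 = (0, j1)" using deg0[OF m1 y1] by (metis prod.collapse)
  have "j1 \<noteq> 0" using Kval[OF m1(1) y1] j1 by auto
  have "j1 \<le> B" using B[OF m1(1) y1] j1 by simp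
  \<comment> \<open>The coefficient at \<open>m0\<close>, one size below the top, will be compared:
    it sees the top monomials obtained from \<open>m0\<close> by adding one variable.\<close>
  define m0 where "m0 = m1 - {#y1#}"
  have m1_eq: "m1 = add_mset (0, j1) m0" using y1 j1 by (simp add: m0_def)
  have szm0: "Suc (size m0) = r" using m1(2) m1_eq by simp
  define c where "c j = \<phi> (xB (2 - int j) j)" for j
  \<comment> \<open>Up to the factor \<open>-j\<close>, this is the coefficient at \<open>m0\<close>
    of the derivative of the top part with respect to the variable \<open>(0, j)\<close>;
    \<open>Suc (count m0 (0, j))\<close> is the exponent before differentiation. Monomials outside
    \<open>K\<close> count as zero.\<close>
  define Q where "Q j = [:- of_nat j * of_nat (Suc (count m0 (0, j))):] * (if add_mset (0, j) m0 \<in> K then ?l n (add_mset (0, j) m0) else 0)" for j :: nat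
  have rel: "(\<Sum>j\<le>B. [:c (i + j - 1):] * Q j) \<in> J" if i: "B + 2 \<le> i" for i
  proof -
    define G where "G m = (\<Sum>k<size m. if m0 = m - {#word_of m ! k#}
      then [:letter_coef (1, i) (word_of m ! k) * chi (letter_br (1, i) (word_of m ! k)):] else 0)" for m
    let ?S = "(\<lambda>j. add_mset (0, j) m0) ` {..B}"
    \<comment> \<open>Monomials below the top size could reach \<open>m0\<close> only through a
      commutator that keeps the size, and this would leave in \<open>m0\<close> a new
      variable.\<close>
    have FG: "F i m m0 = (if size m = r then ?l n m * G m else 0)" if "m \<in> K" for m
    proof (cases "size m = r")
      case True
      then show ?thesis
        unfolding F_def G_def using that deg0 Kval szm0
        by (subst lookup_shifted_degree_zero) auto
    next
      case False
      have "m0 \<noteq> add_mset (letter_br (1, i) x) (m - {#x#})" for x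
      proof
        assume "m0 = add_mset (letter_br (1, i) x) (m - {#x#})"
        then have "letter_br (1, i) x \<in># m1" using m1_eq by (metis insert_iff set_mset_add_mset_insert)
        then show False using B[OF m1(1)] new[OF i, of x] by fastforce
      qed
      then show ?thesis
        unfolding F_def using False that Kval szm0 size_le[OF that] i
        by (subst lookup_shifted_top) auto
    qed
    have GS: "m \<in> ?S" if mr: "m \<in> K" "size m = r" and Gm: "G m \<noteq> 0" for m
    proof -
      have "\<exists>k<size m. m0 = m - {#word_of m ! k#}"
      proof (rule ccontr)
        assume "\<not> ?thesis"
        then have "G m = 0" unfolding G_def by (intro sum.neutral) auto
        then show False using Gm by simp
      qed
      then obtain k where k: "k < size m" "m0 = m - {#word_of m ! k#}" by blast
      let ?x = "word_of m ! k"
      have x: "?x \<in># m" using k word_of_nth by blast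
      obtain j where "?x = (0, j)" using deg0[OF mr x] by (metis prod.collapse)
      moreover have "j \<le> B" using B[OF mr(1) x] calculation by simp
      moreover have "m = add_mset ?x m0" using k x by simp
      ultimately show ?thesis by auto
    qed
    have Gval: "G (add_mset (0, j) m0) = [:of_nat (Suc (count m0 (0, j))) * (- of_nat j * c (i + j - 1)):]" for j
    proof -
      let ?m = "add_mset (0, j) m0"
      have len: "length (word_of ?m) = size ?m" by (metis mset_sorted_list_of_multiset size_mset)
      have x: "m0 = ?m - {#x#} \<longleftrightarrow> x = (0, j)" if "x \<in># ?m" for x
        using that by (metis add_mset_remove_trivial insert_DiffM multi_self_add_other_not_self add_mset_add_single add_left_cancel single_eq_single)
      have "G ?m = (\<Sum>k<length (word_of ?m). if word_of ?m ! k = (0, j)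
          then [:letter_coef (1, i) (0, j) * chi (letter_br (1, i) (0, j)):] else 0)"
        unfolding G_def len by (intro sum.cong refl) (use x[OF word_of_nth] in \<open>auto simp del: letter_br.simps letter_coef.simps\<close>)
      also have "\<dots> = [:of_nat (Suc (count m0 (0, j))) * (letter_coef (1, i) (0, j) * chi (letter_br (1, i) (0, j))):]"
        unfolding sum_nth_count by (simp add: of_nat_poly flip: count_mset)
      also have "letter_coef (1, i) (0, j) * chi (letter_br (1, i) (0, j)) = - of_nat j * c (i + j - 1)"
        by (simp add: chi_def c_def)
      finally show ?thesis .
    qed
    define H where "H m = (if m \<in> K then ?l n m else 0) * G m" for m
    have "(\<Sum>m\<in>K. F i m m0) = (\<Sum>m\<in>K \<inter> ?S. H m)"
    proof (rule sum.mono_neutral_cong_right[OF finK])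
      show "\<forall>m\<in>K - K \<inter> ?S. F i m m0 = 0" using GS FG by auto
      fix m assume "m \<in> K \<inter> ?S"
      then show "F i m m0 = H m" using FG szm0 by (auto simp: H_def)
    qed simp
    also have "\<dots> = (\<Sum>m\<in>?S. H m)"
      by (rule sum.mono_neutral_left) (auto simp: H_def)
    also have "\<dots> = (\<Sum>j\<le>B. H (add_mset (0, j) m0))"
      by (rule sum.reindex_cong[of "\<lambda>j. add_mset (0, j) m0"]) (auto intro!: inj_onI)
    also have "\<dots> = (\<Sum>j\<le>B. [:c (i + j - 1):] * Q j)"
      by (intro sum.cong refl) (simp add: H_def Q_def Gval algebra_simps)
    finally show ?thesis using FJ by metis
  qed
  obtain g where g: "J = {p. g dvd p}" by (rule poly_ideal_principal[OF J])
  \<comment> \<open>Remainders modulo \<open>g\<close> are linear over \<complex>, so each power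
    \<open>k\<close> of the indeterminate gives one complex relation. Rows start at 1 and
    \<open>rel\<close> at \<open>B + 2\<close>, whence \<open>i = i' + B + 1\<close> and the shift
    \<open>B + 1\<close>; the columns are \<open>0..B\<close>, with
    \<open>B \<ge> j1 \<ge> 1\<close>.\<close>
  have "coeff (Q j1 mod g) k = 0" for k
  proof (rule good_character_relation[OF good, of B "B + 1" "\<lambda>j. coeff (Q j mod g) k"])
    fix i' :: nat assume i': "1 \<le> i'"
    define i where "i = i' + B + 1"
    have "(\<Sum>j\<le>B. [:c (i + j - 1):] * Q j) mod g = 0"
      using rel[of i] g i' by (simp add: i_def mod_eq_0_iff_dvd)
    moreover have mod_sum: "(\<Sum>j\<in>A. f j) mod g = (\<Sum>j\<in>A. f j mod g)" for f :: "nat \<Rightarrow> complex poly" and A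
      by (induction A rule: infinite_finite_induct) (auto simp: poly_mod_add_left)
    ultimately have "(\<Sum>j\<le>B. smult (c (i + j - 1)) (Q j mod g)) = 0"
      by (simp add: mod_smult_left)
    then have "coeff (\<Sum>j\<le>B. smult (c (i + j - 1)) (Q j mod g)) k = 0" by simp
    moreover have "hankel \<phi> (B + 1) i' j = c (i + j - 1)" for j
    proof -
      have "i' + j + (B + 1) - 1 = i + j - 1" by (simp add: i_def)
      then show ?thesis unfolding hankel_def c_def Let_def by (simp only:)
    qed
    ultimately show "(\<Sum>j\<le>B. coeff (Q j mod g) k * hankel \<phi> (B + 1) i' j) = 0"
      by (simp add: coeff_sum mult.commute)
  qed (use \<open>j1 \<noteq> 0\<close> \<open>j1 \<le> B\<close> in auto)
  then have "Q j1 mod g = 0" by (simp add: poly_eq_iff)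
  then have "Q j1 \<in> J" using g by (simp add: mod_eq_0_iff_dvd)
  then have "[:- of_nat j1 * of_nat (Suc (count m0 (0, j1))):] * ?l n m1 \<in> J"
    using m1(1) m1_eq by (simp only: Q_def if_True)
  \<comment> \<open>Here \<open>j1\<close> is nonzero because the variable \<open>(0, 0)\<close> is
    central and excluded by validity.\<close>
  moreover have "- of_nat j1 * of_nat (Suc (count m0 (0, j1))) \<noteq> (0 :: complex)"
    using \<open>j1 \<noteq> 0\<close> by (simp del: of_nat_Suc)
  ultimately have "?l n m1 \<in> J" by (rule poly_ideal_const_mult[OF J])
  then show False using m1(1) by (simp add: K_def)
qed

end

section \<open>Lifting polynomials to the enveloping algebra\<close>

lemma const_add: "const (a + b) = const a + const b"
  and const_mult: "const a * const b = const (a * b)"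
  and const_zero [simp]: "const 0 = 0"
  and const_one [simp]: "const 1 = 1"
  and const_minus: "const (- a) = - const a"
  by (simp_all add: const_def single_add mult_single single_uminus)

lemma const_commute: "const c * f = f * const c"
  by (induction f rule: poly_mapping_induct_add)
    (simp_all add: const_def mult_single mult.commute distrib_left distrib_right)

abbreviation gen_central :: "lieB free_alg"
  where "gen_central \<equiv> gen (xB 1 0)"

text \<open>Horner evaluation at \<open>gen_central\<close> in the free algebra itself: there it is
  already multiplicative, whereas commuting with other elements holds only modulo
  \<open>uea_ideal\<close>.\<close>

definition central_poly :: "complex poly \<Rightarrow> lieB free_alg"
  where "central_poly p = fold_coeffs (\<lambda>a f. const a + gen_central * f) p 0"

lemma central_poly_0 [simp]: "central_poly 0 = 0"
  by (simp add: central_poly_def)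

lemma central_poly_pCons: "central_poly (pCons a p) = const a + gen_central * central_poly p"
  by (cases "p = 0"; cases "a = 0") (simp_all add: central_poly_def)

lemma central_poly_const: "central_poly [:a:] = const a"
  by (simp add: central_poly_pCons)

lemma central_poly_one [simp]: "central_poly 1 = 1"
  by (simp add: one_pCons central_poly_const)

lemma central_poly_add: "central_poly (p + q) = central_poly p + central_poly q"
  by (induction p q rule: poly_induct2) (simp_all add: central_poly_pCons const_add algebra_simps)

lemma const_left_commute: "const c * (f * g) = f * (const c * g)"
  by (metis const_commute mult.assoc)

lemma central_poly_smult: "central_poly (smult a p) = const a * central_poly p"
  by (induction p)
    (simp_all add: central_poly_pCons distrib_left const_mult const_left_commute[of a gen_central])

lemma central_poly_mult: "central_poly (p * q) = central_poly p * central_poly q"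
  by (induction p)
    (simp_all add: central_poly_pCons central_poly_add central_poly_smult distrib_right mult.assoc)

lemma central_poly_minus: "central_poly (- p) = - central_poly p"
  using central_poly_smult[of "- 1" p] by (simp add: const_minus)

lemma central_poly_monom_Suc: "central_poly (monom 1 (Suc k)) = gen_central * central_poly (monom 1 k)"
  by (simp add: monom_Suc central_poly_pCons)

lemma uea_ideal_UNIV_closed:
  shows "0 \<in> uea_ideal UNIV"
    and "f \<in> uea_ideal UNIV \<Longrightarrow> g \<in> uea_ideal UNIV \<Longrightarrow> f + g \<in> uea_ideal UNIV"
    and "f \<in> uea_ideal UNIV \<Longrightarrow> - f \<in> uea_ideal UNIV"
    and "f \<in> uea_ideal UNIV \<Longrightarrow> h * f \<in> uea_ideal UNIV"
    and "f \<in> uea_ideal UNIV \<Longrightarrow> f * h \<in> uea_ideal UNIV"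
  using zero_in_uea_ideal[OF lie_subspace_UNIV] uea_ideal_closed[OF lie_subspace_UNIV] by auto

lemma gen_zero_in_ideal: "gen 0 \<in> uea_ideal UNIV"
proof -
  have "gen (0 + 0) - (gen 0 + gen 0) \<in> uea_ideal UNIV"
    by (rule uea_relations_in_ideal[OF lie_subspace_UNIV]) (unfold uea_relations_def, blast)
  from uea_ideal_UNIV_closed(3)[OF this] show ?thesis by simp
qed

lemma gen_add_in_ideal: "gen (y + z) - (gen y + gen z) \<in> uea_ideal UNIV"
  and gen_scaleB_in_ideal: "gen (c *\<^sub>B y) - const c * gen y \<in> uea_ideal UNIV"
  and gen_bracket_in_ideal: "gen y * gen z - gen z * gen y - gen (bracket y z) \<in> uea_ideal UNIV"
  by (rule uea_relations_in_ideal[OF lie_subspace_UNIV]; unfold uea_relations_def; blast)+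

lemma bracket_central: "bracket (xB 1 0) y = 0"
  by (simp add: bracket_def xB_def case_prod_unfold)

lemma gen_central_commute: "gen_central * g - g * gen_central \<in> uea_ideal UNIV"
proof (induction g rule: poly_mapping_induct_add)
  case zero
  then show ?case using uea_ideal_UNIV_closed(1) by simp
next
  case (add f g)
  then show ?case using uea_ideal_UNIV_closed(2)[OF add] by (simp add: algebra_simps)
next
  case (single u c)
  have gen: "gen_central * gen y - gen y * gen_central \<in> uea_ideal UNIV" for y
    using uea_ideal_UNIV_closed(2)[OF gen_bracket_in_ideal[of "xB 1 0" y] gen_zero_in_ideal]
    by (simp add: bracket_central)
  have "gen_central * Poly_Mapping.single (Free_Monoid ys) c - Poly_Mapping.single (Free_Monoid ys) c * gen_central
      \<in> uea_ideal UNIV" for ys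
  proof (induction ys)
    case Nil
    have "Poly_Mapping.single (Free_Monoid []) c = (const c :: lieB free_alg)"
      by (simp add: const_def zero_free_monoid_def)
    then show ?case using uea_ideal_UNIV_closed(1) by (simp add: const_commute)
  next
    case (Cons y ys)
    let ?w = "Poly_Mapping.single (Free_Monoid ys) c"
    have w: "Poly_Mapping.single (Free_Monoid (y # ys)) c = gen y * ?w"
      by (simp add: gen_def mult_single plus_free_monoid_def)
    have "(gen_central * gen y - gen y * gen_central) * ?w + gen y * (gen_central * ?w - ?w * gen_central)
        \<in> uea_ideal UNIV"
      by (intro uea_ideal_UNIV_closed gen Cons)
    then show ?case unfolding w by (simp add: algebra_simps)
  qed
  from this[of "letters u"] show ?case by simp
qed

lemma central_poly_commute: "central_poly p * g - g * central_poly p \<in> uea_ideal UNIV"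
proof (induction p)
  case 0
  then show ?case using uea_ideal_UNIV_closed(1) by simp
next
  case (pCons a p)
  have "gen_central * (central_poly p * g - g * central_poly p)
      + (gen_central * g - g * gen_central) * central_poly p \<in> uea_ideal UNIV"
    by (intro uea_ideal_UNIV_closed gen_central_commute pCons.IH)
  then show ?case by (simp add: central_poly_pCons algebra_simps const_commute)
qed

definition letter_word :: "letter list \<Rightarrow> lieB free_alg"
  where "letter_word w = foldr (\<lambda>x f. gen (letter_vec x) * f) w 1"

lemma letter_word_simps [simp]:
  "letter_word [] = 1" "letter_word (x # w) = gen (letter_vec x) * letter_word w"
  by (simp_all add: letter_word_def)

lemma letter_word_append: "letter_word (u @ v) = letter_word u * letter_word v"
  by (induction u) (simp_all add: mult.assoc)

text \<open>Monomials go to their sorted words, so \<open>lift (act g 1)\<close> is the normal form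
  of \<open>g\<close>.\<close>

definition lift :: "sym \<Rightarrow> lieB free_alg"
  where "lift n = ext (\<lambda>m p. central_poly p * letter_word (sorted_list_of_multiset m)) n"

lemma lift_add: "lift (m + n) = lift m + lift n"
  unfolding lift_def by (rule ext_add) (simp add: central_poly_add distrib_right)

lemma lift_zero [simp]: "lift 0 = 0"
  by (simp add: lift_def)

lemma lift_single:
  "lift (Poly_Mapping.single m p) = central_poly p * letter_word (sorted_list_of_multiset m)"
  by (simp add: lift_def ext_single)

lemma lift_pscale: "lift (pscale p n) = central_poly p * lift n"
  by (induction n rule: poly_mapping_induct_add)
    (simp_all add: lift_single lift_add pscale_add central_poly_mult mult.assoc distrib_left)

lemma lift_one: "lift 1 = 1"
  using lift_single[of "{#}" 1] by (simp flip: zero_multiset_def)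

context lie_char
begin

text \<open>A left ideal containing the relations of the enveloping algebra and the products
  \<open>g (y - \<phi> y)\<close> with \<open>y \<in> \<nn>\<close> is closed under all straightening steps.\<close>

lemma sub_lift_act_mem:
  assumes ideal: "uea_ideal UNIV \<subseteq> G"
    and add: "\<And>f g. f \<in> G \<Longrightarrow> g \<in> G \<Longrightarrow> f + g \<in> G"
    and left: "\<And>f h. f \<in> G \<Longrightarrow> h * f \<in> G"
    and whittaker: "\<And>g y. y \<in> \<nn> \<Longrightarrow> g * gen y - g * const (\<phi> y) \<in> G"
  shows "g - lift (act g 1) \<in> G"
proof -
  note idl = uea_ideal_UNIV_closed
  have zero: "0 \<in> G" using ideal idl(1) by blast
  \<comment> \<open>The counterpart of \<open>normal_value\<close>: central letters move to the
    front, modulo \<open>uea_ideal\<close> only.\<close>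
  have central_front: "letter_word w - central_poly (monom 1 (count_list w central))
      * letter_word (filter (\<lambda>x. x \<noteq> central) w) \<in> uea_ideal UNIV" for w
  proof (induction w)
    case Nil
    then show ?case using idl(1) by (simp add: monom_0 flip: one_pCons)
  next
    case (Cons a w)
    let ?p = "central_poly (monom 1 (count_list w central))" and ?f = "letter_word (filter (\<lambda>x. x \<noteq> central) w)"
    have 1: "gen (letter_vec a) * (letter_word w - ?p * ?f) \<in> uea_ideal UNIV"
      by (rule idl(4)[OF Cons])
    show ?case
    proof (cases "a = central")
      case True
      then show ?thesis using 1 by (simp add: central_poly_monom_Suc algebra_simps)
    next
      case False
      have "gen (letter_vec a) * (letter_word w - ?p * ?f)
          + - ((?p * gen (letter_vec a) - gen (letter_vec a) * ?p) * ?f) \<in> uea_ideal UNIV"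
        by (intro idl 1 central_poly_commute)
      then show ?thesis using False by (simp add: algebra_simps)
    qed
  qed
  have word: "letter_word w - lift (straighten w) \<in> G" for w
  proof (induction w rule: straighten_induct)
    case (snoc_pos u x)
    have "(letter_word u * gen (letter_vec x) - letter_word u * const (chi x))
        + const (chi x) * (letter_word u - lift (straighten u)) \<in> G"
      by (intro add left snoc_pos(2) whittaker[OF letter_vec_in_n[OF snoc_pos(1)], folded chi_def])
    then show ?case
      by (simp add: letter_word_append straighten_snoc_pos[OF snoc_pos(1)] lift_pscale central_poly_const
          algebra_simps const_commute)
  next
    case (swap u x y v)
    let ?g = "\<lambda>x. gen (letter_vec x)" and ?b = "letter_br x y" and ?c = "const (letter_coef x y)"
    \<comment> \<open>The bracket of two letters is a multiple of a letter as a vector; to make it a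
      scalar times a generator, the scaling relation is needed besides the bracket relation.\<close>
    have "letter_word u * ((?g x * ?g y - ?g y * ?g x - gen (bracket (letter_vec x) (letter_vec y)))
        + (gen (letter_coef x y *\<^sub>B letter_vec ?b) - ?c * ?g ?b)) * letter_word v \<in> G"
      by (intro subsetD[OF ideal] idl gen_bracket_in_ideal gen_scaleB_in_ideal)
    moreover have "(letter_word (u @ y # x # v) - lift (straighten (u @ y # x # v)))
        + ?c * (letter_word (u @ ?b # v) - lift (straighten (u @ ?b # v))) \<in> G"
      by (intro add left swap)
    ultimately have "letter_word u * ((?g x * ?g y - ?g y * ?g x - gen (bracket (letter_vec x) (letter_vec y)))
        + (gen (letter_coef x y *\<^sub>B letter_vec ?b) - ?c * ?g ?b)) * letter_word v
      + ((letter_word (u @ y # x # v) - lift (straighten (u @ y # x # v)))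
        + ?c * (letter_word (u @ ?b # v) - lift (straighten (u @ ?b # v)))) \<in> G"
      by (rule add)
    moreover have "?c * (letter_word u * h) = letter_word u * (?c * h)" for h
      by (metis const_commute mult.assoc)
    ultimately show ?case
      by (simp add: straighten_swap[of u x y v] lift_add lift_pscale central_poly_const letter_word_append
          bracket_letter algebra_simps)
  next
    case (sorted w)
    have "sorted_list_of_multiset (mset (filter (\<lambda>y. y \<noteq> central) w)) = filter (\<lambda>y. y \<noteq> central) w"
      using sorted(1) by (simp add: sorted_list_of_multiset_mset sorted_wrt_filter sorted_sort_id
          flip: mset_filter)
    then show ?case
      using sorted subsetD[OF ideal central_front[of w]]
      by (simp add: straighten_sorted[of w] normal_value_def[of w] lift_single)
  qed
  \<comment> \<open>The coefficient \<open>central_poly p\<close> stands left of the word, so the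
    letter has to cross it before \<open>word\<close> applies.\<close>
  have letter: "gen (letter_vec x) * lift n - lift (rho x n) \<in> G" for x n
  proof (induction n rule: poly_mapping_induct_add)
    case (single m p)
    let ?w = "letter_word (word_of m)"
    have "- ((central_poly p * gen (letter_vec x) - gen (letter_vec x) * central_poly p) * ?w)
        + central_poly p * (letter_word (x # word_of m) - lift (straighten (x # word_of m))) \<in> G"
      by (intro add left word subsetD[OF ideal] idl central_poly_commute)
    then show ?case by (simp add: lift_single rho_single lift_pscale algebra_simps)
  next
    case (add f g)
    from assms(2)[OF add] show ?case by (simp add: lift_add rho_add algebra_simps)
  qed (simp add: zero)
  have vec: "gen y * lift n - lift (rho_vec y n) \<in> G" for y n
  proof (induction y rule: poly_mapping_induct_add)
    case zero
    then show ?case using subsetD[OF ideal idl(5)[OF gen_zero_in_ideal]] by simp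
  next
    case (single k c)
    let ?v = "letter_vec (letter_of k)"
    have "(gen (c *\<^sub>B ?v) - const c * gen ?v) * lift n
        + const c * (gen ?v * lift n - lift (rho (letter_of k) n)) \<in> G"
      by (intro add left letter subsetD[OF ideal] idl gen_scaleB_in_ideal)
    then show ?case
      by (simp add: letter_of_inverse scaleB_single rho_vec_single lift_pscale central_poly_const algebra_simps)
  next
    case (add y z)
    have "(gen (y + z) - (gen y + gen z)) * lift n
        + ((gen y * lift n - lift (rho_vec y n)) + (gen z * lift n - lift (rho_vec z n))) \<in> G"
      by (intro assms(2) add subsetD[OF ideal] idl gen_add_in_ideal)
    then show ?case by (simp add: lift_add rho_vec_add_left algebra_simps)
  qed
  show ?thesis
  proof (induction g rule: poly_mapping_induct_add)
    case (single u c)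
    have "Poly_Mapping.single (Free_Monoid ys) 1 - lift (act (Poly_Mapping.single (Free_Monoid ys) 1) 1) \<in> G" for ys
    proof (induction ys)
      case Nil
      have "Poly_Mapping.single (Free_Monoid []) 1 = (1 :: lieB free_alg)"
        by (simp flip: zero_free_monoid_def)
      then show ?case using zero by (simp add: lift_one)
    next
      case (Cons y ys)
      let ?w = "Poly_Mapping.single (Free_Monoid ys) 1"
      have w: "Poly_Mapping.single (Free_Monoid (y # ys)) 1 = gen y * ?w"
        by (simp add: gen_def mult_single plus_free_monoid_def)
      have "gen y * (?w - lift (act ?w 1)) + (gen y * lift (act ?w 1) - lift (rho_vec y (act ?w 1))) \<in> G"
        by (intro add left vec Cons)
      then show ?case unfolding w by (simp add: act_mult algebra_simps)
    qed
    from left[OF this[of "letters u"], of "const c"]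
    have "const c * Poly_Mapping.single u 1 - const c * lift (act (Poly_Mapping.single u 1) 1) \<in> G"
      by (simp add: algebra_simps)
    moreover have "const c * Poly_Mapping.single u 1 = Poly_Mapping.single u c"
      by (simp add: const_def mult_single)
    moreover have "const c * lift (act (Poly_Mapping.single u 1) 1) = lift (act (const c * Poly_Mapping.single u 1) 1)"
      unfolding act_mult by (simp add: lift_pscale central_poly_const)
    ultimately show ?case by simp
  next
    case (add f g)
    from assms(2)[OF add] show ?case by (simp add: act_add_left lift_add algebra_simps)
  qed (simp add: zero)
qed

lemma act_central_poly:
  assumes "valid n"
  shows "act (central_poly p) n = pscale p n"
proof (induction p)
  case (pCons a p)
  have "xB 1 0 = letter_vec central" by simp
  then have "rho_vec (xB 1 0) k = rho central k" for k by (metis rho_vec_letter)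
  then show ?case
    by (simp add: central_poly_pCons act_add_left act_mult pCons.IH rho_central valid_pscale assms
        flip: pscale_add_left)
qed simp

end

section \<open>Quotient modules\<close>

text \<open>Every scalar acts by a group endomorphism. This passes to quotients by stable subgroups,
  so the same notion serves for the free group under the tensor product, for \<open>M_whit\<close>
  and for \<open>V_whit\<close>.\<close>

locale scalar_action = abelian_group M for M :: "('r, 'm) module" (structure) +
  fixes R :: "'r set"
  assumes smult_closed: "r \<in> R \<Longrightarrow> m \<in> carrier M \<Longrightarrow> r \<odot> m \<in> carrier M"
    and smult_add: "r \<in> R \<Longrightarrow> m \<in> carrier M \<Longrightarrow> n \<in> carrier M \<Longrightarrow> r \<odot> (m \<oplus> n) = r \<odot> m \<oplus> r \<odot> n"
begin

lemma smult_zero: "r \<in> R \<Longrightarrow> r \<odot> \<zero> = \<zero>"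
  using smult_add[of r \<zero> \<zero>] smult_closed[of r \<zero>] by (simp add: r_neg1 add.r_cancel_one')

lemma smult_minus:
  assumes "r \<in> R" "m \<in> carrier M"
  shows "r \<odot> (\<ominus> m) = \<ominus> (r \<odot> m)"
proof -
  have "r \<odot> (\<ominus> m) \<oplus> r \<odot> m = \<zero>"
    using assms smult_add[of r "\<ominus> m" m] smult_zero by (simp add: l_neg)
  then show ?thesis using assms by (intro minus_equality[symmetric]) (auto simp: smult_closed)
qed

lemma smult_diff:
  assumes "r \<in> R" "m \<in> carrier M" "n \<in> carrier M"
  shows "r \<odot> (m \<ominus> n) = r \<odot> m \<ominus> r \<odot> n"
  by (simp only: minus_eq smult_add[OF assms(1,2) a_inv_closed[OF assms(3)]] smult_minus[OF assms(1,3)])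

lemma additive_subgroup_generate:
  "S \<subseteq> carrier M \<Longrightarrow> additive_subgroup (generate (add_monoid M) S) M"
  by (intro additive_subgroupI group.generate_is_subgroup[OF a_group]) simp

lemma generate_minimal_additive:
  assumes "S \<subseteq> H" "additive_subgroup H M"
  shows "generate (add_monoid M) S \<subseteq> H"
  using group.generate_subgroup_incl[OF a_group assms(1)] additive_subgroup.a_subgroup[OF assms(2)] by blast

text \<open>The elements that \<open>r\<close> sends into the generated subgroup form a subgroup
  containing \<open>S\<close>.\<close>

lemma generate_smult_stable:
  assumes S: "S \<subseteq> carrier M" and r: "r \<in> R"
    and stable: "\<And>s. s \<in> S \<Longrightarrow> r \<odot> s \<in> generate (add_monoid M) S"
    and n: "n \<in> generate (add_monoid M) S"
  shows "r \<odot> n \<in> generate (add_monoid M) S"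
proof -
  interpret N: additive_subgroup "generate (add_monoid M) S" M
    by (rule additive_subgroup_generate[OF S])
  have "additive_subgroup {m \<in> carrier M. r \<odot> m \<in> generate (add_monoid M) S} M"
  proof (intro additive_subgroupI add.subgroupI)
    show "{m \<in> carrier M. r \<odot> m \<in> generate (add_monoid M) S} \<noteq> {}"
      using smult_zero[OF r] N.zero_closed by force
  qed (auto simp: smult_add[OF r] smult_minus[OF r])
  from generate_minimal_additive[OF _ this] show ?thesis using S stable n by blast
qed

end

locale action_quotient = scalar_action +
  fixes N
  assumes sub: "additive_subgroup N M"
    and stable: "r \<in> R \<Longrightarrow> n \<in> N \<Longrightarrow> r \<odot> n \<in> N"
begin

sublocale abelian_subgroup N M
  by (rule abelian_subgroupI3[OF sub abelian_group_axioms])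

abbreviation Q where "Q \<equiv> quotient_module M N"

lemma carrier_Q: "carrier Q = (\<lambda>m. N +> m) ` carrier M"
  by (auto simp: quotient_module_def A_RCOSETS_def')

lemma coset_eq_iff:
  assumes "m \<in> carrier M" "n \<in> carrier M"
  shows "N +> m = N +> n \<longleftrightarrow> m \<ominus> n \<in> N"
proof -
  have "N +> m = N +> n \<longleftrightarrow> m \<in> N +> n"
    using assms a_rcos_self a_repr_independence[OF _ _ a_subgroup] by metis
  then show ?thesis using assms a_rcos_module by (simp only: minus_eq)
qed

lemma add_Q: "m \<in> carrier M \<Longrightarrow> n \<in> carrier M \<Longrightarrow> (N +> m) \<oplus>\<^bsub>Q\<^esub> (N +> n) = N +> (m \<oplus> n)"
  by (simp add: quotient_module_def a_rcos_sum)

lemma zero_Q: "\<zero>\<^bsub>Q\<^esub> = N"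
  by (simp add: quotient_module_def)

text \<open>Stability of \<open>N\<close> makes all cosets in the union of
  \<open>quotient_module\<close> equal.\<close>

lemma smult_Q:
  assumes "r \<in> R" "m \<in> carrier M"
  shows "r \<odot>\<^bsub>Q\<^esub> (N +> m) = N +> (r \<odot> m)"
proof -
  have "N +> (r \<odot> m') = N +> (r \<odot> m)" if "m' \<in> N +> m" for m'
  proof -
    have m': "m' \<in> carrier M" using that assms(2) a_subset a_r_coset_subset_G by blast
    have "m' \<ominus> m \<in> N" using that a_rcos_module[OF assms(2) m'] by (simp only: minus_eq)
    from stable[OF assms(1) this] have "r \<odot> m' \<ominus> r \<odot> m \<in> N"
      by (simp only: smult_diff[OF assms(1) m' assms(2)])
    then show ?thesis using assms m' by (simp add: coset_eq_iff smult_closed)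
  qed
  then have "(\<Union>m'\<in>N +> m. N +> (r \<odot> m')) = N +> (r \<odot> m)"
    by (intro UN_constant_eq[OF a_rcos_self[OF assms(2)]] ballI)
  then show ?thesis by (simp add: quotient_module_def)
qed

lemma scalar_action_Q: "scalar_action Q R"
proof -
  have zero: "\<zero>\<^bsub>Q\<^esub> = N +> \<zero>"
    using a_coset_add_zero[OF a_subset] by (simp add: zero_Q)
  have "abelian_group Q"
  proof (rule abelian_groupI)
    fix x assume "x \<in> carrier Q"
    then obtain m where m: "m \<in> carrier M" "x = N +> m" by (auto simp: carrier_Q)
    have "\<ominus> m \<in> carrier M" using m(1) by (rule abelian_group.a_inv_closed[OF abelian_group_axioms])
    then show "\<exists>y\<in>carrier Q. y \<oplus>\<^bsub>Q\<^esub> x = \<zero>\<^bsub>Q\<^esub>"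
      using m by (intro bexI[of _ "N +> (\<ominus> m)"]) (auto simp: add_Q zero carrier_Q l_neg)
  qed (auto simp: carrier_Q add_Q zero a_ac)
  then interpret Q: abelian_group Q .
  show ?thesis
    by unfold_locales (auto simp: carrier_Q smult_Q add_Q smult_closed smult_add)
qed

end

section \<open>The tensor product and its image among the polynomials\<close>

context lie_char
begin

abbreviation TF where "TF \<equiv> tensor_free UB (C_mod \<phi>)"
abbreviation TK where "TK \<equiv> tensor_kernel (\<U> \<nn>) UB uea_inclusion (C_mod \<phi>)"
abbreviation cls where "cls \<equiv> uea_class UNIV"
abbreviation relations where "relations \<equiv> tensor_relations (\<U> \<nn>) UB uea_inclusion (C_mod \<phi>)"

lemma UB_simps [simp]:
  "cls f \<otimes>\<^bsub>UB\<^esub> cls g = cls (f * g)" "cls f \<oplus>\<^bsub>UB\<^esub> cls g = cls (f + g)"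
  "\<one>\<^bsub>UB\<^esub> = cls 1"
  by (simp_all add: uea_mult uea_add uea_one lie_subspace_UNIV)

lemma carrier_UB: "carrier UB = range cls"
  by (auto simp: carrier_uea)

lemma cls_in_UB [simp]: "cls f \<in> carrier UB"
  by (simp add: carrier_UB)

lemma cls_eq_iff: "cls f = cls g \<longleftrightarrow> f - g \<in> uea_ideal UNIV"
  by (simp add: uea_class_eq_iff lie_subspace_UNIV)

lemma TF_simps [simp]:
  "carrier TF = {f. Poly_Mapping.keys f \<subseteq> carrier UB \<times> UNIV}"
  "f \<oplus>\<^bsub>TF\<^esub> g = f + g" "\<zero>\<^bsub>TF\<^esub> = 0"
  "s \<odot>\<^bsub>TF\<^esub> f = frag_extend (\<lambda>(t, n). frag_of (s \<otimes>\<^bsub>UB\<^esub> t, n)) f"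
  by (simp_all add: tensor_free_def C_mod_def)

lemma abelian_group_TF: "abelian_group TF"
proof (rule abelian_groupI)
  fix x assume "x \<in> carrier TF"
  then show "\<exists>y\<in>carrier TF. y \<oplus>\<^bsub>TF\<^esub> x = \<zero>\<^bsub>TF\<^esub>"
    by (intro bexI[of _ "- x"]) auto
qed (use keys_add in \<open>fastforce simp: algebra_simps\<close>)+

sublocale TF: scalar_action TF "carrier UB"
proof -
  interpret abelian_group TF by (rule abelian_group_TF)
  interpret UB: ring UB by (rule ring_uea[OF lie_subspace_UNIV])
  show "scalar_action TF (carrier UB)"
  proof unfold_locales
    fix s f assume s: "s \<in> carrier UB" and f: "f \<in> carrier TF"
    have "Poly_Mapping.keys (frag_extend (\<lambda>(t, n). frag_of (s \<otimes>\<^bsub>UB\<^esub> t, n)) f)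
        \<subseteq> (\<Union>x\<in>Poly_Mapping.keys f. Poly_Mapping.keys (case x of (t, n) \<Rightarrow> frag_of (s \<otimes>\<^bsub>UB\<^esub> t, n)))"
      by (rule keys_frag_extend)
    also have "\<dots> \<subseteq> carrier UB \<times> UNIV"
      using s f UB.m_closed by fastforce
    finally show "s \<odot>\<^bsub>TF\<^esub> f \<in> carrier TF" by simp
  qed (simp add: frag_extend_add)
qed

lemma a_inv_TF: "f \<in> carrier TF \<Longrightarrow> \<ominus>\<^bsub>TF\<^esub> f = - f"
  by (rule TF.minus_equality) auto

lemma minus_TF: "f \<in> carrier TF \<Longrightarrow> g \<in> carrier TF \<Longrightarrow> f \<ominus>\<^bsub>TF\<^esub> g = f - g"
  by (simp only: TF.minus_eq a_inv_TF) simp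

lemma C_mod_simps [simp]:
  "carrier (C_mod \<phi>) = UNIV" "m \<oplus>\<^bsub>C_mod \<phi>\<^esub> n = m + n"
  "u \<odot>\<^bsub>C_mod \<phi>\<^esub> c = uea_character \<phi> u * c"
  by (simp_all add: C_mod_def)

text \<open>Restates the relations through representatives in the free algebra, where
  \<open>act\<close> and \<open>char_value\<close> can be computed.\<close>

lemma relations_cases:
  assumes "x \<in> relations"
  obtains (add_left) f g c where "x = frag_of (cls (f + g), c) - (frag_of (cls f, c) + frag_of (cls g, c))"
    | (add_right) f c d where "x = frag_of (cls f, c + d) - (frag_of (cls f, c) + frag_of (cls f, d))"
    | (balanced) f r c where "r \<in> carrier (free_algebra \<nn>)"
        "x = frag_of (cls (f * r), c) - frag_of (cls f, char_value r * c)"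
proof -
  from assms consider
    s t c where "s \<in> carrier UB" "t \<in> carrier UB" "x = frag_of (s \<oplus>\<^bsub>UB\<^esub> t, c) - (frag_of (s, c) + frag_of (t, c))"
  | s c d where "s \<in> carrier UB" "x = frag_of (s, c \<oplus>\<^bsub>C_mod \<phi>\<^esub> d) - (frag_of (s, c) + frag_of (s, d))"
  | s r c where "s \<in> carrier UB" "r \<in> carrier (\<U> \<nn>)"
      "x = frag_of (s \<otimes>\<^bsub>UB\<^esub> uea_inclusion r, c) - frag_of (s, r \<odot>\<^bsub>C_mod \<phi>\<^esub> c)"
    unfolding tensor_relations_def by blast
  then show thesis
  proof cases
    case (1 s t c)
    then obtain f g where "s = cls f" "t = cls g" by (auto simp: carrier_UB)
    then show ?thesis using 1 add_left by simp
  next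
    case (2 s c d)
    then obtain f where "s = cls f" by (auto simp: carrier_UB)
    then show ?thesis using 2 add_right by simp
  next
    case (3 s r c)
    then obtain f g where "s = cls f" "r = uea_class \<nn> g" "g \<in> carrier (free_algebra \<nn>)"
      by (auto simp: carrier_UB carrier_uea[of \<nn>])
    then show ?thesis using 3 balanced by (simp add: uea_inclusion_class uea_character_class)
  qed
qed

lemma relationsI:
  shows "frag_of (cls (f + g), c) - (frag_of (cls f, c) + frag_of (cls g, c)) \<in> relations"
    and "frag_of (cls f, c + d) - (frag_of (cls f, c) + frag_of (cls f, d)) \<in> relations"
    and "r \<in> carrier (free_algebra \<nn>) \<Longrightarrow>
      frag_of (cls (f * r), c) - frag_of (cls f, char_value r * c) \<in> relations"
proof -
  have c: "c \<in> carrier (C_mod \<phi>)" for c by simp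
  have "frag_of (cls f \<oplus>\<^bsub>UB\<^esub> cls g, c) - (frag_of (cls f, c) + frag_of (cls g, c)) \<in> relations"
    unfolding tensor_relations_def using cls_in_UB c by blast
  then show "frag_of (cls (f + g), c) - (frag_of (cls f, c) + frag_of (cls g, c)) \<in> relations" by simp
  have "frag_of (cls f, c \<oplus>\<^bsub>C_mod \<phi>\<^esub> d) - (frag_of (cls f, c) + frag_of (cls f, d)) \<in> relations"
    unfolding tensor_relations_def using cls_in_UB c by blast
  then show "frag_of (cls f, c + d) - (frag_of (cls f, c) + frag_of (cls f, d)) \<in> relations" by simp
  assume r: "r \<in> carrier (free_algebra \<nn>)"
  then have "uea_class \<nn> r \<in> carrier (\<U> \<nn>)" by (simp add: carrier_uea)
  then have "frag_of (cls f \<otimes>\<^bsub>UB\<^esub> uea_inclusion (uea_class \<nn> r), c)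
      - frag_of (cls f, uea_class \<nn> r \<odot>\<^bsub>C_mod \<phi>\<^esub> c) \<in> relations"
    unfolding tensor_relations_def using cls_in_UB c by blast
  then show "frag_of (cls (f * r), c) - frag_of (cls f, char_value r * c) \<in> relations"
    using r by (simp add: uea_inclusion_class uea_character_class)
qed

lemma char_value_gen: "char_value (gen y) = \<phi> y"
  by (simp add: char_value_def gen_def)

lemma char_value_const: "char_value (const c) = c"
  by (cases "c = 0") (simp_all add: char_value_def const_def letters_zero)

lemma relations_subset: "relations \<subseteq> carrier TF"
proof
  fix x assume "x \<in> relations"
  then show "x \<in> carrier TF"
    by (cases rule: relations_cases)
      (auto dest!: subsetD[OF keys_diff] subsetD[OF keys_add])
qed

lemma TK_eq: "TK = generate (add_monoid TF) relations"
  by (simp add: tensor_kernel_def)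

lemma relations_TK: "x \<in> relations \<Longrightarrow> x \<in> TK"
  unfolding TK_eq by (rule generate.incl)

sublocale TK: action_quotient TF "carrier UB" TK
proof (intro action_quotient.intro action_quotient_axioms.intro TF.scalar_action_axioms)
  show "additive_subgroup TK TF"
    unfolding TK_eq by (rule TF.additive_subgroup_generate[OF relations_subset])
  fix s n assume s: "s \<in> carrier UB" and n: "n \<in> TK"
  obtain h where h: "s = cls h" using s by (auto simp: carrier_UB)
  show "s \<odot>\<^bsub>TF\<^esub> n \<in> TK"
    using n unfolding TK_eq
  proof (rule TF.generate_smult_stable[OF relations_subset s, rotated])
    \<comment> \<open>Multiplication by \<open>cls h\<close> carries a relation to one of the same
      family, with each first factor multiplied by \<open>h\<close> from the left.\<close>
    fix x assume "x \<in> relations"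
    then show "s \<odot>\<^bsub>TF\<^esub> x \<in> generate (add_monoid TF) relations"
    proof (cases rule: relations_cases)
      case (add_left f g c)
      then show ?thesis using relations_TK[OF relationsI(1)[of "h * f" "h * g" c]]
        by (simp add: h TK_eq frag_extend_diff frag_extend_add distrib_left)
    next
      case (add_right f c d)
      then show ?thesis using relations_TK[OF relationsI(2)[of "h * f" c d]]
        by (simp add: h TK_eq frag_extend_diff frag_extend_add)
    next
      case (balanced f r c)
      then show ?thesis using relations_TK[OF relationsI(3)[of r "h * f" c]]
        by (simp add: h TK_eq frag_extend_diff mult.assoc)
    qed
  qed
qed

abbreviation M where "M \<equiv> M_whit \<phi>"

lemma M_eq: "M = quotient_module TF TK"
  by (simp add: M_whit_def tensor_module_def)

sublocale M: scalar_action M "carrier UB"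
  unfolding M_eq by (rule TK.scalar_action_Q)

lemma TK_closed:
  shows "f \<in> TK \<Longrightarrow> g \<in> TK \<Longrightarrow> f + g \<in> TK" "f \<in> TK \<Longrightarrow> g \<in> TK \<Longrightarrow> f - g \<in> TK" "0 \<in> TK"
proof -
  show add: "f + g \<in> TK" if "f \<in> TK" "g \<in> TK" for f g
    using TK.a_closed[OF that] by simp
  show "0 \<in> TK" using TK.zero_closed by simp
  have "- g \<in> TK" if "g \<in> TK" for g
    using TK.a_inv_closed[OF that] a_inv_TF[OF TK.a_Hcarr[OF that]] by simp
  then show "f - g \<in> TK" if "f \<in> TK" "g \<in> TK" using add[of f "- g"] that by simp
qed

text \<open>A tensor of \<open>g\<close> and \<open>c\<close> goes to \<open>c\<close> times the
  value of \<open>g\<close> on \<open>1\<close>. The chosen representative does not matter, since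
  \<open>uea_ideal UNIV\<close> acts as zero (\<open>Psi_frag_of\<close>).\<close>

definition Psi :: "(lieB free_alg set \<times> complex \<Rightarrow>\<^sub>0 int) \<Rightarrow> sym"
  where "Psi f = ext (\<lambda>(s, c) k. pscale [:of_int k * c:] (act (SOME g. s = cls g) 1)) f"

lemma Psi_add: "Psi (f + g) = Psi f + Psi g"
  unfolding Psi_def
  by (rule ext_add) (auto simp: algebra_simps simp flip: pscale_add_left)

lemma Psi_zero [simp]: "Psi 0 = 0"
  by (simp add: Psi_def)

lemma Psi_diff: "Psi (f - g) = Psi f - Psi g"
  using Psi_add[of "f - g" g] by simp

lemma Psi_frag_of: "Psi (frag_of (cls g, c)) = pscale [:c:] (act g 1)"
proof -
  have "cls g = cls (SOME h. cls g = cls h)" by (rule someI) simp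
  then have "act g 1 = act (SOME h. cls g = cls h) 1"
    using act_uea_ideal[of "g - (SOME h. cls g = cls h)" 1] by (simp add: cls_eq_iff act_diff_left)
  then show ?thesis
    by (simp add: Psi_def ext_def)
qed

lemma Psi_smult:
  assumes "f \<in> carrier TF"
  shows "Psi (cls h \<odot>\<^bsub>TF\<^esub> f) = act h (Psi f)"
proof -
  have "Poly_Mapping.keys f \<subseteq> carrier UB \<times> UNIV" using assms by simp
  then show ?thesis
  proof (induction f rule: frag_induction)
    case (one x)
    then obtain g c where "x = (cls g, c)" by (auto simp: carrier_UB)
    then show ?case by (simp add: Psi_frag_of act_mult act_pscale)
  next
    case (diff a b)
    have "act h (m - n) = act h m - act h n" for m n
      using act_add[of h "m - n" n] by simp
    then show ?case using diff by (simp add: frag_extend_diff Psi_diff)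
  qed simp
qed

text \<open>The balanced relations are where it matters that \<open>1\<close> is a Whittaker vector:
  they are killed by \<open>act_char\<close>.\<close>

lemma Psi_TK:
  assumes "f \<in> TK"
  shows "Psi f = 0"
proof -
  have "additive_subgroup {f \<in> carrier TF. Psi f = 0} TF"
  proof (intro additive_subgroupI TF.add.subgroupI)
    show "{f \<in> carrier TF. Psi f = 0} \<noteq> {}" by (auto intro: exI[of _ 0])
    fix f assume "f \<in> {f \<in> carrier TF. Psi f = 0}"
    then show "\<ominus>\<^bsub>TF\<^esub> f \<in> {f \<in> carrier TF. Psi f = 0}"
      using Psi_diff[of 0 f] by (simp only: a_inv_TF mem_Collect_eq) simp
  next
    fix f g assume "f \<in> {f \<in> carrier TF. Psi f = 0}" "g \<in> {f \<in> carrier TF. Psi f = 0}"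
    then show "f \<oplus>\<^bsub>TF\<^esub> g \<in> {f \<in> carrier TF. Psi f = 0}"
      using keys_add[of f g] by (auto simp: Psi_add)
  qed auto
  moreover have "relations \<subseteq> {f \<in> carrier TF. Psi f = 0}"
  proof
    fix x assume x: "x \<in> relations"
    then have "Psi x = 0"
    proof (cases rule: relations_cases)
      case (add_left f g c)
      then show ?thesis by (simp add: Psi_diff Psi_add Psi_frag_of act_add_left pscale_add)
    next
      case (add_right f c d)
      then show ?thesis by (simp add: Psi_diff Psi_add Psi_frag_of flip: pscale_add_left)
    next
      case (balanced f r c)
      then show ?thesis by (simp add: Psi_diff Psi_frag_of act_mult act_char act_pscale mult.commute)
    qed
    then show "x \<in> {f \<in> carrier TF. Psi f = 0}" using x relations_subset by blast
  qed
  ultimately show ?thesis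
    using assms TF.generate_minimal_additive unfolding TK_eq by blast
qed

lemma frag_of_cls_add: "frag_of (cls (f + g), 1) - (frag_of (cls f, 1) + frag_of (cls g, 1)) \<in> TK"
  by (rule relations_TK[OF relationsI(1)])

text \<open>\<open>sub_lift_act_mem\<close> is applied to the left ideal of all \<open>g\<close>
  whose tensor with 1 vanishes.\<close>

lemma sub_lift_frag: "frag_of (cls (g - lift (act g 1)), 1) \<in> TK"
proof -
  define G where "G = {g. frag_of (cls g, 1) \<in> TK}"
  have "g - lift (act g 1) \<in> G"
  proof (rule sub_lift_act_mem)
    have zero: "0 \<in> G"
      using TK_closed(2)[OF TK_closed(3) frag_of_cls_add[of 0 0]] by (simp add: G_def)
    show "uea_ideal UNIV \<subseteq> G"
    proof
      fix f :: "lieB free_alg"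
      assume "f \<in> uea_ideal UNIV"
      then have "cls f = cls 0" by (simp add: cls_eq_iff)
      then show "f \<in> G" using zero by (simp add: G_def)
    qed
    show add: "f + g \<in> G" if "f \<in> G" "g \<in> G" for f g
      using TK_closed(1)[OF frag_of_cls_add[of f g] TK_closed(1)[of "frag_of (cls f, 1)" "frag_of (cls g, 1)"]] that
      by (simp add: G_def)
    show "h * f \<in> G" if "f \<in> G" for f h
      using TK.stable[of "cls h" "frag_of (cls f, 1)"] that by (simp add: G_def)
    fix g :: "lieB free_alg" and y :: lieB
    assume y: "y \<in> \<nn>"
    \<comment> \<open>The balanced relation is used for \<open>gen y\<close> and for
      \<open>const (\<phi> y)\<close>, which have the same \<open>char_value\<close>.\<close>
    have 1: "frag_of (cls (g * gen y), 1) - frag_of (cls g, char_value (gen y) * 1) \<in> TK"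
      by (rule relations_TK[OF relationsI(3)]) (use y in \<open>simp add: free_algebra_closed\<close>)
    have 2: "frag_of (cls (g * const (\<phi> y)), 1) - frag_of (cls g, char_value (const (\<phi> y)) * 1) \<in> TK"
      by (rule relations_TK[OF relationsI(3)]) (simp add: free_algebra_closed)
    let ?a = "g * gen y" and ?b = "g * const (\<phi> y)"
    have 3: "frag_of (cls ?a, 1) - frag_of (cls ?b, 1) \<in> TK"
      using TK_closed(2)[OF 1 2] by (simp add: char_value_gen char_value_const)
    have "frag_of (cls (?a - ?b + ?b), 1) - (frag_of (cls (?a - ?b), 1) + frag_of (cls ?b, 1)) \<in> TK"
      by (rule frag_of_cls_add)
    from TK_closed(2)[OF 3 this] show "?a - ?b \<in> G" by (simp add: G_def)
  qed
  then show ?thesis by (simp add: G_def)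
qed

text \<open>Together with \<open>Psi_TK\<close> this says that \<open>TK\<close> is exactly the
  kernel of \<open>Psi\<close>, so that questions on \<open>M\<close> become questions on
  polynomials.\<close>

lemma sub_lift_Psi:
  assumes "f \<in> carrier TF"
  shows "f - frag_of (cls (lift (Psi f)), 1) \<in> TK"
proof -
  have z: "frag_of (cls 0, 1) \<in> TK"
    using TK_closed(2)[OF TK_closed(3) frag_of_cls_add[of 0 0]] by simp
  have "Poly_Mapping.keys f \<subseteq> carrier UB \<times> UNIV" using assms by simp
  then show ?thesis
  proof (induction f rule: frag_induction)
    case zero
    show ?case using TK_closed(2)[OF TK_closed(3) z] by simp
  next
    case (one x)
    then obtain g c where x: "x = (cls g, c)" by (auto simp: carrier_UB)
    let ?g = "g * const c"
    \<comment> \<open>Balancing with a scalar moves \<open>c\<close> into the first factor, where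
      \<open>sub_lift_frag\<close> applies.\<close>
    have "frag_of (cls ?g, 1) - frag_of (cls g, char_value (const c) * 1) \<in> TK"
      by (rule relations_TK[OF relationsI(3)]) (simp add: free_algebra_closed)
    then have 1: "frag_of (cls ?g, 1) - frag_of (cls g, c) \<in> TK"
      by (simp add: char_value_const)
    have L: "act ?g 1 = Psi (frag_of x)"
      by (simp add: x Psi_frag_of act_mult act_pscale)
    have 2: "frag_of (cls ?g, 1) - (frag_of (cls (?g - lift (act ?g 1)), 1) + frag_of (cls (lift (act ?g 1)), 1)) \<in> TK"
      using frag_of_cls_add[of "?g - lift (act ?g 1)" "lift (act ?g 1)"] by simp
    from TK_closed(2)[OF TK_closed(1)[OF 2 sub_lift_frag[of ?g]] 1]
    show ?case by (simp add: x L[symmetric, unfolded x])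
  next
    case (diff a b)
    let ?A = "lift (Psi a)" and ?B = "lift (Psi b)"
    have "lift (Psi (a - b)) + ?B = ?A" by (simp add: Psi_diff flip: lift_add)
    then have "frag_of (cls ?A, 1) - (frag_of (cls (lift (Psi (a - b))), 1) + frag_of (cls ?B, 1)) \<in> TK"
      using frag_of_cls_add[of "lift (Psi (a - b))" ?B] by simp
    from TK_closed(1)[OF this TK_closed(2)[OF diff]] show ?case by simp
  qed
qed

abbreviation mk where "mk f \<equiv> TK +>\<^bsub>TF\<^esub> f"

lemma carrier_M: "carrier M = mk ` carrier TF"
  unfolding M_eq by (rule TK.carrier_Q)

lemma M_add: "f \<in> carrier TF \<Longrightarrow> g \<in> carrier TF \<Longrightarrow> mk f \<oplus>\<^bsub>M\<^esub> mk g = mk (f + g)"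
  using TK.add_Q[of f g] by (simp add: M_eq)

lemma M_smult: "f \<in> carrier TF \<Longrightarrow> cls h \<odot>\<^bsub>M\<^esub> mk f = mk (cls h \<odot>\<^bsub>TF\<^esub> f)"
  unfolding M_eq by (rule TK.smult_Q) auto

lemma mk_eq_iff: "f \<in> carrier TF \<Longrightarrow> g \<in> carrier TF \<Longrightarrow> mk f = mk g \<longleftrightarrow> f - g \<in> TK"
  by (simp only: TK.coset_eq_iff minus_TF)

lemma TF_closed:
  shows "f \<in> carrier TF \<Longrightarrow> g \<in> carrier TF \<Longrightarrow> f + g \<in> carrier TF"
    and "f \<in> carrier TF \<Longrightarrow> g \<in> carrier TF \<Longrightarrow> f - g \<in> carrier TF"
    and "0 \<in> carrier TF" and "frag_of (cls h, c) \<in> carrier TF"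
  using keys_add[of f g] keys_diff[of f g] by auto

lemma M_minus:
  assumes "f \<in> carrier TF" "g \<in> carrier TF"
  shows "mk f \<ominus>\<^bsub>M\<^esub> mk g = mk (f - g)"
proof -
  have c: "mk f \<in> carrier M" "mk g \<in> carrier M" "mk (f - g) \<in> carrier M"
    using assms TF_closed(2) carrier_M by blast+
  have "mk (f - g) \<oplus>\<^bsub>M\<^esub> mk g = mk f"
    using M_add[OF TF_closed(2)[OF assms] assms(2)] by simp
  then show ?thesis
    using c by (metis M.add.inv_solve_right M.minus_eq a_minus_def)
qed

lemma M_zero: "\<zero>\<^bsub>M\<^esub> = mk 0"
proof -
  have "mk 0 \<oplus>\<^bsub>M\<^esub> mk 0 = mk 0" using M_add[OF TF_closed(3) TF_closed(3)] by simp
  moreover have "mk 0 \<in> carrier M" using TF_closed(3) carrier_M by blast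
  ultimately show ?thesis by (metis M.add.r_cancel_one')
qed

end

section \<open>The quotient by an ideal of the central subalgebra\<close>

locale whittaker_quotient = lie_char +
  fixes I :: "lieB free_alg set set"
  assumes ideal_I: "ideal I (UB\<lparr>carrier := AZ\<rparr>)"
begin

abbreviation IM where "IM \<equiv> ideal_smult I M"
abbreviation V where "V \<equiv> V_whit \<phi> I"

lemma central_poly_AZ: "cls (central_poly p) \<in> AZ"
proof (induction p)
  case 0
  have "scalar 0 \<in> AZ" unfolding AZ_def by (intro generate_ring.incl) simp
  then show ?case by (simp add: scalar_def)
next
  case (pCons a p)
  have "scalar a \<oplus>\<^bsub>UB\<^esub> (lie_elt (xB 1 0) \<otimes>\<^bsub>UB\<^esub> cls (central_poly p)) \<in> AZ"
    using pCons.IH unfolding AZ_def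
    by (intro generate_ring.eng_add generate_ring.eng_mult) (auto intro: generate_ring.incl)
  then show ?case by (simp add: scalar_def lie_elt_def central_poly_pCons)
qed

lemma AZ_central_poly:
  assumes "r \<in> AZ"
  obtains p where "r = cls (central_poly p)"
proof -
  interpret UB: ring UB by (rule ring_uea[OF lie_subspace_UNIV])
  have "\<exists>p. r = cls (central_poly p)"
    using assms unfolding AZ_def
  proof (induction rule: generate_ring.induct)
    case one
    show ?case by (rule exI[of _ 1]) simp
  next
    case (incl h)
    then consider c where "h = scalar c" | "h = lie_elt (xB 1 0)" by auto
    then show ?case
    proof cases
      case 1
      then show ?thesis by (intro exI[of _ "[:c:]"]) (simp add: scalar_def central_poly_const)
    next
      case 2
      then show ?thesis by (intro exI[of _ "[:0, 1:]"]) (simp add: lie_elt_def central_poly_pCons)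
    qed
  next
    case (a_inv h)
    then obtain p where p: "h = cls (central_poly p)" by blast
    have "cls 0 = \<zero>\<^bsub>UB\<^esub>"
    proof -
      have "cls 0 \<oplus>\<^bsub>UB\<^esub> cls 0 = cls 0" by simp
      then show ?thesis by (metis UB.add.r_cancel_one' cls_in_UB)
    qed
    then have "cls (central_poly (- p)) \<oplus>\<^bsub>UB\<^esub> h = \<zero>\<^bsub>UB\<^esub>"
      by (simp add: p central_poly_minus)
    then have "\<ominus>\<^bsub>UB\<^esub> h = cls (central_poly (- p))"
      using p by (intro UB.minus_equality) auto
    then show ?case by blast
  next
    case (eng_add h1 h2)
    then obtain p q where "h1 = cls (central_poly p)" "h2 = cls (central_poly q)" by blast
    then show ?case by (intro exI[of _ "p + q"]) (simp add: central_poly_add)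
  next
    case (eng_mult h1 h2)
    then obtain p q where "h1 = cls (central_poly p)" "h2 = cls (central_poly q)" by blast
    then show ?case by (intro exI[of _ "p * q"]) (simp add: central_poly_mult)
  qed
  then show ?thesis using that by blast
qed

text \<open>The preimage of \<open>I\<close> in \<complex>[t]. Nothing of \<open>I\<close> is lost,
  since \<open>central_poly\<close> reaches every element of \<open>AZ\<close>
  (\<open>AZ_central_poly\<close>).\<close>

definition J :: "complex poly set"
  where "J = {p. cls (central_poly p) \<in> I}"

lemma I_subset: "I \<subseteq> AZ"
proof -
  interpret ideal I "UB\<lparr>carrier := AZ\<rparr>" by (rule ideal_I)
  show ?thesis using additive_subgroup.a_subset[OF is_additive_subgroup] by simp
qed

lemma poly_ideal_J: "poly_ideal J"
proof -
  interpret ideal I "UB\<lparr>carrier := AZ\<rparr>" by (rule ideal_I)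
  interpret UB: ring UB by (rule ring_uea[OF lie_subspace_UNIV])
  have mult: "cls (central_poly (q * p)) \<in> I" if "cls (central_poly p) \<in> I" for p q
    using I_l_closed[OF that, of "cls (central_poly q)"] central_poly_AZ by (simp add: central_poly_mult)
  moreover have "cls (central_poly (p + q)) \<in> I"
    if "cls (central_poly p) \<in> I" "cls (central_poly q) \<in> I" for p q
    using additive_subgroup.a_closed[OF is_additive_subgroup that] by (simp add: central_poly_add)
  moreover have "cls (central_poly 0) \<in> I"
  proof -
    obtain r where r: "r \<in> I" using additive_subgroup.zero_closed[OF is_additive_subgroup] by blast
    then obtain p where "r = cls (central_poly p)" using I_subset AZ_central_poly by blast
    then show ?thesis using mult[of p 0] r by simp
  qed
  ultimately show ?thesis by (auto simp: poly_ideal_def J_def)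
qed

lemma J_closed:
  "0 \<in> J" "p \<in> J \<Longrightarrow> q \<in> J \<Longrightarrow> p + q \<in> J" "p \<in> J \<Longrightarrow> q \<in> J \<Longrightarrow> p - q \<in> J" "p \<in> J \<Longrightarrow> q * p \<in> J"
proof -
  show *: "0 \<in> J" "p \<in> J \<Longrightarrow> q \<in> J \<Longrightarrow> p + q \<in> J" "p \<in> J \<Longrightarrow> q * p \<in> J" for p q
    using poly_ideal_J by (auto simp: poly_ideal_def)
  show "p \<in> J \<Longrightarrow> q \<in> J \<Longrightarrow> p - q \<in> J" using *(2)[of p "- q"] *(3)[of q "- 1"] by simp
qed

definition in_J :: "sym \<Rightarrow> bool"
  where "in_J n \<longleftrightarrow> (\<forall>m. Poly_Mapping.lookup n m \<in> J)"

lemma valid_Psi: "valid (Psi f)"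
  unfolding Psi_def ext_def
  by (intro valid_sum) (auto simp: case_prod_unfold intro!: valid_pscale valid_act valid_one)

lemma IM_generators:
  "{r \<odot>\<^bsub>M\<^esub> m | r m. r \<in> I \<and> m \<in> carrier M}
    = {mk (cls (central_poly p) \<odot>\<^bsub>TF\<^esub> f) | p f. p \<in> J \<and> f \<in> carrier TF}" (is "?L = ?R")
proof
  show "?L \<subseteq> ?R"
  proof
    fix x assume "x \<in> ?L"
    then obtain r m where x: "x = r \<odot>\<^bsub>M\<^esub> m" and r: "r \<in> I" and m: "m \<in> carrier M" by blast
    obtain p where p: "r = cls (central_poly p)" using r I_subset AZ_central_poly by blast
    obtain f where f: "m = mk f" "f \<in> carrier TF" using m carrier_M by blast
    have "x = mk (cls (central_poly p) \<odot>\<^bsub>TF\<^esub> f)" unfolding x p f(1) by (rule M_smult[OF f(2)])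
    then show "x \<in> ?R" using r p f(2) unfolding J_def by blast
  qed
  show "?R \<subseteq> ?L"
  proof
    fix x assume "x \<in> ?R"
    then obtain p f where x: "x = mk (cls (central_poly p) \<odot>\<^bsub>TF\<^esub> f)" and p: "p \<in> J" and f: "f \<in> carrier TF"
      by blast
    have "x = cls (central_poly p) \<odot>\<^bsub>M\<^esub> mk f" unfolding x by (rule M_smult[OF f, symmetric])
    then show "x \<in> ?L" using p f carrier_M unfolding J_def by blast
  qed
qed

lemma IM_eq:
  "IM = generate (add_monoid M) {mk (cls (central_poly p) \<odot>\<^bsub>TF\<^esub> f) | p f. p \<in> J \<and> f \<in> carrier TF}"
  by (simp only: ideal_smult_def IM_generators)

lemma generators_subset:
  "{mk (cls (central_poly p) \<odot>\<^bsub>TF\<^esub> f) | p f. p \<in> J \<and> f \<in> carrier TF} \<subseteq> carrier M"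
  using TF.smult_closed[OF cls_in_UB] carrier_M by blast

lemma additive_subgroup_IM: "additive_subgroup IM M"
  unfolding IM_eq by (rule M.additive_subgroup_generate[OF generators_subset])

text \<open>An element of \<open>I\<close> acts as multiplication by a polynomial in
  \<open>J\<close>, so the generators have coefficients in \<open>J\<close>, a condition stable
  under sums. The representative \<open>f\<close> may differ from the one found, but only by
  \<open>TK\<close>, which \<open>Psi\<close> ignores.\<close>

lemma IM_imp_in_J:
  assumes f: "f \<in> carrier TF" and "mk f \<in> IM"
  shows "in_J (Psi f)"
proof -
  let ?H = "mk ` {f \<in> carrier TF. in_J (Psi f)}"
  have "additive_subgroup ?H M"
  proof (intro additive_subgroupI M.add.subgroupI)
    show "?H \<subseteq> carrier M" using carrier_M by blast
    have "in_J (Psi 0)" by (simp add: in_J_def J_closed)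
    then have z: "mk 0 \<in> ?H" using TF_closed(3) by blast
    then show "?H \<noteq> {}" by blast
    fix a assume "a \<in> ?H"
    then obtain f where f: "a = mk f" "f \<in> carrier TF" "in_J (Psi f)" by blast
    have "\<ominus>\<^bsub>M\<^esub> a = \<zero>\<^bsub>M\<^esub> \<ominus>\<^bsub>M\<^esub> a"
      unfolding M.minus_eq using f carrier_M by (intro M.l_zero[symmetric] M.a_inv_closed) blast
    also have "\<dots> = mk (0 - f)"
      unfolding M_zero f(1) by (rule M_minus[OF TF_closed(3) f(2)])
    finally have "\<ominus>\<^bsub>M\<^esub> a = mk (0 - f)" .
    moreover have "in_J (Psi (0 - f))"
      unfolding Psi_diff using f(3) J_closed(3)[OF J_closed(1)] by (simp add: in_J_def)
    ultimately show "\<ominus>\<^bsub>M\<^esub> a \<in> ?H" using TF_closed(2)[OF TF_closed(3) f(2)] by blast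
    fix b assume "b \<in> ?H"
    then obtain g where g: "b = mk g" "g \<in> carrier TF" "in_J (Psi g)" by blast
    have "a \<oplus>\<^bsub>M\<^esub> b = mk (f + g)" unfolding f(1) g(1) by (rule M_add[OF f(2) g(2)])
    moreover have "in_J (Psi (f + g))"
      using f(3) g(3) J_closed(2) by (simp add: Psi_add in_J_def lookup_add)
    ultimately show "a \<oplus>\<^bsub>M\<^esub> b \<in> ?H" using TF_closed(1)[OF f(2) g(2)] by blast
  qed
  moreover have "{mk (cls (central_poly p) \<odot>\<^bsub>TF\<^esub> f) | p f. p \<in> J \<and> f \<in> carrier TF} \<subseteq> ?H"
  proof clarify
    fix p f assume p: "p \<in> J" and f: "f \<in> carrier TF"
    have "Psi (cls (central_poly p) \<odot>\<^bsub>TF\<^esub> f) = pscale p (Psi f)"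
      by (simp only: Psi_smult[OF f] act_central_poly[OF valid_Psi])
    then have "in_J (Psi (cls (central_poly p) \<odot>\<^bsub>TF\<^esub> f))"
      unfolding in_J_def by (metis J_closed(4) lookup_pscale mult.commute p)
    then show "mk (cls (central_poly p) \<odot>\<^bsub>TF\<^esub> f) \<in> ?H"
      using TF.smult_closed[OF cls_in_UB f] by blast
  qed
  ultimately have "IM \<subseteq> ?H" unfolding IM_eq by (intro M.generate_minimal_additive)
  then obtain g where g: "mk f = mk g" "g \<in> carrier TF" "in_J (Psi g)" using assms(2) by blast
  then have "f - g \<in> TK" using mk_eq_iff f by blast
  then have "Psi f = Psi g" using Psi_TK[of "f - g"] by (simp add: Psi_diff)
  then show ?thesis using g by simp
qed

text \<open>By \<open>sub_lift_Psi\<close> the element is a sum of sorted words multiplied by their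
  coefficients; each coefficient lies in \<open>J\<close>, so each summand is one of the
  generators.\<close>

lemma in_J_imp_IM:
  assumes f: "f \<in> carrier TF" and J: "in_J (Psi f)"
  shows "mk f \<in> IM"
proof -
  let ?e = "\<lambda>g. frag_of (cls g, 1 :: complex)"
  interpret IM: additive_subgroup IM M by (rule additive_subgroup_IM)
  have e_add: "mk (?e (g + h)) = mk (?e g) \<oplus>\<^bsub>M\<^esub> mk (?e h)" for g h
  proof -
    have "mk (?e (g + h)) = mk (?e g + ?e h)"
      using frag_of_cls_add[of g h] TF_closed(4) TF_closed(1)[OF TF_closed(4) TF_closed(4)] mk_eq_iff by blast
    also have "\<dots> = mk (?e g) \<oplus>\<^bsub>M\<^esub> mk (?e h)" by (rule M_add[symmetric]) (rule TF_closed(4))+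
    finally show ?thesis .
  qed
  have one: "mk (?e (central_poly p * g)) \<in> IM" if "p \<in> J" for p g
  proof -
    have "mk (cls (central_poly p) \<odot>\<^bsub>TF\<^esub> ?e g) \<in> IM"
      unfolding IM_eq by (rule generate.incl) (use that TF_closed(4) in blast)
    then show ?thesis by simp
  qed
  let ?n = "Psi f"
  have "mk (?e (lift (\<Sum>m\<in>A. Poly_Mapping.single m (Poly_Mapping.lookup ?n m)))) \<in> IM" if "finite A" for A
    using that
  proof (induction A)
    case empty
    show ?case using one[OF J_closed(1), of 0] by simp
  next
    case (insert m A)
    then show ?case using J one by (simp add: lift_add e_add lift_single in_J_def)
  qed
  from this[of "Poly_Mapping.keys ?n"] have "mk (?e (lift ?n)) \<in> IM"
    by (simp add: poly_mapping_sum_keys)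
  moreover have "mk f = mk (?e (lift ?n))"
    using sub_lift_Psi[OF f] mk_eq_iff[OF f TF_closed(4)] by blast
  ultimately show ?thesis by simp
qed

sublocale IM: action_quotient M "carrier UB" IM
proof (intro action_quotient.intro action_quotient_axioms.intro M.scalar_action_axioms)
  show "additive_subgroup IM M" by (rule additive_subgroup_IM)
  fix r n assume r: "r \<in> carrier UB" and n: "n \<in> IM"
  obtain f where f: "f \<in> carrier TF" "n = mk f"
    using additive_subgroup.a_subset[OF additive_subgroup_IM] n carrier_M by blast
  obtain h where h: "r = cls h" using r by (auto simp: carrier_UB)
  \<comment> \<open>Stability under the whole enveloping algebra is checked on polynomials: every
    letter acts linearly over \<complex>[t], so coefficients in \<open>J\<close> stay in
    \<open>J\<close>.\<close>
  have "in_J (Psi f)" using IM_imp_in_J f n by blast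
  moreover have "in_J (act h k)" if "in_J k" for k
  proof -
    have "in_J (rho_vec y k)" if "in_J k" for y k
      unfolding rho_vec_def ext_def in_J_def lookup_sum
      using that lookup_in_ideal[OF poly_ideal_J]
      by (intro allI poly_ideal_sum[OF poly_ideal_J]) (auto simp: in_J_def J_closed simp del: lookup_pscale)
    then have "in_J (foldr rho_vec ys k)" for ys
      using that by (induction ys) auto
    then show ?thesis
      unfolding act_def ext_def in_J_def lookup_sum
      by (intro allI poly_ideal_sum[OF poly_ideal_J]) (auto simp: in_J_def intro!: lookup_in_ideal[OF poly_ideal_J] simp del: lookup_pscale)
  qed
  ultimately have "in_J (Psi (cls h \<odot>\<^bsub>TF\<^esub> f))" by (simp only: Psi_smult[OF f(1)])
  then have "mk (cls h \<odot>\<^bsub>TF\<^esub> f) \<in> IM"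
    by (rule in_J_imp_IM[OF TF.smult_closed[OF cls_in_UB f(1)]])
  then show "r \<odot>\<^bsub>M\<^esub> n \<in> IM" unfolding h f(2) by (simp only: M_smult[OF f(1)])
qed

lemma V_eq: "V = quotient_module M IM"
  by (simp add: V_whit_def)

abbreviation mkV where "mkV f \<equiv> IM +>\<^bsub>M\<^esub> mk f"

lemma mkV_smult:
  assumes "f \<in> carrier TF"
  shows "cls h \<odot>\<^bsub>V\<^esub> mkV f = mkV (cls h \<odot>\<^bsub>TF\<^esub> f)"
  unfolding V_eq using assms carrier_M by (subst IM.smult_Q) (auto simp only: M_smult cls_in_UB image_eqI)

text \<open>Equality in \<open>V\<close> is equality of polynomials modulo \<open>J\<close>; this
  transfers the Whittaker condition to coefficients.\<close>

lemma mkV_eq_iff: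
  assumes "f \<in> carrier TF" "g \<in> carrier TF"
  shows "mkV f = mkV g \<longleftrightarrow> in_J (Psi f - Psi g)"
proof -
  have "mk f \<in> carrier M" "mk g \<in> carrier M" using assms carrier_M by blast+
  then have "mkV f = mkV g \<longleftrightarrow> mk (f - g) \<in> IM"
    using IM.coset_eq_iff M_minus[OF assms] by simp
  also have "\<dots> \<longleftrightarrow> in_J (Psi (f - g))"
    using IM_imp_in_J in_J_imp_IM TF_closed(2)[OF assms] by blast
  finally show ?thesis by (simp only: Psi_diff)
qed

lemma whittaker_vector_multiple:
  assumes good: "good_character \<phi>" and v: "whittaker_vector \<phi> V v"
  shows "\<exists>p\<in>AZ. v = p \<odot>\<^bsub>V\<^esub> w_quot \<phi> I"
proof -
  have "v \<in> carrier V" using v by (simp add: whittaker_vector_def)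
  then obtain f where f: "f \<in> carrier TF" "v = mkV f"
    unfolding V_eq IM.carrier_Q carrier_M by blast
  let ?n = "Psi f"
  have "in_J (shifted i ?n)" for i
  proof -
    let ?y = "letter_vec (1, i)"
    have "?y \<in> \<nn>" by (rule letter_vec_in_n) (simp add: letter_pos_def)
    then have "lie_elt ?y \<odot>\<^bsub>V\<^esub> v = scalar (\<phi> ?y) \<odot>\<^bsub>V\<^esub> v"
      using v by (simp only: whittaker_vector_def)
    then have "mkV (cls (gen ?y) \<odot>\<^bsub>TF\<^esub> f) = mkV (cls (const (\<phi> ?y)) \<odot>\<^bsub>TF\<^esub> f)"
      unfolding lie_elt_def scalar_def f(2) mkV_smult[OF f(1)] .
    then have "in_J (Psi (cls (gen ?y) \<odot>\<^bsub>TF\<^esub> f) - Psi (cls (const (\<phi> ?y)) \<odot>\<^bsub>TF\<^esub> f))"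
      using mkV_eq_iff TF.smult_closed[OF cls_in_UB f(1)] by blast
    then show ?thesis
      by (simp only: Psi_smult[OF f(1)] act_gen act_const rho_vec_letter shifted_def chi_def)
  qed
  then have J: "Poly_Mapping.lookup ?n m \<in> J" if "m \<noteq> {#}" for m
    using shifted_ideal_imp_ideal[OF good poly_ideal_J valid_Psi _ that] by (simp add: in_J_def)
  \<comment> \<open>Modulo \<open>J\<close> only the constant term in the variables survives, and as
    a polynomial in \<open>t\<close> it is the required element of \<open>AZ\<close>.\<close>
  let ?p = "Poly_Mapping.lookup ?n {#}"
  let ?g = "frag_of (cls (central_poly ?p), 1 :: complex)"
  have "Psi ?g = pscale ?p 1"
    by (simp only: Psi_frag_of act_central_poly[OF valid_one] pscale_pscale) (simp flip: one_pCons)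
  then have "in_J (?n - Psi ?g)"
    using J J_closed(1) by (auto simp: in_J_def lookup_minus lookup_one when_def zero_multiset_def[symmetric])
  then have "v = mkV ?g" unfolding f(2) using mkV_eq_iff f(1) TF_closed(4) by blast
  also have "?g = cls (central_poly ?p) \<odot>\<^bsub>TF\<^esub> frag_of (\<one>\<^bsub>UB\<^esub>, 1)" by simp
  also have "mkV \<dots> = cls (central_poly ?p) \<odot>\<^bsub>V\<^esub> mkV (frag_of (\<one>\<^bsub>UB\<^esub>, 1))"
    by (rule mkV_smult[symmetric]) simp
  also have "mkV (frag_of (\<one>\<^bsub>UB\<^esub>, 1)) = w_quot \<phi> I"
    by (simp only: w_quot_def w_whit_def pure_tensor_def)
  finally show ?thesis using central_poly_AZ by blast
qed

end

theorem lemma3p1: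
  fixes \<phi> :: "lieB \<Rightarrow> complex"
    and I :: "lieB free_alg set set"
    and v :: "whit set"
  assumes "good_character \<phi>"
    and "ideal I (UB\<lparr>carrier := AZ\<rparr>)"
    and "whittaker_vector \<phi> (V_whit \<phi> I) v"
  shows "\<exists>p\<in>AZ. v = p \<odot>\<^bsub>V_whit \<phi> I\<^esub> w_quot \<phi> I"
proof -
  interpret whittaker_quotient \<phi> I
    using assms
    by (intro whittaker_quotient.intro lie_char.intro whittaker_quotient_axioms.intro)
      (simp_all only: good_character_def)
  show ?thesis by (rule whittaker_vector_multiple[OF assms(1,3)])
qed

end
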